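(* Let $d \geq 2$, let $K$ be a field such that the characteristic of $K$ does not divide $d$, and let $K^{sep}$ be a separable closure of $K$. Let $t$ be a transcendental element over $K$, let $c \in K$, and let $\xi \in K^{sep}$ be a primitive $d$-th root of unity. Suppose that $f(x) = x^d + c \in K[x]$ is a post-critically infinite unicritical polynomial. Then the group $G_\infty(K, x^d+c, t)$ is regular branch, its Hausdorff dimension is $$\mathcal{H}(G_\infty(K,x^d+c,t)) = \frac{\log(d)}{\log(d!)},$$ and its fixed-point proportion is $$\mathrm{FPP}(G_\infty(K,x^d+c,t)) = \frac{\# \{a \in I : a-1 \in (\mathbb{Z}/d\mathbb{Z})^\times\}}{\Phi(d)},$$ where $I$ is the image of the map $\mathrm{Gal}(K(\xi)/K) \rightarrow (\mathbb{Z}/d\mathbb{Z})^\times$ given by $\sigma \mapsto a$ with $\sigma(\xi) = \xi^a$, and $\Phi$ is Euler's totient function. In the particular case where $K = \mathbb{Q}$, we have $$\mathrm{FPP}(G_\infty(\mathbb{Q},x^d+c,t)) = \prod_{p \mid d} \frac{p-2}{p-1},$$ where the product runs over the prime divisors $p$ of $d$. So, if $d$ is odd, the fixed-point proportion is positive.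
   Context: Trees. $T$ is the $d$-regular rooted tree, identified with the set of finite words over $\{1,\dots,d\}$ (root: empty word; children of $v$: the words $vx$). $\mathcal{L}_n$ is the $n$-th level (words of length $n$), and $\mathrm{Aut}(T)$ is the group of bijections of $T$ fixing the root and preserving adjacency. $\mathrm{St}(n)$ is the pointwise stabilizer of $\mathcal{L}_n$ and $\pi_n : \mathrm{Aut}(T) \to \mathrm{Aut}(T)/\mathrm{St}(n)$ is the projection (restriction of the action to the first $n$ levels). For $g \in \mathrm{Aut}(T)$ and $v \in T$, the section $g|_v \in \mathrm{Aut}(T)$ is defined by $g(vw) = g(v)\, g|_v(w)$ for all words $w$. For a subgroup $G \le \mathrm{Aut}(T)$: $$\mathrm{FPP}(G) = \lim_{n\to\infty} \frac{\#\{g \in \pi_n(G) : g \text{ fixes a vertex in } \mathcal{L}_n\}}{|\pi_n(G)|}, \qquad \mathcal{H}(G) = \liminf_{n\to\infty} \frac{\log|\pi_n(G)|}{\log|\pi_n(\mathrm{Aut}(T))|}.$$ $G$ is level-transitive if it acts transitively on $\mathcal{L}_n$ for every $n$. For a subgroup $B \le \mathrm{Aut}(T)$, put $B_1 = \{g \in \mathrm{St}(1) : g|_v \in B \text{ for all } v \in \mathcal{L}_1\}$. $G$ is regular branch if it is level-transitive and there is a subgroup $B$ of $G$ such that $B_1$ is a finite-index subgroup of $B$ and $B$ is a finite-index subgroup of $G$. Polynomials and Galois groups. The polynomial $f(x)=x^d+c$ is unicritical, with $0$ as its only (finite) critical point; it is post-critically infinite if $f^n(0) \neq f^m(0)$ for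 all $n \neq m$, where $f^n$ is the $n$-th iterate. Let $f^{-n}(t)$ be the set of preimages of $t$ under $f^n$ in a separable closure $K(t)^{sep}$ (it has $d^n$ elements) and $K_\infty(f) = K\left(\bigcup_{n \ge 0} f^{-n}(t)\right)$. Then $G_\infty(K,f,t) = \mathrm{Gal}(K_\infty(f)/K(t))$. It acts faithfully on the $d$-regular rooted tree whose $n$-th level is $f^{-n}(t)$, with $v$ at level $n$ joined to $w$ at level $n+1$ iff $f(w)=v$, and is thus viewed as a closed subgroup of $\mathrm{Aut}(T)$. The preimage tree is identified with $T$ as follows: the root is $t$; given the element $\alpha_{x_1\cdots x_{n-1}}$ at level $n-1$ (equal to $t$ when $n=1$), choose a $d$-th root $\alpha_{x_1\cdots x_{n-1}d} = \sqrt[d]{\alpha_{x_1\cdots x_{n-1}} - c}$ and set $\alpha_{x_1\cdots x_n} = \xi^{x_n}\alpha_{x_1\cdots x_{n-1}d}$ for $x_n \in \{1,\dots,d\}$; the element $\alpha_{x_1\cdots x_n}$ corresponds to the word $x_1\cdots x_n$.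
   Formalization: The denominator Φ(d) in the general FPP formula is replaced by #I, since the printed formula fails (e.g. d=5, K=Q(√5), c=1: true value 1/2, printed 1/4); the formula with Φ(d) is stated when #I=Φ(d). *)

theory Defs
  imports
    "HOL-Algebra.Algebraic_Closure_Type"
    "HOL-Algebra.Generated_Fields"
    "HOL-Algebra.Finite_Extensions"
    "HOL-Algebra.QuotRing"
    "HOL-Algebra.Bij"
    "HOL-Algebra.Coset"
    "HOL-Number_Theory.Residues"
    "HOL-Number_Theory.Totient"
    "HOL-Library.Extended_Real"
    "HOL-Library.Liminf_Limsup"
begin

section \<open>The \<open>d\<close>-regular rooted tree and its automorphisms\<close>

definition words :: "nat \<Rightarrow> nat list set" where
  "words d = lists {1..d}"

definition level :: "nat \<Rightarrow> nat \<Rightarrow> nat list set" where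
  "level d n = {v \<in> words d. length v = n}"

text \<open>Words grow on the right, so the children of \<open>v\<close> are the words \<open>v @ [x]\<close>.\<close>

definition adjacent :: "nat list \<Rightarrow> nat list \<Rightarrow> bool" where
  "adjacent v w \<longleftrightarrow> (\<exists>x. w = v @ [x] \<or> v = w @ [x])"

definition Aut_tree :: "nat \<Rightarrow> (nat list \<Rightarrow> nat list) monoid" where
  "Aut_tree d = (BijGroup (words d))
     \<lparr>carrier := {g \<in> Bij (words d). g [] = [] \<and>
        (\<forall>v\<in>words d. \<forall>w\<in>words d. adjacent v w \<longleftrightarrow> adjacent (g v) (g w))}\<rparr>"

definition St :: "nat \<Rightarrow> nat \<Rightarrow> (nat list \<Rightarrow> nat list) set" where
  "St d n = {g \<in> carrier (Aut_tree d). \<forall>v\<in>level d n. g v = v}"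

text \<open>The projection onto \<open>Aut_tree d Mod St d n\<close>, whose elements are cosets.\<close>

definition proj :: "nat \<Rightarrow> nat \<Rightarrow> (nat list \<Rightarrow> nat list) \<Rightarrow> (nat list \<Rightarrow> nat list) set" where
  "proj d n g = St d n #>\<^bsub>Aut_tree d\<^esub> g"

text \<open>For a tree automorphism, \<open>g v\<close> is the prefix of \<open>g (v @ w)\<close> of length \<open>length v\<close>,
  so this is the solution of \<open>g (v @ w) = g v @ section_at d g v w\<close>.\<close>

definition section_at ::
    "nat \<Rightarrow> (nat list \<Rightarrow> nat list) \<Rightarrow> nat list \<Rightarrow> (nat list \<Rightarrow> nat list)" where
  "section_at d g v = (\<lambda>w\<in>words d. drop (length v) (g (v @ w)))"

text \<open>All elements of a coset of \<open>St d n\<close> act on \<open>level d n\<close> in the same way, so it does not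
  matter which representative is asked to fix the vertex.\<close>

definition fixed_ratio :: "nat \<Rightarrow> (nat list \<Rightarrow> nat list) set \<Rightarrow> nat \<Rightarrow> real" where
  "fixed_ratio d G n =
     real (card {C \<in> proj d n ` G. \<exists>g\<in>C. \<exists>v\<in>level d n. g v = v}) / real (card (proj d n ` G))"

definition FPP :: "nat \<Rightarrow> (nat list \<Rightarrow> nat list) set \<Rightarrow> real" where
  "FPP d G = lim (fixed_ratio d G)"

definition Hausdorff_dim :: "nat \<Rightarrow> (nat list \<Rightarrow> nat list) set \<Rightarrow> ereal" where
  "Hausdorff_dim d G = liminf (\<lambda>n. ereal
     (ln (real (card (proj d n ` G))) / ln (real (card (proj d n ` carrier (Aut_tree d))))))"

definition level_transitive :: "nat \<Rightarrow> (nat list \<Rightarrow> nat list) set \<Rightarrow> bool" where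
  "level_transitive d G \<longleftrightarrow> (\<forall>n. \<forall>v\<in>level d n. \<forall>w\<in>level d n. \<exists>g\<in>G. g v = w)"

definition finite_index_subgroup :: "'g set \<Rightarrow> ('g, 'm) monoid_scheme \<Rightarrow> bool" where
  "finite_index_subgroup H G \<longleftrightarrow> subgroup H G \<and> finite (rcosets\<^bsub>G\<^esub> H)"

definition first_level_sections_in ::
    "nat \<Rightarrow> (nat list \<Rightarrow> nat list) set \<Rightarrow> (nat list \<Rightarrow> nat list) set" where
  "first_level_sections_in d B = {g \<in> St d 1. \<forall>v\<in>level d 1. section_at d g v \<in> B}"

definition regular_branch :: "nat \<Rightarrow> (nat list \<Rightarrow> nat list) set \<Rightarrow> bool" where
  "regular_branch d G \<longleftrightarrow> subgroup G (Aut_tree d) \<and> level_transitive d G \<and>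
     (\<exists>B. finite_index_subgroup B ((Aut_tree d)\<lparr>carrier := G\<rparr>) \<and>
          finite_index_subgroup (first_level_sections_in d B) ((Aut_tree d)\<lparr>carrier := B\<rparr>))"


section \<open>Fields inside an ambient field\<close>

text \<open>All fields are subfields of a field given as a type, seen as a ring via
  \<open>ring_of_type_algebra\<close>.\<close>

abbreviation adjoin :: "'a::field set \<Rightarrow> 'a set \<Rightarrow> 'a set" where
  "adjoin K S \<equiv> generate_field ring_of_type_algebra (K \<union> S)"

definition separable_over :: "'a::field set \<Rightarrow> 'a \<Rightarrow> bool" where
  "separable_over F x \<longleftrightarrow>
     (\<exists>p. p \<noteq> 0 \<and> (\<forall>i. poly.coeff p i \<in> F) \<and> coprime p (pderiv p) \<and> poly p x = 0)"

text \<open>The ambient field \<open>'a\<close> is a separable closure of its subfield \<open>F\<close>.\<close>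

definition ambient_separable_closure_of :: "'a::field set \<Rightarrow> bool" where
  "ambient_separable_closure_of F \<longleftrightarrow> (\<forall>x. separable_over F x) \<and>
     (\<forall>p :: 'a poly. Polynomial.degree p > 0 \<longrightarrow> coprime p (pderiv p) \<longrightarrow> (\<exists>x. poly p x = 0))"

text \<open>\<open>Gal M F\<close> is the Galois group of \<open>M\<close> over \<open>F\<close>; the maps are made extensional on \<open>M\<close>.\<close>

definition Gal :: "'a::field set \<Rightarrow> 'a set \<Rightarrow> ('a \<Rightarrow> 'a) set" where
  "Gal M F = {\<sigma> \<in> extensional M.
     \<sigma> \<in> ring_iso (ring_of_type_algebra\<lparr>carrier := M\<rparr>) (ring_of_type_algebra\<lparr>carrier := M\<rparr>) \<and>
     (\<forall>x\<in>F. \<sigma> x = x)}"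

definition primitive_root_of_unity :: "nat \<Rightarrow> 'a::field \<Rightarrow> bool" where
  "primitive_root_of_unity d \<xi> \<longleftrightarrow> \<xi> ^ d = 1 \<and> (\<forall>k. 0 < k \<and> k < d \<longrightarrow> \<xi> ^ k \<noteq> 1)"

text \<open>The image of \<open>Gal (K(\<xi>)) K\<close> in the unit group of the integers modulo \<open>d\<close>.
  Its cardinality is \<open>[K(\<xi>) : K]\<close>, a divisor of \<open>totient d\<close> that can be proper, e.g.
  for \<open>d = 5\<close> and \<open>K\<close> generated by the square root of 5 over the rationals.\<close>

definition cyclotomic_image :: "nat \<Rightarrow> 'a::field set \<Rightarrow> 'a \<Rightarrow> int set" where
  "cyclotomic_image d K \<xi> = {a \<in> Units (residue_ring (int d)).
     \<exists>\<sigma>\<in>Gal (adjoin K {\<xi>}) K. \<sigma> \<xi> = \<xi> ^ nat a}"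


section \<open>Iterated preimages and the arboreal Galois group\<close>

definition post_critically_infinite_at_0 :: "'a::field poly \<Rightarrow> bool" where
  "post_critically_infinite_at_0 f \<longleftrightarrow> (\<forall>n m. n \<noteq> m \<longrightarrow> (poly f ^^ n) 0 \<noteq> (poly f ^^ m) 0)"

definition preimages :: "'a::field poly \<Rightarrow> nat \<Rightarrow> 'a \<Rightarrow> 'a set" where
  "preimages f n t = {x. (poly f ^^ n) x = t}"

definition K_inf :: "'a::field set \<Rightarrow> 'a poly \<Rightarrow> 'a \<Rightarrow> 'a set" where
  "K_inf K f t = adjoin K (\<Union>n. preimages f n t)"

abbreviation unicritical :: "nat \<Rightarrow> 'a::field \<Rightarrow> 'a poly" where
  "unicritical d c \<equiv> Polynomial.monom 1 d + [:c:]"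

text \<open>The identification of the tree of preimages of \<open>t\<close> under \<open>x\<^sup>d + c\<close> with the tree of words,
  for some choice of the \<open>d\<close>-th roots \<open>\<alpha> (w @ [d])\<close>.\<close>

definition preimage_labelling ::
    "nat \<Rightarrow> 'a::field \<Rightarrow> 'a \<Rightarrow> 'a \<Rightarrow> (nat list \<Rightarrow> 'a) \<Rightarrow> bool" where
  "preimage_labelling d \<xi> c t \<alpha> \<longleftrightarrow> \<alpha> [] = t \<and>
     (\<forall>w\<in>words d. \<alpha> (w @ [d]) ^ d = \<alpha> w - c \<and>
        (\<forall>x\<in>{1..d}. \<alpha> (w @ [x]) = \<xi> ^ x * \<alpha> (w @ [d])))"

text \<open>The action of a Galois automorphism on words: \<open>w\<close> goes to the word labelling \<open>\<sigma> (\<alpha> w)\<close>.\<close>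

definition tree_action ::
    "nat \<Rightarrow> (nat list \<Rightarrow> 'a) \<Rightarrow> ('a \<Rightarrow> 'a) \<Rightarrow> (nat list \<Rightarrow> nat list)" where
  "tree_action d \<alpha> \<sigma> = (\<lambda>w\<in>words d. inv_into (words d) \<alpha> (\<sigma> (\<alpha> w)))"

definition G_inf ::
    "nat \<Rightarrow> 'a::field set \<Rightarrow> 'a poly \<Rightarrow> 'a \<Rightarrow> (nat list \<Rightarrow> 'a) \<Rightarrow> (nat list \<Rightarrow> nat list) set" where
  "G_inf d K f t \<alpha> = tree_action d \<alpha> ` Gal (K_inf K f t) (adjoin K {t})"

end

theory Submission
  imports
    Defs
    "HOL-Computational_Algebra.Formal_Laurent_Series"
    "HOL-Computational_Algebra.Polynomial_Factorial"
    "HOL-Combinatorics.Permutations"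
begin

text \<open>Write \<open>\<beta>\<^sub>w\<close> for \<open>\<alpha>\<^bsub>wd\<^esub>\<close>, so that \<open>\<beta>\<^sub>w\<^sup>d = \<alpha>\<^sub>w - c\<close>: the tower \<open>K\<^sub>\<infinity>\<close> arises from \<open>K(\<xi>, t)\<close> by adjoining \<open>d\<close>-th
  roots, and an automorphism \<open>\<sigma>\<close> with \<open>\<sigma>(\<xi>) = \<xi>\<^sup>a\<close> acts at every vertex by an affine map
  \<open>x \<mapsto> a x + b\<^sub>w\<close> modulo \<open>d\<close> with the same \<open>a \<in> I\<close>. Every such family occurs. To see that
  \<open>\<beta>\<^sub>w\<close> has degree \<open>d\<close> over the field generated by the other \<open>\<beta>\<^sub>u\<close> with \<open>|u| \<le> |w| = N\<close>, specialise
  \<open>t\<close> to \<open>f\<^bsup>N+1\<^esup>(0) + X\<close> and label the tree by power series so that \<open>\<alpha>\<^sub>w\<close> has constant term \<open>c\<close>.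
  As \<open>0\<close> is not preperiodic, \<open>\<alpha>\<^sub>w - c\<close> then has valuation 1 while the other \<open>\<alpha>\<^sub>u - c\<close> are units,
  so the other \<open>\<beta>\<^sub>u\<close> live in the Laurent series, where \<open>(\<alpha>\<^sub>w - c)\<^sup>m\<close> with \<open>0 < m < d\<close> is no \<open>d\<close>-th power.

  The group is therefore explicit. The subgroup with \<open>a = 1\<close> is the branching subgroup, and
  counting the families \<open>(b\<^sub>w)\<close> gives the Hausdorff dimension. For fixed \<open>a\<close>, the proportion
  \<open>u\<^sub>n\<close> of elements without a fixed vertex at level \<open>n\<close> satisfies \<open>u\<^bsub>n+1\<^esub> = (\<Sum>\<^sub>b u\<^sub>n\<^bsup>k(b)\<^esup>) / d\<close>, where
  \<open>k(b)\<close> is the number of fixed points of \<open>x \<mapsto> a x + b\<close>. This is a critical branching process: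
  it dies out, except when every \<open>k(b)\<close> is 1, which happens iff \<open>a - 1\<close> is a unit. Over the
  rationals, \<open>I\<close> is the whole unit group because the cyclotomic polynomials are irreducible.\<close>

text \<open>The proof has to avoid a circle. Sending the other \<open>\<beta>_u\<close> to Laurent
  series needs a homomorphism on the field that they generate, which is built from their own
  independence. Induction over finite sets of vertices closed under parents breaks it: a longest
  word is added last, and independence within the smaller set is already known. All powers
  \<open>\<beta>_w^m\<close> with \<open>0 < m < d\<close> must be excluded, because a factor of
  degree \<open>m\<close> of \<open>X^d - \<beta>_w^d\<close> has a constant term proportional to
  \<open>\<beta>_w^m\<close>; a valuation does this uniformly, as \<open>d v = m\<close> has no
  integer solution. The series have coefficients in the ambient field: its \<open>d\<close>-th roots
  supply constant terms, and invertibility of \<open>d\<close> lifts them. The same extension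
  argument then works with the ambient field as target and produces the automorphisms. In the
  probabilistic part \<open>a\<close> is fixed first, because it is shared by the whole tree; only
  then are the subtrees independent. In the dimension, a vertex contributes a factor
  \<open>d\<close> out of \<open>d!\<close>, and the choice of \<open>a\<close> one bounded factor
  in total.\<close>

section \<open>Subfields of the ambient field\<close>

text \<open>Closure conditions in a form suited to simplification; the convention
  \<open>inverse 0 = 0\<close> spares the inverse clause a side condition.
  \<open>sfield_iff_subfield\<close> links it to the algebraic notion.\<close>

definition sfield :: "'a::field set \<Rightarrow> bool" where
  "sfield F \<longleftrightarrow> 0 \<in> F \<and> 1 \<in> F \<and> (\<forall>x\<in>F. \<forall>y\<in>F. x + y \<in> F \<and> x * y \<in> F) \<and>
     (\<forall>x\<in>F. - x \<in> F \<and> inverse x \<in> F)"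

abbreviation TR :: "'a::field ring" where "TR \<equiv> ring_of_type_algebra"

lemma TR_simps [simp]:
  "carrier (TR::'a::field ring) = UNIV"
  "x \<otimes>\<^bsub>TR\<^esub> y = x * (y::'a)" "x \<oplus>\<^bsub>TR\<^esub> y = x + (y::'a)" "\<one>\<^bsub>TR\<^esub> = (1::'a)" "\<zero>\<^bsub>TR\<^esub> = (0::'a)"
  by (simp_all add: ring_of_type_algebra_def)

lemma TR_field: "field (TR :: 'a::field ring)"
  by (rule field_from_type_algebra)

lemmas TR_domain = field.axioms(1)[OF TR_field]
lemmas TR_ring = cring.axioms(1)[OF domain.axioms(1)[OF TR_domain]]
lemmas TR_monoid = ring.is_monoid[OF TR_ring]

lemma TR_a_inv [simp]: "\<ominus>\<^bsub>TR\<^esub> x = - (x::'a::field)"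
  by (rule abelian_group.minus_equality[OF ring.is_abelian_group[OF TR_ring]]) simp_all

lemma TR_m_inv [simp]: "x \<noteq> 0 \<Longrightarrow> inv\<^bsub>TR\<^esub> x = inverse (x::'a::field)"
  by (rule monoid.inv_unique'[OF TR_monoid, symmetric]) simp_all

lemma sfield_iff_subfield: "sfield F \<longleftrightarrow> subfield F TR"
proof
  assume F: "sfield F"
  show "subfield F TR"
  proof (rule field.subfieldI'[OF TR_field])
    show "subring F TR"
      by (rule ring.subringI[OF TR_ring]) (use F in \<open>auto simp: sfield_def\<close>)
  qed (use F in \<open>auto simp: sfield_def\<close>)
next
  assume F: "subfield F TR"
  then have R: "subring F TR" by (rule subfieldE)
  have inv: "inverse x \<in> F" if "x \<in> F" for x
  proof (cases "x = 0")
    case False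
    then show ?thesis
      using ring.subfield_m_inv(1)[OF TR_ring F, of x] that by auto
  next
    case True
    then show ?thesis using that by simp
  qed
  show "sfield F"
    unfolding sfield_def
    using subringE(2,3)[OF R] subringE(5-7)[OF R] inv by simp
qed

lemma sfieldD:
  assumes "sfield F"
  shows "0 \<in> F" "1 \<in> F" "x \<in> F \<Longrightarrow> y \<in> F \<Longrightarrow> x + y \<in> F" "x \<in> F \<Longrightarrow> y \<in> F \<Longrightarrow> x * y \<in> F"
    "x \<in> F \<Longrightarrow> - x \<in> F" "x \<in> F \<Longrightarrow> inverse x \<in> F" "x \<in> F \<Longrightarrow> y \<in> F \<Longrightarrow> x - y \<in> F"
    "x \<in> F \<Longrightarrow> y \<in> F \<Longrightarrow> x / y \<in> F" "x \<in> F \<Longrightarrow> x ^ n \<in> F"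
proof -
  show *: "0 \<in> F" "1 \<in> F" "x \<in> F \<Longrightarrow> y \<in> F \<Longrightarrow> x + y \<in> F" "x \<in> F \<Longrightarrow> y \<in> F \<Longrightarrow> x * y \<in> F"
    "x \<in> F \<Longrightarrow> - x \<in> F" "x \<in> F \<Longrightarrow> inverse x \<in> F" for x y
    using assms by (auto simp: sfield_def)
  show "x \<in> F \<Longrightarrow> y \<in> F \<Longrightarrow> x - y \<in> F" using *(3)[of x "-y"] *(5)[of y] by simp
  show "x \<in> F \<Longrightarrow> y \<in> F \<Longrightarrow> x / y \<in> F" using *(4)[of x "inverse y"] *(6)[of y] by (simp add: divide_inverse)
  show "x \<in> F \<Longrightarrow> x ^ n \<in> F" by (induction n) (use * in auto)
qed

lemma sfield_sum: "sfield F \<Longrightarrow> (\<And>i. i \<in> A \<Longrightarrow> f i \<in> F) \<Longrightarrow> sum f A \<in> F"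
  by (induction A rule: infinite_finite_induct) (auto simp: sfieldD)

lemma sfield_prod: "sfield F \<Longrightarrow> (\<And>i. i \<in> A \<Longrightarrow> f i \<in> F) \<Longrightarrow> prod f A \<in> F"
  by (induction A rule: infinite_finite_induct) (auto simp: sfieldD)

lemma sfield_of_int: "sfield F \<Longrightarrow> of_int n \<in> F"
proof -
  assume F: "sfield F"
  have "of_nat m \<in> F" for m by (induction m) (auto simp: sfieldD F)
  then show ?thesis
    by (cases n rule: int_cases2) (auto simp: sfieldD F)
qed

lemma sfield_adjoin: "sfield (adjoin K S)"
  unfolding sfield_iff_subfield by (rule field.generate_field_is_subfield[OF TR_field]) simp

lemma adjoin_incl: "K \<subseteq> adjoin K S" "S \<subseteq> adjoin K S"
  by (auto intro: generate_field.incl)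

lemma adjoin_least: "sfield F \<Longrightarrow> K \<subseteq> F \<Longrightarrow> S \<subseteq> F \<Longrightarrow> adjoin K S \<subseteq> F"
  unfolding sfield_iff_subfield by (rule field.generate_field_min_subfield1[OF TR_field]) auto

lemma adjoin_mono: "K \<subseteq> K' \<Longrightarrow> S \<subseteq> S' \<Longrightarrow> adjoin K S \<subseteq> adjoin K' S'"
  by (meson adjoin_least adjoin_incl sfield_adjoin subset_trans)

lemma adjoin_adjoin: "adjoin (adjoin K S) S' = adjoin K (S \<union> S')"
proof
  show "adjoin (adjoin K S) S' \<subseteq> adjoin K (S \<union> S')"
    by (rule adjoin_least[OF sfield_adjoin adjoin_mono])
      (use adjoin_incl(2)[where S = "S \<union> S'" and K = K] in blast)+
  show "adjoin K (S \<union> S') \<subseteq> adjoin (adjoin K S) S'"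
  proof (rule adjoin_least[OF sfield_adjoin])
    show "K \<subseteq> adjoin (adjoin K S) S'"
      by (meson adjoin_incl subset_trans)
    show "S \<union> S' \<subseteq> adjoin (adjoin K S) S'"
      by (meson Un_least adjoin_incl subset_trans)
  qed
qed

section \<open>Homomorphisms out of a subfield\<close>

text \<open>Source and target may be different ambient fields, as needed for maps into Laurent
  series. Values off \<open>F\<close> are unconstrained, and \<open>\<phi> 1 = 1\<close> excludes
  the zero map, which is what makes such maps injective on a subfield.\<close>

definition hom_on :: "'a::field set \<Rightarrow> ('a \<Rightarrow> 'b::field) \<Rightarrow> bool" where
  "hom_on F \<phi> \<longleftrightarrow> \<phi> 1 = 1 \<and> (\<forall>x\<in>F. \<forall>y\<in>F. \<phi> (x + y) = \<phi> x + \<phi> y \<and> \<phi> (x * y) = \<phi> x * \<phi> y)"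

lemma hom_on_mono: "hom_on F \<phi> \<Longrightarrow> F' \<subseteq> F \<Longrightarrow> hom_on F' \<phi>"
  by (auto simp: hom_on_def)

lemma hom_onD:
  assumes F: "sfield F" and h: "hom_on F \<phi>"
  shows "\<phi> 1 = 1" "\<phi> 0 = 0" "x \<in> F \<Longrightarrow> y \<in> F \<Longrightarrow> \<phi> (x + y) = \<phi> x + \<phi> y"
    "x \<in> F \<Longrightarrow> y \<in> F \<Longrightarrow> \<phi> (x * y) = \<phi> x * \<phi> y" "x \<in> F \<Longrightarrow> \<phi> (- x) = - \<phi> x"
    "x \<in> F \<Longrightarrow> y \<in> F \<Longrightarrow> \<phi> (x - y) = \<phi> x - \<phi> y"
    "x \<in> F \<Longrightarrow> \<phi> (inverse x) = inverse (\<phi> x)"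
    "x \<in> F \<Longrightarrow> y \<in> F \<Longrightarrow> \<phi> (x / y) = \<phi> x / \<phi> y"
    "x \<in> F \<Longrightarrow> \<phi> (x ^ n) = \<phi> x ^ n"
    "x \<in> F \<Longrightarrow> \<phi> x = 0 \<longleftrightarrow> x = 0"
proof -
  show 1: "\<phi> 1 = 1" and add: "\<And>x y. x \<in> F \<Longrightarrow> y \<in> F \<Longrightarrow> \<phi> (x + y) = \<phi> x + \<phi> y"
    and mult: "\<And>x y. x \<in> F \<Longrightarrow> y \<in> F \<Longrightarrow> \<phi> (x * y) = \<phi> x * \<phi> y"
    using h by (auto simp: hom_on_def)
  show 0: "\<phi> 0 = 0" using add[OF sfieldD(1)[OF F] sfieldD(1)[OF F]] by (simp only: add_0_left add_cancel_right_left)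
  show minus: "\<phi> (- x) = - \<phi> x" if "x \<in> F" for x
    using add[of x "-x"] that sfieldD[OF F] 0 by (simp add: eq_neg_iff_add_eq_0 add.commute)
  show "x \<in> F \<Longrightarrow> y \<in> F \<Longrightarrow> \<phi> (x - y) = \<phi> x - \<phi> y"
    using add[of x "-y"] minus[of y] sfieldD[OF F] by simp
  show inv: "\<phi> (inverse x) = inverse (\<phi> x)" if "x \<in> F" for x
  proof (cases "x = 0")
    case False
    then have "\<phi> x * \<phi> (inverse x) = 1" using mult[of x "inverse x"] that sfieldD[OF F] 1 by simp
    then show ?thesis by (metis inverse_unique)
  qed (simp add: 0)
  show "x \<in> F \<Longrightarrow> y \<in> F \<Longrightarrow> \<phi> (x / y) = \<phi> x / \<phi> y"
    using mult[of x "inverse y"] inv[of y] sfieldD[OF F] by (simp add: divide_inverse)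
  show "x \<in> F \<Longrightarrow> \<phi> (x ^ n) = \<phi> x ^ n"
    by (induction n) (use 1 mult sfieldD[OF F] in auto)
  show "\<phi> x = 0 \<longleftrightarrow> x = 0" if "x \<in> F"
    using mult[of x "inverse x"] that sfieldD[OF F] 0 1 by (cases "x = 0") auto
qed

lemma hom_on_sum:
  assumes "sfield F" "hom_on F \<phi>" "\<And>i. i \<in> A \<Longrightarrow> f i \<in> F"
  shows "\<phi> (sum f A) = (\<Sum>i\<in>A. \<phi> (f i))"
  using assms(3)
  by (induction A rule: infinite_finite_induct)
    (auto simp: hom_onD[OF assms(1,2)] sfield_sum[OF assms(1)])

lemma hom_on_inj:
  assumes "sfield F" "hom_on F \<phi>"
  shows "inj_on \<phi> F"
proof (rule inj_onI)
  fix x y assume "x \<in> F" "y \<in> F" "\<phi> x = \<phi> y"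
  then have "\<phi> (x - y) = 0" "x - y \<in> F"
    using hom_onD(6)[OF assms] sfieldD(7)[OF assms(1)] by auto
  then show "x = y" using hom_onD(10)[OF assms] by auto
qed

lemma sfield_hom_image:
  assumes "sfield F" "hom_on F \<phi>"
  shows "sfield (\<phi> ` F)"
proof -
  note h = hom_onD[OF assms] and F = sfieldD[OF assms(1)]
  show ?thesis
    unfolding sfield_def
  proof (intro conjI ballI)
    show "0 \<in> \<phi> ` F" "1 \<in> \<phi> ` F" using h(1,2) F(1,2) by force+
    fix u assume "u \<in> \<phi> ` F"
    then obtain x where x: "x \<in> F" "u = \<phi> x" by blast
    show "- u \<in> \<phi> ` F" "inverse u \<in> \<phi> ` F"
      unfolding x(2) h(5)[OF x(1), symmetric] h(7)[OF x(1), symmetric] using F(5,6)[OF x(1)] by blast+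
    fix v assume "v \<in> \<phi> ` F"
    then obtain y where y: "y \<in> F" "v = \<phi> y" by blast
    show "u + v \<in> \<phi> ` F" "u * v \<in> \<phi> ` F"
      unfolding x(2) y(2) h(3)[OF x(1) y(1), symmetric] h(4)[OF x(1) y(1), symmetric]
      using F(3,4)[OF x(1) y(1)] by blast+
  qed
qed

lemma sfield_hom_preimage:
  assumes "sfield F" "hom_on F \<phi>" "sfield F'"
  shows "sfield {x \<in> F. \<phi> x \<in> F'}"
  using hom_onD(1-5,7)[OF assms(1,2)] sfieldD(1-6)[OF assms(1)] sfieldD(1-6)[OF assms(3)]
  unfolding sfield_def by simp

lemma hom_on_image_adjoin:
  assumes "hom_on (adjoin K S) \<phi>" "sfield F'" "\<And>x. x \<in> K \<union> S \<Longrightarrow> \<phi> x \<in> F'" "x \<in> adjoin K S"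
  shows "\<phi> x \<in> F'"
proof -
  have "adjoin K S \<subseteq> {x \<in> adjoin K S. \<phi> x \<in> F'}"
    by (rule adjoin_least[OF sfield_hom_preimage[OF sfield_adjoin assms(1,2)]])
      (use assms(3) adjoin_incl in blast)+
  then show ?thesis using assms(4) by blast
qed

text \<open>The set of agreement is a subfield containing the generators. This rigidity later glues
  maps that are chosen separately on finite stages.\<close>

lemma hom_on_unique:
  assumes "hom_on (adjoin K S) \<phi>" "hom_on (adjoin K S) \<psi>"
    and "\<And>x. x \<in> K \<union> S \<Longrightarrow> \<phi> x = \<psi> x" "x \<in> adjoin K S"
  shows "\<phi> x = \<psi> x"
proof -
  have "sfield {x \<in> adjoin K S. \<phi> x = \<psi> x}"
    using hom_onD(1-5,7)[OF sfield_adjoin assms(1)] hom_onD(1-5,7)[OF sfield_adjoin assms(2)]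
      sfieldD(1-6)[OF sfield_adjoin, where S1=S and K1=K]
    unfolding sfield_def by simp
  then have "adjoin K S \<subseteq> {x \<in> adjoin K S. \<phi> x = \<psi> x}"
    by (rule adjoin_least) (use assms(3) adjoin_incl in blast)+
  then show ?thesis using assms(4) by blast
qed

section \<open>Polynomials over a subfield\<close>

text \<open>Polynomials over \<open>F\<close> remain polynomials over the ambient field, so roots,
  degrees and factorisations keep their ambient meaning.\<close>

definition coeffs_in :: "'a::field set \<Rightarrow> 'a poly \<Rightarrow> bool" where
  "coeffs_in F p \<longleftrightarrow> (\<forall>i. poly.coeff p i \<in> F)"

lemma coeffs_in_simps:
  assumes "sfield F"
  shows "coeffs_in F 0" "coeffs_in F 1" "coeffs_in F p \<Longrightarrow> coeffs_in F q \<Longrightarrow> coeffs_in F (p + q)"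
    "coeffs_in F p \<Longrightarrow> coeffs_in F q \<Longrightarrow> coeffs_in F (p - q)" "coeffs_in F p \<Longrightarrow> coeffs_in F (- p)"
    "coeffs_in F p \<Longrightarrow> coeffs_in F q \<Longrightarrow> coeffs_in F (p * q)"
    "a \<in> F \<Longrightarrow> coeffs_in F (Polynomial.monom a n)" "a \<in> F \<Longrightarrow> coeffs_in F [:a:]"
    "a \<in> F \<Longrightarrow> coeffs_in F p \<Longrightarrow> coeffs_in F (Polynomial.smult a p)"
    "a \<in> F \<Longrightarrow> coeffs_in F p \<Longrightarrow> coeffs_in F (pCons a p)"
  using sfieldD[OF assms]
  by (auto simp: coeffs_in_def coeff_mult coeff_pCons coeff_1 intro!: sfield_sum[OF assms] split: nat.split)

lemma coeffs_in_mono: "coeffs_in F p \<Longrightarrow> F \<subseteq> F' \<Longrightarrow> coeffs_in F' p"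
  by (auto simp: coeffs_in_def)

lemma coeffs_in_power: "sfield F \<Longrightarrow> coeffs_in F p \<Longrightarrow> coeffs_in F (p ^ n)"
  by (induction n) (auto simp: coeffs_in_simps)

lemma poly_in: "sfield F \<Longrightarrow> coeffs_in F p \<Longrightarrow> x \<in> F \<Longrightarrow> poly p x \<in> F"
  unfolding poly_altdef by (rule sfield_sum) (auto simp: sfieldD coeffs_in_def)

lemma coeff_map_poly_hom:
  assumes "sfield F" "hom_on F \<phi>"
  shows "poly.coeff (map_poly \<phi> p) i = \<phi> (poly.coeff p i)"
  by (simp add: coeff_map_poly hom_onD(2)[OF assms])

lemma map_poly_hom_simps:
  assumes F: "sfield F" "hom_on F \<phi>" and p: "coeffs_in F p"
  shows "coeffs_in F q \<Longrightarrow> map_poly \<phi> (p + q) = map_poly \<phi> p + map_poly \<phi> q"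
    "coeffs_in F q \<Longrightarrow> map_poly \<phi> (p - q) = map_poly \<phi> p - map_poly \<phi> q"
    "coeffs_in F q \<Longrightarrow> map_poly \<phi> (p * q) = map_poly \<phi> p * map_poly \<phi> q"
    "map_poly \<phi> 1 = 1" "map_poly \<phi> p = 0 \<longleftrightarrow> p = 0"
proof -
  note [simp] = coeff_map_poly_hom[OF F]
  note pp = p[unfolded coeffs_in_def, rule_format]
  show "coeffs_in F q \<Longrightarrow> map_poly \<phi> (p + q) = map_poly \<phi> p + map_poly \<phi> q"
    "coeffs_in F q \<Longrightarrow> map_poly \<phi> (p - q) = map_poly \<phi> p - map_poly \<phi> q"
    by (auto intro!: poly_eqI simp: coeffs_in_def hom_onD[OF F] pp)
  show "coeffs_in F q \<Longrightarrow> map_poly \<phi> (p * q) = map_poly \<phi> p * map_poly \<phi> q"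
    by (auto intro!: poly_eqI simp: coeffs_in_def coeff_mult hom_on_sum[OF F] hom_onD[OF F] pp sfieldD[OF F(1)])
  show "map_poly \<phi> 1 = 1"
    by (rule poly_eqI) (auto simp: coeff_1 hom_onD[OF F])
  show "map_poly \<phi> p = 0 \<longleftrightarrow> p = 0"
    by (auto simp: poly_eq_iff hom_onD(10)[OF F] pp hom_onD(2)[OF F])
qed

text \<open>The fractions form a field whether or not \<open>x\<close> is algebraic; one description
  therefore serves for adjoining \<open>t\<close> and for adjoining radicals.\<close>

lemma adjoin_single:
  assumes F: "sfield F"
  shows "adjoin F {x} = {poly p x / poly q x |p q. coeffs_in F p \<and> coeffs_in F q \<and> poly q x \<noteq> 0}"
    (is "_ = ?Q")
proof
  have QI: "z \<in> ?Q" if "coeffs_in F p" "coeffs_in F q" "poly q x \<noteq> 0" "z = poly p x / poly q x" for z p q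
    using that by blast
  have "sfield ?Q"
    unfolding sfield_def
  proof (intro conjI ballI)
    show "0 \<in> ?Q" by (rule QI[of 0 1]) (auto simp: coeffs_in_simps[OF F])
    show "1 \<in> ?Q" by (rule QI[of 1 1]) (auto simp: coeffs_in_simps[OF F])
    fix u assume "u \<in> ?Q"
    then obtain p q where u: "coeffs_in F p" "coeffs_in F q" "poly q x \<noteq> 0" "u = poly p x / poly q x" by blast
    show "- u \<in> ?Q" by (rule QI[of "-p" q]) (use u in \<open>auto simp: coeffs_in_simps[OF F]\<close>)
    show "inverse u \<in> ?Q"
    proof (cases "poly p x = 0")
      case True
      then show ?thesis by (intro QI[of 0 1]) (use u in \<open>auto simp: coeffs_in_simps[OF F]\<close>)
    next
      case False
      then show ?thesis by (intro QI[of q p]) (use u in \<open>auto simp: coeffs_in_simps[OF F]\<close>)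
    qed
    fix v assume "v \<in> ?Q"
    then obtain r s where v: "coeffs_in F r" "coeffs_in F s" "poly s x \<noteq> 0" "v = poly r x / poly s x" by blast
    show "u + v \<in> ?Q"
      by (rule QI[of "p * s + r * q" "q * s"]) (use u v in \<open>simp_all add: coeffs_in_simps[OF F] add_frac_eq\<close>)
    show "u * v \<in> ?Q"
      by (rule QI[of "p * r" "q * s"]) (use u v in \<open>simp_all add: coeffs_in_simps[OF F] add_frac_eq\<close>)
  qed
  moreover have "F \<subseteq> ?Q"
  proof
    fix a assume "a \<in> F"
    then show "a \<in> ?Q" by (intro QI[of "[:a:]" 1]) (auto simp: coeffs_in_simps[OF F])
  qed
  moreover have "{x} \<subseteq> ?Q"
    using QI[of "[:0,1:]" 1] by (auto simp: coeffs_in_simps[OF F] sfieldD[OF F])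
  ultimately show "adjoin F {x} \<subseteq> ?Q" by (rule adjoin_least)
next
  have x: "x \<in> adjoin F {x}" and sub: "F \<subseteq> adjoin F {x}" using adjoin_incl[where S="{x}" and K=F] by auto
  show "?Q \<subseteq> adjoin F {x}"
    using poly_in[OF sfield_adjoin coeffs_in_mono[OF _ sub] x]
    using sfieldD(8)[OF sfield_adjoin] by blast
qed

text \<open>Equal vanishing at \<open>x\<close> and \<open>y\<close> is exactly what makes
  \<open>p(x)/q(x) \<mapsto> (\<phi> p)(y)/(\<phi> q)(y)\<close> independent of the fraction and
  keeps denominators nonzero. Algebraic and transcendental extensions are both covered, without a
  minimal polynomial.\<close>

lemma hom_extend_single:
  assumes F: "sfield F" and h: "hom_on F \<phi>"
    and zero: "\<And>p. coeffs_in F p \<Longrightarrow> poly p x = 0 \<longleftrightarrow> poly (map_poly \<phi> p) y = 0"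
  shows "\<exists>\<psi>. hom_on (adjoin F {x}) \<psi> \<and> (\<forall>a\<in>F. \<psi> a = \<phi> a) \<and> \<psi> x = y"
proof -
  let ?r = "\<lambda>u p q. coeffs_in F p \<and> coeffs_in F q \<and> poly q x \<noteq> 0 \<and> u = poly p x / poly q x"
  define \<psi> where "\<psi> u = (SOME z. \<exists>p q. ?r u p q \<and> z = poly (map_poly \<phi> p) y / poly (map_poly \<phi> q) y)" for u
  note ms = map_poly_hom_simps[OF F h]
  have \<psi>: "\<psi> u = poly (map_poly \<phi> p) y / poly (map_poly \<phi> q) y" if r: "?r u p q" for u p q
  proof -
    have "\<exists>z. \<exists>p q. ?r u p q \<and> z = poly (map_poly \<phi> p) y / poly (map_poly \<phi> q) y" using r by blast
    from someI_ex[OF this] obtain p' q' where r': "?r u p' q'"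
      and e: "\<psi> u = poly (map_poly \<phi> p') y / poly (map_poly \<phi> q') y"
      unfolding \<psi>_def by blast
    \<comment> \<open>Cross-multiplication turns equality of fractions into the vanishing of one
      polynomial over \<open>F\<close>, to which \<open>zero\<close> applies.\<close>
    have "poly (p * q' - p' * q) x = 0" using r r' by (simp add: field_simps)
    then have "poly (map_poly \<phi> (p * q' - p' * q)) y = 0"
      by (subst (asm) zero) (use r r' in \<open>auto simp: coeffs_in_simps[OF F]\<close>)
    then have "poly (map_poly \<phi> p) y * poly (map_poly \<phi> q') y = poly (map_poly \<phi> p') y * poly (map_poly \<phi> q) y"
      using r r' by (simp add: ms coeffs_in_simps[OF F])
    moreover have "poly (map_poly \<phi> q) y \<noteq> 0" "poly (map_poly \<phi> q') y \<noteq> 0"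
      using zero r r' by auto
    ultimately show ?thesis by (simp add: e field_simps)
  qed
  have base: "\<psi> a = \<phi> a" if "a \<in> F" for a
    using \<psi>[of "[:a:]" 1 a] that
    by (simp add: coeffs_in_simps[OF F] ms map_poly_pCons hom_onD[OF F h])
  have "\<psi> x = y"
    using \<psi>[of "[:0,1:]" 1 x]
    by (simp add: coeffs_in_simps[OF F] ms map_poly_pCons hom_onD[OF F h] sfieldD[OF F])
  moreover have "hom_on (adjoin F {x}) \<psi>"
    unfolding hom_on_def
  proof (intro conjI ballI)
    show "\<psi> 1 = 1" using base[of 1] by (simp add: sfieldD[OF F] hom_onD[OF F h])
    fix u v assume "u \<in> adjoin F {x}" "v \<in> adjoin F {x}"
    then obtain p q r s where u: "?r u p q" and v: "?r v r s"
      unfolding adjoin_single[OF F] by blast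
    have nz: "poly (map_poly \<phi> q) y \<noteq> 0" "poly (map_poly \<phi> s) y \<noteq> 0"
      using zero u v by auto
    have "?r (u + v) (p * s + r * q) (q * s)"
      using u v by (simp add: coeffs_in_simps[OF F] add_frac_eq)
    from \<psi>[OF this] show "\<psi> (u + v) = \<psi> u + \<psi> v"
      using nz u v unfolding \<psi>[OF u] \<psi>[OF v] by (simp add: ms coeffs_in_simps[OF F] add_frac_eq)
    have "?r (u * v) (p * r) (q * s)"
      using u v by (simp add: coeffs_in_simps[OF F] add_frac_eq)
    from \<psi>[OF this] show "\<psi> (u * v) = \<psi> u * \<psi> v"
      using nz u v unfolding \<psi>[OF u] \<psi>[OF v] by (simp add: ms coeffs_in_simps[OF F] add_frac_eq)
  qed
  ultimately show ?thesis using base by blast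
qed

section \<open>Transcendence\<close>

text \<open>Coefficient lists of \<open>ring.eval\<close> start with the leading coefficient, those
  of \<open>Poly\<close> with the constant one, hence the reversal.\<close>

lemma eval_rev: "ring.eval TR (rev xs) x = poly (Poly xs) (x::'a::field)"
proof (induction xs rule: rev_induct)
  case Nil
  then show ?case by (simp add: ring.eval.simps[OF TR_ring])
next
  case (snoc y xs)
  have "x [^]\<^bsub>TR\<^esub> n = x ^ n" for n :: nat
    by (induction n) (simp_all add: monoid.nat_pow_0[OF TR_monoid] monoid.nat_pow_Suc[OF TR_monoid] mult.commute)
  then show ?case using snoc
    by (simp add: ring.eval.simps[OF TR_ring] Poly_snoc poly_monom add.commute)
qed

lemma transcendental_iff_poly:
  assumes K: "subfield K TR"
  shows "ring.transcendental TR K (t::'a::field) \<longleftrightarrow> (\<forall>p. coeffs_in K p \<longrightarrow> poly p t = 0 \<longrightarrow> p = 0)"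
proof (intro iffI allI impI)
  fix p assume tr: "ring.transcendental TR K t" and p: "coeffs_in K p" "poly p t = 0"
  show "p = 0"
  proof (rule ccontr)
    assume "p \<noteq> 0"
    then have "rev (coeffs p) \<in> carrier (K [X]\<^bsub>TR\<^esub>)"
      unfolding univ_poly_def using p
      by (auto simp: polynomial_def hd_rev last_coeffs_eq_coeff_degree coeffs_in_def coeffs_def)
    moreover have "ring.eval TR (rev (coeffs p)) t = \<zero>\<^bsub>TR\<^esub>"
      using p by (simp add: eval_rev)
    moreover have "(ring.transcendental TR over K) t" using tr by (simp add: over_def)
    ultimately have "rev (coeffs p) = []"
      by (intro ring.eval_transcendental[OF TR_ring])
    then show False using \<open>p \<noteq> 0\<close> by simp
  qed
next
  assume *: "\<forall>p. coeffs_in K p \<longrightarrow> poly p t = 0 \<longrightarrow> p = 0"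
  show "ring.transcendental TR K t"
  proof (rule ccontr)
    assume "\<not> ring.transcendental TR K t"
    then obtain l where l: "l \<in> carrier (K [X]\<^bsub>TR\<^esub>)" "l \<noteq> []" "ring.eval TR l t = \<zero>\<^bsub>TR\<^esub>"
      using domain.algebraicE[OF TR_domain subfieldE(1)[OF K], of t] by (auto simp: over_def)
    let ?p = "Poly (rev l)"
    have lK: "set l \<subseteq> K" "hd l \<noteq> 0" using l by (auto simp: univ_poly_def polynomial_def)
    have "coeffs_in K ?p"
      using lK sfieldD(1)[of K] K
      by (auto simp: coeffs_in_def coeff_Poly_eq nth_default_def sfield_iff_subfield rev_nth subset_iff)
    moreover have "poly ?p t = 0" using l(3) eval_rev[of "rev l" t] by simp
    ultimately have "?p = 0" using * by blast
    then have "poly.coeff ?p (length l - 1) = 0" by simp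
    then show False using lK l(2) by (auto simp: coeff_Poly_eq nth_default_def rev_nth hd_conv_nth)
  qed
qed

text \<open>Algebraicity is transitive: if \<open>t\<close> were algebraic over \<open>K(x)\<close>,
  dimensions would multiply in the tower and \<open>t\<close> would lie in a finite-dimensional
  extension of \<open>K\<close>. Since \<open>x\<close> is algebraic, \<open>K[x]\<close> is already
  a field and contains \<open>adjoin K {x}\<close>.\<close>

lemma transcendental_over_algebraic_extension:
  assumes K: "subfield K TR" and x: "\<not> ring.transcendental TR K x" and t: "ring.transcendental TR K t"
  shows "ring.transcendental TR (adjoin K {x}) (t::'a::field)"
proof (rule ccontr)
  note R = TR_ring[where 'a='a] and D = TR_domain[where 'a='a]
  let ?E = "ring.simple_extension TR K x"
  assume *: "\<not> ring.transcendental TR (adjoin K {x}) t"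
  have alg: "(ring.algebraic TR over K) x" using x by (simp add: over_def)
  have E: "subfield ?E TR" using domain.simple_extension_is_subfield[OF D K, of x] alg by simp
  have "K \<subseteq> ?E" "x \<in> ?E"
    using ring.simple_extension_incl[OF R, of K x] ring.simple_extension_mem[OF R subfieldE(1)[OF K], of x] by auto
  then have "adjoin K {x} \<subseteq> ?E" using E by (intro adjoin_least) (auto simp: sfield_iff_subfield)
  then have "(ring.algebraic TR over ?E) t"
    using ring.algebraic_mono[OF R] * by (auto simp: over_def)
  then have "ring.finite_dimension TR ?E (ring.simple_extension TR ?E t)"
    using domain.finite_dimension_simple_extension[OF D E] by simp
  moreover have "ring.finite_dimension TR K ?E"
    using domain.finite_dimension_simple_extension[OF D K] alg by simp
  ultimately have "ring.finite_dimension TR K (ring.simple_extension TR ?E t)"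
    using ring.telescopic_base_dim(1)[OF R K E] by blast
  moreover have "t \<in> ring.simple_extension TR ?E t" "subring (ring.simple_extension TR ?E t) TR"
    using ring.simple_extension_mem[OF R subfieldE(1)[OF E], of t]
      domain.simple_extension_is_subring[OF D subfieldE(1)[OF E], of t] by auto
  ultimately have "(ring.algebraic TR over K) t"
    using ring.finite_dimension_imp_algebraic[OF R K] by blast
  then show False using t by (simp add: over_def)
qed

section \<open>Roots of unity\<close>

lemma prim_root_pow_eq_iff:
  assumes "primitive_root_of_unity d \<xi>" "d > 0"
  shows "\<xi> ^ i = \<xi> ^ j \<longleftrightarrow> i mod d = j mod d"
proof -
  have xd: "\<xi> ^ d = 1" and nz: "\<xi> \<noteq> 0" using assms by (auto simp: primitive_root_of_unity_def power_0_left)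
  have red: "\<xi> ^ i = \<xi> ^ (i mod d)" for i
    by (subst div_mult_mod_eq[of i d, symmetric]) (simp only: power_add power_mult mult.commute[of _ d] xd power_one mult_1)
  have *: "i = j" if "i < d" "j < d" "i \<le> j" "\<xi> ^ i = \<xi> ^ j" for i j
  proof (rule ccontr)
    assume "i \<noteq> j"
    have "\<xi> ^ j = \<xi> ^ i * \<xi> ^ (j - i)" using that by (metis le_add_diff_inverse power_add)
    then have "\<xi> ^ (j - i) = 1" using that nz by simp
    moreover have "0 < j - i" "j - i < d" using that \<open>i \<noteq> j\<close> by auto
    ultimately show False using assms by (auto simp: primitive_root_of_unity_def)
  qed
  have "\<xi> ^ i = \<xi> ^ j \<longleftrightarrow> \<xi> ^ (i mod d) = \<xi> ^ (j mod d)" using red by metis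
  also have "\<dots> \<longleftrightarrow> i mod d = j mod d"
    using *[of "i mod d" "j mod d"] *[of "j mod d" "i mod d"] assms(2)
    by (metis linear mod_less_divisor)
  finally show ?thesis .
qed

text \<open>Both sides are monic of degree \<open>d\<close>, so their difference has degree below
  \<open>d\<close> or is zero; yet it vanishes at the \<open>d\<close> points
  \<open>\<xi> ^ i * \<beta>\<close>, distinct because \<open>\<beta> \<noteq> 0\<close>.\<close>

lemma prim_root_factor:
  assumes "primitive_root_of_unity d \<xi>" "d > 0" "\<beta> \<noteq> 0"
  shows "Polynomial.monom 1 d - [:\<beta> ^ d:] = (\<Prod>i<d. [:- (\<xi> ^ i * \<beta>), 1:])"
proof -
  let ?p = "Polynomial.monom 1 d - [:\<beta> ^ d:]" and ?q = "\<Prod>i<d. [:- (\<xi> ^ i * \<beta>), 1:]"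
  have inj: "inj_on (\<lambda>i. \<xi> ^ i * \<beta>) {..<d}"
    using prim_root_pow_eq_iff[OF assms(1,2)] assms(3) by (auto simp: inj_on_def)
  have dq: "Polynomial.degree ?q = d" by (subst degree_prod_eq_sum_degree) auto
  have lq: "poly.coeff ?q d = 1"
    using lead_coeff_prod[of "\<lambda>i. [:- (\<xi> ^ i * \<beta>), 1:]" "{..<d}"] dq by simp
  have lp: "poly.coeff ?p d = 1" using assms(2) by (auto simp: coeff_pCons split: nat.split)
  have dp: "Polynomial.degree ?p \<le> d"
    by (rule degree_diff_le) (auto simp: degree_monom_le)
  show ?thesis
  proof (rule ccontr)
    assume ne: "?p \<noteq> ?q"
    let ?r = "?p - ?q"
    have r0: "?r \<noteq> 0" using ne by simp
    have "Polynomial.degree ?r \<le> d" using dp dq by (rule degree_diff_le[OF _ eq_refl])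
    moreover have "poly.coeff ?r d = 0" using lp lq by simp
    ultimately have "Polynomial.degree ?r < d"
      using r0 by (metis leading_coeff_0_iff nless_le)
    moreover have "(\<lambda>i. \<xi> ^ i * \<beta>) ` {..<d} \<subseteq> {x. poly ?r x = 0}"
    proof (rule image_subsetI)
      fix i assume i: "i \<in> {..<d}"
      have "poly ?q (\<xi> ^ i * \<beta>) = 0" using i by (auto simp: poly_prod)
      moreover have "(\<xi> ^ i * \<beta>) ^ d = \<beta> ^ d"
        using assms(1) by (simp add: power_mult_distrib primitive_root_of_unity_def flip: power_mult)
          (simp add: mult.commute[of i d] power_mult)
      ultimately show "\<xi> ^ i * \<beta> \<in> {x. poly ?r x = 0}" by (simp add: poly_monom)
    qed
    from card_mono[OF poly_roots_finite[OF r0] this] have "d \<le> card {x. poly ?r x = 0}"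
      unfolding card_image[OF inj] by (simp only: card_lessThan)
    moreover note card_poly_roots_bound[OF r0]
    ultimately show False by (meson leD le_trans)
  qed
qed

lemma root_of_unity_multiple:
  assumes "primitive_root_of_unity d \<xi>" "d > 0" "\<beta> \<noteq> 0" "x ^ d = \<beta> ^ d"
  obtains i where "i < d" "x = \<xi> ^ i * \<beta>"
proof -
  have "poly (Polynomial.monom 1 d - [:\<beta> ^ d:]) x = 0"
    using assms by (simp add: poly_monom)
  then have "\<exists>i<d. x = \<xi> ^ i * \<beta>"
    unfolding prim_root_factor[OF assms(1-3)] by (auto simp: poly_prod)
  then show ?thesis using that by blast
qed

text \<open>One linear factor is removed at a time: if \<open>r x\<close> is a root of
  \<open>p\<close>, the factor cancels on both sides, otherwise it must divide the cofactor
  \<open>k\<close> of \<open>p\<close>.\<close>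

lemma dvd_prod_linear:
  fixes p :: "'a::field poly"
  assumes "finite A" "p dvd (\<Prod>i\<in>A. [:- r i, 1:])"
  shows "\<exists>B\<subseteq>A. \<exists>c. p = Polynomial.smult c (\<Prod>i\<in>B. [:- r i, 1:])"
  using assms
proof (induction A arbitrary: p rule: finite_induct)
  case empty
  then obtain c where "p = [:c:]" by (auto simp: is_unit_poly_iff)
  then show ?case by (intro exI[of _ "{}"] conjI exI[of _ c]) auto
next
  case (insert x A)
  show ?case
  proof (cases "poly p (r x) = 0")
    case True
    then obtain p' where p': "p = [:- r x, 1:] * p'" by (auto simp: poly_eq_0_iff_dvd)
    then have "[:- r x, 1:] * p' dvd [:- r x, 1:] * (\<Prod>i\<in>A. [:- r i, 1:])"
      using insert by simp
    then have "p' dvd (\<Prod>i\<in>A. [:- r i, 1:])" by (subst (asm) dvd_times_left_cancel_iff) auto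
    from insert.IH[OF this] obtain B c where B: "B \<subseteq> A" "p' = Polynomial.smult c (\<Prod>i\<in>B. [:- r i, 1:])" by blast
    have "finite B" "x \<notin> B" using B insert.hyps finite_subset by auto
    then show ?thesis using B p'
      by (intro exI[of _ "insert x B"] conjI exI[of _ c]) (auto simp: mult_smult_right)
  next
    case False
    obtain k where k: "[:- r x, 1:] * (\<Prod>i\<in>A. [:- r i, 1:]) = p * k"
      using insert.prems insert.hyps by (auto elim!: dvdE)
    have "poly (p * k) (r x) = 0" unfolding k[symmetric] by simp
    then obtain k' where k': "k = [:- r x, 1:] * k'" using False by (auto simp: poly_eq_0_iff_dvd)
    have "[:- r x, 1:] * (\<Prod>i\<in>A. [:- r i, 1:]) = [:- r x, 1:] * (p * k')"
      using k unfolding k' by (simp add: mult.left_commute del: mult_pCons_left)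
    then have "(\<Prod>i\<in>A. [:- r i, 1:]) = p * k'" by (subst (asm) mult_cancel_left) auto
    then have "p dvd (\<Prod>i\<in>A. [:- r i, 1:])" by simp
    from insert.IH[OF this] show ?thesis by blast
  qed
qed

text \<open>Ordinary long division; each step divides by a leading coefficient in \<open>F\<close>,
  so nothing leaves \<open>F\<close>.\<close>

lemma division_in_subfield:
  assumes F: "sfield F" and p: "coeffs_in F p" "p \<noteq> 0" and a: "coeffs_in F a"
  shows "\<exists>s r. coeffs_in F s \<and> coeffs_in F r \<and> a = p * s + r \<and>
    (r = 0 \<or> Polynomial.degree r < Polynomial.degree p)"
  using a
\<comment> \<open>The measure separates the zero polynomial from nonzero constants, both of degree
  0, so that a division step ending in zero also counts as descent.\<close>
proof (induction "if a = 0 then 0 else Suc (Polynomial.degree a)" arbitrary: a rule: less_induct)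
  case less
  show ?case
  proof (cases "a = 0 \<or> Polynomial.degree a < Polynomial.degree p")
    case True
    then show ?thesis using less.prems by (intro exI[of _ 0] exI[of _ a]) (auto simp: coeffs_in_simps[OF F])
  next
    case False
    let ?m = "Polynomial.monom (lead_coeff a / lead_coeff p) (Polynomial.degree a - Polynomial.degree p)"
    let ?a = "a - p * ?m"
    have m: "coeffs_in F ?m"
      using less.prems p by (auto intro!: coeffs_in_simps[OF F] sfieldD[OF F] simp: coeffs_in_def)
    have ca: "coeffs_in F ?a" using m less.prems p by (auto intro!: coeffs_in_simps[OF F])
    have "?a = 0 \<or> Polynomial.degree ?a < Polynomial.degree a"
    proof -
      have "Polynomial.degree (p * ?m) = Polynomial.degree a"
        using p False by (subst degree_mult_eq) (auto simp: degree_monom_eq monom_eq_0_iff)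
      then have "Polynomial.degree ?a \<le> Polynomial.degree a" by (intro degree_diff_le) auto
      moreover have "poly.coeff ?a (Polynomial.degree a) = 0"
        using p False by (simp add: mult.commute[of p] coeff_monom_mult)
      ultimately show ?thesis
        by (metis leading_coeff_0_iff nless_le)
    qed
    then have "(if ?a = 0 then 0 else Suc (Polynomial.degree ?a)) < (if a = 0 then 0 else Suc (Polynomial.degree a))"
      using False by auto
    from less.hyps[OF this ca] obtain s r where sr: "coeffs_in F s" "coeffs_in F r" "?a = p * s + r"
      "r = 0 \<or> Polynomial.degree r < Polynomial.degree p" by blast
    then have "a = p * (s + ?m) + r" by (simp add: algebra_simps)
    then show ?thesis using sr m by (intro exI[of _ "s + ?m"] exI[of _ r]) (auto intro: coeffs_in_simps[OF F])
  qed
qed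

section \<open>Kummer extensions\<close>

text \<open>A nonzero \<open>g\<close> over \<open>F\<close> of least degree \<open>m\<close>
  killing \<open>\<beta>\<close> divides \<open>X^d - \<beta>^d\<close>, hence is a scalar multiple
  of a product of \<open>m\<close> factors \<open>X - \<xi>^i \<beta>\<close>. Its constant term is
  a nonzero element of \<open>F\<close> times \<open>\<beta>^m\<close>, so \<open>m < d\<close>
  would put \<open>\<beta>^m\<close> into \<open>F\<close>.\<close>

lemma kummer_min_degree:
  assumes F: "sfield F" and \<xi>: "\<xi> \<in> F" "primitive_root_of_unity d \<xi>" and d: "d > 0"
    and \<beta>: "\<beta> \<noteq> 0" "\<beta> ^ d \<in> F" "\<And>m. 0 < m \<Longrightarrow> m < d \<Longrightarrow> \<beta> ^ m \<notin> F"
    and p: "coeffs_in F p" "poly p \<beta> = 0" "Polynomial.degree p < d"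
  shows "p = 0"
proof (rule ccontr)
  assume "p \<noteq> 0"
  define Q where "Q n \<longleftrightarrow> (\<exists>p. coeffs_in F p \<and> poly p \<beta> = 0 \<and> p \<noteq> 0 \<and> Polynomial.degree p = n)" for n
  have "Q (Polynomial.degree p)" using p \<open>p \<noteq> 0\<close> by (auto simp: Q_def)
  define m where "m = (LEAST n. Q n)"
  have "Q m" "m \<le> Polynomial.degree p" unfolding m_def using \<open>Q _\<close> by (auto intro: LeastI Least_le)
  then obtain g where g: "coeffs_in F g" "poly g \<beta> = 0" "g \<noteq> 0" "Polynomial.degree g = m"
    by (auto simp: Q_def)
  have "m < d" using \<open>m \<le> _\<close> p by simp
  have "m > 0" using g by (metis degree_eq_zeroE gr0I poly_pCons poly_0 mult_zero_right add_0_right pCons_0_0)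
  have min: "r = 0" if "coeffs_in F r" "poly r \<beta> = 0" "r = 0 \<or> Polynomial.degree r < m" for r
  proof (rule ccontr)
    assume "r \<noteq> 0"
    then have "Q (Polynomial.degree r)" "Polynomial.degree r < m" using that by (auto simp: Q_def)
    then show False using not_less_Least[of "Polynomial.degree r" Q] unfolding m_def by blast
  qed
  have "coeffs_in F (Polynomial.monom 1 d - [:\<beta> ^ d:])"
    using \<beta> by (auto intro!: coeffs_in_simps[OF F] sfieldD[OF F])
  from division_in_subfield[OF F g(1,3) this] obtain s r where
    sr: "coeffs_in F s" "coeffs_in F r" "Polynomial.monom 1 d - [:\<beta> ^ d:] = g * s + r"
      "r = 0 \<or> Polynomial.degree r < m" using g by auto
  have "poly (g * s + r) \<beta> = 0" unfolding sr(3)[symmetric] by (simp add: poly_monom)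
  then have "r = 0" using g sr by (intro min) auto
  then have "g dvd (\<Prod>i<d. [:- (\<xi> ^ i * \<beta>), 1:])"
    using sr(3) unfolding prim_root_factor[OF \<xi>(2) d \<beta>(1)] by simp
  from dvd_prod_linear[OF _ this] obtain B c where B: "B \<subseteq> {..<d}"
    and gB: "g = Polynomial.smult c (\<Prod>i\<in>B. [:- (\<xi> ^ i * \<beta>), 1:])" by auto
  have "finite B" using B finite_subset by blast
  have c: "c \<noteq> 0" using g gB by auto
  have "lead_coeff g = c" unfolding gB by (simp add: lead_coeff_smult lead_coeff_prod)
  then have cF: "c \<in> F" using g by (auto simp: coeffs_in_def)
  have "m = card B" using g(4) c unfolding gB by (simp add: degree_prod_eq_sum_degree)
  have "poly g 0 = c * (\<Prod>i\<in>B. - (\<xi> ^ i)) * \<beta> ^ m"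
    unfolding gB \<open>m = card B\<close> by (simp add: poly_prod prod.distrib flip: mult_minus_left)
  moreover have "poly g 0 \<in> F" using poly_in[OF F g(1)] sfieldD[OF F] by blast
  moreover have pF: "(\<Prod>i\<in>B. - (\<xi> ^ i)) \<in> F" using \<xi> by (intro sfield_prod[OF F] sfieldD[OF F])
  moreover have "\<xi> \<noteq> 0" using \<xi> d by (auto simp: primitive_root_of_unity_def power_0_left)
  ultimately have "\<beta> ^ m = poly g 0 / (c * (\<Prod>i\<in>B. - (\<xi> ^ i)))"
    using c \<open>finite B\<close> by (simp add: field_simps)
  also have "\<dots> \<in> F" using \<open>poly g 0 \<in> F\<close> cF pF by (intro sfieldD[OF F])
  finally show False using \<beta>(3) \<open>m > 0\<close> \<open>m < d\<close> by blast
qed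

text \<open>Modulo \<open>X^d - \<beta>^d\<close> every polynomial reduces to degree below
  \<open>d\<close>, where vanishing at the radical means being zero. The powers of
  \<open>\<gamma>\<close> avoid the image field just as those of \<open>\<beta>\<close> avoid
  \<open>F\<close>, so on both sides vanishing amounts to a zero remainder.\<close>

lemma hom_extend_kummer:
  assumes F: "sfield F" and \<xi>: "\<xi> \<in> F" "primitive_root_of_unity d \<xi>" and d: "d > 0"
    and \<beta>: "\<beta> \<noteq> 0" "\<beta> ^ d \<in> F" "\<And>m. 0 < m \<Longrightarrow> m < d \<Longrightarrow> \<beta> ^ m \<notin> F"
    and h: "hom_on F \<phi>" and \<gamma>: "\<gamma> ^ d = \<phi> (\<beta> ^ d)"
  shows "\<exists>\<psi>. hom_on (adjoin F {\<beta>}) \<psi> \<and> (\<forall>a\<in>F. \<psi> a = \<phi> a) \<and> \<psi> \<beta> = \<gamma>"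
proof (rule hom_extend_single[OF F h])
  note hD = hom_onD[OF F h]
  have \<gamma>0: "\<gamma> \<noteq> 0"
  proof
    assume "\<gamma> = 0"
    then have "\<phi> (\<beta> ^ d) = 0" using \<gamma> d by (simp add: power_0_left)
    then show False using hD(10)[OF \<beta>(2)] \<beta>(1) by simp
  qed
  have F': "sfield (\<phi> ` F)" by (rule sfield_hom_image[OF F h])
  have prim: "primitive_root_of_unity d (\<phi> \<xi>)"
    unfolding primitive_root_of_unity_def
  proof (intro conjI allI impI)
    show "\<phi> \<xi> ^ d = 1" using hD(9)[OF \<xi>(1), of d] \<xi>(2) hD(1) by (simp add: primitive_root_of_unity_def)
    fix k assume k: "0 < k \<and> k < d"
    show "\<phi> \<xi> ^ k \<noteq> 1"
    proof
      assume "\<phi> \<xi> ^ k = 1"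
      then have "\<phi> (\<xi> ^ k) = \<phi> 1" using hD(9)[OF \<xi>(1), of k] hD(1) by simp
      then have "\<xi> ^ k = 1" using hom_on_inj[OF F h] \<xi>(1) by (auto simp: inj_on_def sfieldD[OF F])
      then show False using \<xi>(2) k by (auto simp: primitive_root_of_unity_def)
    qed
  qed
  \<comment> \<open>If \<open>\<gamma>^m\<close> were the image of \<open>y\<close>, injectivity
    would give \<open>y^d = (\<beta>^m)^d\<close>; then \<open>y\<close> and
    \<open>\<beta>^m\<close> differ by a power of \<open>\<xi>\<close>, which lies in
    \<open>F\<close>.\<close>
  have \<gamma>m: "\<gamma> ^ m \<notin> \<phi> ` F" if m: "0 < m" "m < d" for m
  proof
    assume "\<gamma> ^ m \<in> \<phi> ` F"
    then obtain y where y: "y \<in> F" "\<gamma> ^ m = \<phi> y" by blast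
    have "\<phi> (y ^ d) = (\<gamma> ^ d) ^ m" using y hD(9)[OF y(1), of d] by (simp add: mult.commute flip: power_mult y(2))
    also have "\<dots> = \<phi> ((\<beta> ^ d) ^ m)" using \<gamma> hD(9)[OF \<beta>(2)] by simp
    finally have "y ^ d = (\<beta> ^ m) ^ d"
      using hom_on_inj[OF F h] y \<beta>(2) sfieldD(9)[OF F]
      by (metis inj_onD mult.commute power_mult)
    from root_of_unity_multiple[OF \<xi>(2) d _ this] obtain i where i: "y = \<xi> ^ i * \<beta> ^ m"
      using \<beta>(1) by auto
    have "\<xi> \<noteq> 0" using \<xi> d by (auto simp: primitive_root_of_unity_def power_0_left)
    then have "\<beta> ^ m = y / \<xi> ^ i" using i by simp
    then have "\<beta> ^ m \<in> F" using y \<xi> by (simp add: sfieldD[OF F])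
    then show False using \<beta>(3) m by blast
  qed
  fix p assume p: "coeffs_in F p"
  let ?b = "Polynomial.monom 1 d - [:\<beta> ^ d:]"
  have b: "coeffs_in F ?b" using \<beta> by (auto intro!: coeffs_in_simps[OF F] sfieldD[OF F])
  have db: "Polynomial.degree ?b = d" unfolding prim_root_factor[OF \<xi>(2) d \<beta>(1)]
    by (subst degree_prod_eq_sum_degree) auto
  have "?b \<noteq> 0" using db d by auto
  from division_in_subfield[OF F b this p] obtain s r where
    sr: "coeffs_in F s" "coeffs_in F r" "p = ?b * s + r" "r = 0 \<or> Polynomial.degree r < d"
    using db by auto
  note ms = map_poly_hom_simps[OF F h]
  have pb: "poly (map_poly \<phi> ?b) \<gamma> = 0"
    using \<gamma> \<beta>(2)
    by (simp add: ms coeffs_in_simps[OF F] sfieldD[OF F] map_poly_monom hD map_poly_pCons poly_monom)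
  have "poly p \<beta> = poly r \<beta>" unfolding sr(3) by (simp add: poly_monom)
  also have "\<dots> = 0 \<longleftrightarrow> r = 0"
    using kummer_min_degree[OF F \<xi> d \<beta> sr(2)] sr(4) d by auto
  also have "\<dots> \<longleftrightarrow> poly (map_poly \<phi> r) \<gamma> = 0"
  proof
    assume "poly (map_poly \<phi> r) \<gamma> = 0"
    moreover have "coeffs_in (\<phi> ` F) (map_poly \<phi> r)"
      using sr(2) by (auto simp: coeffs_in_def coeff_map_poly hD)
    moreover have "Polynomial.degree (map_poly \<phi> r) < d"
      using sr(4) d map_poly_degree_leq[of \<phi> r] by auto
    ultimately have "map_poly \<phi> r = 0"
      using kummer_min_degree[OF F' _ prim d \<gamma>0 _ \<gamma>m, of "map_poly \<phi> r"] \<xi>(1) \<gamma> \<beta>(2) by auto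
    then show "r = 0" using ms(5)[OF sr(2)] by simp
  qed auto
  also have "poly (map_poly \<phi> r) \<gamma> = poly (map_poly \<phi> p) \<gamma>"
    unfolding sr(3) using pb by (simp add: ms b sr coeffs_in_simps[OF F])
  finally show "poly p \<beta> = 0 \<longleftrightarrow> poly (map_poly \<phi> p) \<gamma> = 0" .
qed

lemma hom_extend_transcendental:
  assumes F: "sfield F" and h: "hom_on F \<phi>"
    and t: "\<And>p. coeffs_in F p \<Longrightarrow> poly p t = 0 \<Longrightarrow> p = 0"
    and u: "\<And>p. coeffs_in (\<phi> ` F) p \<Longrightarrow> poly p u = 0 \<Longrightarrow> p = 0"
  shows "\<exists>\<psi>. hom_on (adjoin F {t}) \<psi> \<and> (\<forall>a\<in>F. \<psi> a = \<phi> a) \<and> \<psi> t = u"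
proof (rule hom_extend_single[OF F h])
  fix p assume p: "coeffs_in F p"
  have "coeffs_in (\<phi> ` F) (map_poly \<phi> p)"
    using p by (auto simp: coeffs_in_def coeff_map_poly hom_onD[OF F h])
  then show "poly p t = 0 \<longleftrightarrow> poly (map_poly \<phi> p) u = 0"
    using t[OF p] u map_poly_hom_simps(5)[OF F h p] by (metis map_poly_0 poly_0)
qed

section \<open>Roots of power series\<close>

lemma fps_power_cong_upto:
  fixes f g :: "'a::comm_ring_1 fps"
  assumes "\<And>i. i \<le> n \<Longrightarrow> fps_nth f i = fps_nth g i" "i \<le> n"
  shows "fps_nth (f ^ d) i = fps_nth (g ^ d) i"
  using assms(2) by (induction d arbitrary: i) (auto simp: fps_mult_nth assms(1) intro!: sum.cong)

text \<open>Hensel's lemma for \<open>Q^d = P\<close>, solved one coefficient at a time: the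
  coefficient to be found enters linearly, multiplied by \<open>d b^(d-1)\<close>, which is
  invertible.\<close>

lemma fps_root_exists:
  fixes P :: "'a::field fps"
  assumes b: "b ^ d = fps_nth P 0" "b \<noteq> 0" and d: "of_nat d \<noteq> (0::'a)"
  shows "\<exists>Q. Q ^ d = P \<and> fps_nth Q 0 = b"
proof -
  define R where "R n Q \<longleftrightarrow> fps_nth Q 0 = b \<and> (\<forall>i\<le>n. fps_nth (Q ^ d) i = fps_nth P i)" for n Q
  have step: "\<exists>Q'. R (Suc n) Q' \<and> (\<forall>i\<le>n. fps_nth Q' i = fps_nth Q i)" if Q: "R n Q" for n Q
  proof -
    let ?e = "fps_nth P (Suc n) - fps_nth (Q ^ d) (Suc n)"
    \<comment> \<open>One Newton step: the error at index \<open>Suc n\<close>, divided by the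
      derivative of \<open>x^d\<close> at \<open>b\<close>.\<close>
    define c where "c = ?e / (of_nat d * b ^ (d - 1))"
    define Q' where "Q' = Q + fps_const c * fps_X ^ Suc n"
    \<comment> \<open>The quotient of \<open>Q'^d - Q^d\<close> by \<open>Q' - Q\<close>; only its
      constant term affects the coefficient at \<open>Suc n\<close>.\<close>
    define T where "T = (\<Sum>i<d. Q ^ (d - Suc i) * Q' ^ i)"
    have low: "fps_nth Q' i = fps_nth Q i" if "i \<le> n" for i
      using that by (simp add: Q'_def del: power_Suc)
    have "fps_nth T 0 = (\<Sum>i<d. b ^ (d - 1))"
      using Q low[of 0] unfolding T_def
      by (auto simp: fps_sum_nth R_def fps_power_zeroth simp flip: power_add intro!: sum.cong)
    then have T0: "fps_nth T 0 = of_nat d * b ^ (d - 1)" by simp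
    have "Q' ^ d - Q ^ d = (Q' - Q) * T"
      unfolding T_def by (rule power_diff_sumr2)
    then have "Q' ^ d = Q ^ d + fps_const c * fps_X ^ Suc n * T"
      by (simp add: Q'_def algebra_simps)
    then have "fps_nth (Q' ^ d) i = fps_nth (Q ^ d) i + c * fps_nth (fps_X ^ Suc n * T) i" for i
      by (simp add: mult.assoc del: power_Suc)
    then have co: "fps_nth (Q' ^ d) i = fps_nth (Q ^ d) i + (if i < Suc n then 0 else c * fps_nth T (i - Suc n))" for i
      by (simp add: fps_X_power_mult_nth del: power_Suc)
    have "R (Suc n) Q'"
      unfolding R_def
    proof (intro conjI allI impI)
      show "fps_nth Q' 0 = b" using low[of 0] Q by (simp add: R_def)
      fix i assume "i \<le> Suc n"
      then consider "i \<le> n" | "i = Suc n" by linarith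
      then show "fps_nth (Q' ^ d) i = fps_nth P i"
        by cases (use Q b d in \<open>auto simp: co R_def T0 c_def\<close>)
    qed
    then show ?thesis using low by blast
  qed
  have "R 0 (fps_const b)" using b by (simp add: R_def)
  then obtain S where S: "\<And>n. R n (S n)" "\<And>n. \<forall>i\<le>n. fps_nth (S (Suc n)) i = fps_nth (S n) i"
    using dependent_nat_choice[of R "\<lambda>n Q Q'. \<forall>i\<le>n. fps_nth Q' i = fps_nth Q i"] step by metis
  \<comment> \<open>Diagonal limit: the coefficient at \<open>n\<close> is frozen from stage
    \<open>n\<close> on.\<close>
  define L where "L = Abs_fps (\<lambda>n. fps_nth (S n) n)"
  have agree: "fps_nth (S (n + k)) i = fps_nth (S n) i" if "i \<le> n" for n k i
    by (induction k) (use S(2) that in auto)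
  have "fps_nth (L ^ d) n = fps_nth P n" for n
  proof -
    have "fps_nth L i = fps_nth (S n) i" if "i \<le> n" for i
      using agree[of i i "n - i"] that by (simp add: L_def)
    from fps_power_cong_upto[OF this, of n n d] show ?thesis using S(1)[of n] by (simp add: R_def)
  qed
  moreover have "fps_nth L 0 = b" using S(1)[of 0] by (simp add: L_def R_def)
  ultimately show ?thesis by (auto simp: fps_eq_iff)
qed

lemma poly_map_fps_const:
  "poly (map_poly fps_const q) (fps_of_poly r) = fps_of_poly (pcompose q (r :: 'a::field poly))"
  by (induction q) (auto simp: map_poly_pCons pcompose_pCons fps_of_poly_add fps_of_poly_mult fps_of_poly_const)

text \<open>Evaluating \<open>q\<close> at \<open>a + X\<close> is composition with a polynomial of
  degree 1, which kills no nonzero \<open>q\<close>.\<close>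

lemma transcendental_fps_const:
  assumes "poly (map_poly fps_const q) (fps_const a + fps_X) = (0 :: 'a::field fps)"
  shows "q = 0"
proof -
  have "fps_of_poly [:a, 1:] = fps_const a + fps_X"
    by (simp add: fps_of_poly_pCons)
  then have "fps_of_poly (pcompose q [:a, 1:]) = 0"
    using assms poly_map_fps_const[of q "[:a,1:]"] by (simp only:)
  then have "poly.coeff (pcompose q [:a, 1:]) n = 0" for n
    by (metis fps_of_poly_nth fps_zero_nth)
  then have "pcompose q [:a, 1:] = 0" by (simp add: poly_eq_iff)
  then show "q = 0" by (rule pcompose_eq_0) simp
qed

section \<open>A labelled tree of power series\<close>

abbreviation unit_map :: "nat \<Rightarrow> 'a::comm_ring_1 \<Rightarrow> 'a \<Rightarrow> 'a" where
  "unit_map d c \<equiv> \<lambda>x. x ^ d + c"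

text \<open>\<open>u - v\<close> divides \<open>u^d - v^d\<close>, and this survives iteration.
  Among power series, divisibility bounds the order of vanishing.\<close>

lemma iterate_diff_dvd:
  fixes y z :: "'a::comm_ring_1"
  shows "(y - z) dvd ((unit_map d c ^^ n) y - (unit_map d c ^^ n) z)"
proof (induction n)
  case (Suc n)
  have "u - v dvd u ^ d - v ^ d" for u v :: 'a
    unfolding power_diff_sumr2 by simp
  from dvd_trans[OF Suc this] show ?case by simp
qed simp

lemma fps_const_iterate:
  "(unit_map d (fps_const c) ^^ n) (fps_const x) = fps_const ((unit_map d c ^^ n) (x::'a::comm_ring_1))"
  by (induction n) (simp_all add: fps_const_power)

lemma words_simps [simp]:
  "[] \<in> words d" "w @ u \<in> words d \<longleftrightarrow> w \<in> words d \<and> u \<in> words d" "x # w \<in> words d \<longleftrightarrow> x \<in> {1..d} \<and> w \<in> words d"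
  by (auto simp: words_def)

lemma words_take: "w \<in> words d \<Longrightarrow> take n w \<in> words d"
  by (auto simp: words_def dest: in_set_takeD)

text \<open>Iterating the tower relation from \<open>w0\<close> back to the root exhibits \<open>fps_X\<close> as a multiple of
  \<open>lab w0 - fps_const c\<close>, whose order is therefore 1. Since \<open>lab w0\<close> is not the constant \<open>c\<close>, there is
  no \<open>d\<close>-th root below \<open>w0\<close>, and the values of \<open>lab\<close> there are junk.\<close>

lemma local_labelling:
  fixes c \<xi> :: "'a::field"
  assumes d: "d > 0" "of_nat d \<noteq> (0::'a)" and \<xi>: "primitive_root_of_unity d \<xi>"
    and roots: "\<And>u::'a. u \<noteq> 0 \<Longrightarrow> \<exists>r. r ^ d = u"
    and pci: "\<And>n m. n \<noteq> m \<Longrightarrow> (unit_map d c ^^ n) 0 \<noteq> (unit_map d c ^^ m) 0"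
    and w0: "w0 \<in> words d"
  obtains lab :: "nat list \<Rightarrow> 'a fps" where
    "lab [] = fps_const ((unit_map d c ^^ Suc (length w0)) 0) + fps_X"
    "\<And>w. w \<in> words d \<Longrightarrow> length w \<le> length w0 \<Longrightarrow> w \<noteq> w0 \<Longrightarrow> lab (w @ [d]) ^ d = lab w - fps_const c"
    "\<And>w x. w \<in> words d \<Longrightarrow> x \<in> {1..d} \<Longrightarrow> lab (w @ [x]) = fps_const \<xi> ^ x * lab (w @ [d])"
    "fps_nth (lab w0) 0 = c" "fps_nth (lab w0) 1 \<noteq> 0"
proof -
  define N where "N = length w0"
  \<comment> \<open>Indexed from \<open>c = f(0)\<close>, so \<open>it n\<close> is
    \<open>f^(n+1)(0)\<close>: the root carries \<open>it N\<close>, and \<open>w0\<close>, at depth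
    \<open>N\<close>, carries \<open>it 0 = c\<close>.\<close>
  define it where "it n = (unit_map d c ^^ n) c" for n
  have it_Suc: "it (Suc n) = it n ^ d + c" for n by (simp add: it_def)
  have it0: "(unit_map d c ^^ Suc n) 0 = it n" for n
    using d by (simp add: it_def funpow_Suc_right power_0_left del: funpow.simps)
  have it_inj: "it n \<noteq> it m" if "n \<noteq> m" for n m using pci[of "Suc n" "Suc m"] that by (simp only: it0) simp
  have xd: "\<xi> ^ d = 1" and \<xi>0: "\<xi> \<noteq> 0" using \<xi> d by (auto simp: primitive_root_of_unity_def power_0_left)
  \<comment> \<open>Here \<open>v\<close> is a reversed word. On the path to \<open>w0\<close> the
    choice of root is forced: the child in direction \<open>w0 ! length v\<close> must have constant
    term \<open>it (N - length v - 1)\<close>, the next point of the critical orbit on the way back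
    to \<open>c\<close>. Off the path any root will do.\<close>
  define good where "good v P Q \<longleftrightarrow> Q ^ d = P - fps_const c \<and>
    (length v < N \<and> rev v = take (length v) w0 \<longrightarrow> \<xi> ^ (w0 ! length v) * fps_nth Q 0 = it (N - length v - 1))"
    for v :: "nat list" and P Q :: "'a fps"
  define rt where "rt v P = (SOME Q. good v P Q)" for v P
  \<comment> \<open>List recursion strips the head whereas children are appended at the end; hence
    the recursion over reversed words.\<close>
  define labr where "labr = rec_list (fps_const (it N) + fps_X) (\<lambda>x v P. fps_const \<xi> ^ x * rt v P)"
  define lab where "lab w = labr (rev w)" for w
  have lab_Nil: "lab [] = fps_const (it N) + fps_X" by (simp add: lab_def labr_def)
  have lab_snoc: "lab (w @ [x]) = fps_const \<xi> ^ x * rt (rev w) (lab w)" for w x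
    by (simp add: lab_def labr_def)
  have fcd: "fps_const \<xi> ^ d = 1" using xd by (simp add: fps_const_power)
  have lab_d: "lab (w @ [d]) = rt (rev w) (lab w)" for w by (simp only: lab_snoc fcd mult_1_left)
  have good_rt: "good v P (rt v P)"
    if "fps_nth P 0 \<noteq> c" "length v < N \<and> rev v = take (length v) w0 \<longrightarrow> fps_nth P 0 = it (N - length v)" for v P
  proof -
    have "\<exists>b. b ^ d = fps_nth P 0 - c \<and> (length v < N \<and> rev v = take (length v) w0 \<longrightarrow>
         \<xi> ^ (w0 ! length v) * b = it (N - length v - 1))"
    proof (cases "length v < N \<and> rev v = take (length v) w0")
      case True
      then have "fps_nth P 0 = it (N - length v - 1) ^ d + c"
        using that it_Suc[of "N - length v - 1"] by (simp add: Suc_diff_Suc)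
      moreover have "(\<xi> ^ n) ^ d = 1" for n using xd by (metis mult.commute power_mult power_one)
      ultimately show ?thesis using \<xi>0
        by (intro exI[of _ "it (N - length v - 1) / \<xi> ^ (w0 ! length v)"]) (auto simp: power_divide)
    next
      case False
      then show ?thesis using roots[of "fps_nth P 0 - c"] that(1) by auto
    qed
    then obtain b where b: "b ^ d = fps_nth P 0 - c" "length v < N \<and> rev v = take (length v) w0 \<longrightarrow>
         \<xi> ^ (w0 ! length v) * b = it (N - length v - 1)" by blast
    have "b \<noteq> 0" using b(1) that(1) d by (auto simp: power_0_left)
    with fps_root_exists[of b d "P - fps_const c"] b d obtain Q where "Q ^ d = P - fps_const c" "fps_nth Q 0 = b"
      by auto
    then have "good v P Q" using b by (auto simp: good_def)
    then show ?thesis unfolding rt_def by (rule someI)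
  qed
  \<comment> \<open>Iterating from depth \<open>length w\<close> back to the root recovers
    \<open>it N\<close>. A constant term \<open>c\<close> at depth below \<open>N\<close> would give
    \<open>it (length w) = it N\<close>, contrary to \<open>it_inj\<close>; so all roots needed
    there are roots of units.\<close>
  have main: "(unit_map d c ^^ length w) (fps_nth (lab w) 0) = it N \<and>
      (w = take (length w) w0 \<longrightarrow> fps_nth (lab w) 0 = it (N - length w))"
    if "w \<in> words d" "length w \<le> N" for w
    using that
  proof (induction w rule: rev_induct)
    case Nil
    then show ?case by (simp add: lab_Nil)
  next
    case (snoc x w)
    then have IH: "(unit_map d c ^^ length w) (fps_nth (lab w) 0) = it N"
      "w = take (length w) w0 \<longrightarrow> fps_nth (lab w) 0 = it (N - length w)" and lw: "length w < N"
      by auto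
    have "fps_nth (lab w) 0 \<noteq> c"
      using IH(1) it_inj[of "length w" N] lw unfolding it_def by auto
    then have g: "good (rev w) (lab w) (rt (rev w) (lab w))"
      using IH(2) by (intro good_rt) auto
    let ?r = "rt (rev w) (lab w)"
    have r: "?r ^ d = lab w - fps_const c" using g by (simp add: good_def)
    have "lab (w @ [x]) ^ d = (fps_const \<xi> ^ d) ^ x * ?r ^ d"
      unfolding lab_snoc by (simp add: power_mult_distrib mult.commute flip: power_mult)
    then have "lab (w @ [x]) ^ d = lab w - fps_const c" using fcd r by simp
    then have "fps_nth (lab (w @ [x])) 0 ^ d = fps_nth (lab w) 0 - c"
      by (metis fps_power_zeroth fps_sub_nth fps_nth_fps_const)
    then have 1: "(unit_map d c ^^ length (w @ [x])) (fps_nth (lab (w @ [x])) 0) = it N"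
      using IH(1) by (simp add: funpow_swap1 del: funpow.simps) (simp add: funpow_Suc_right del: funpow.simps)
    have 2: "fps_nth (lab (w @ [x])) 0 = it (N - length (w @ [x]))" if "w @ [x] = take (length (w @ [x])) w0"
    proof -
      have "length w < length w0" using lw by (simp add: N_def)
      then have "take (length (w @ [x])) w0 = take (length w) w0 @ [w0 ! length w]"
        by (simp add: take_Suc_conv_app_nth)
      with that have "w @ [x] = take (length w) w0 @ [w0 ! length w]" by metis
      then have "w = take (length w) w0" "x = w0 ! length w" unfolding append1_eq_conv by blast+
      then show ?thesis using g lw unfolding lab_snoc good_def
        by (simp add: fps_power_zeroth)
    qed
    show ?case using 1 2 by blast
  qed
  \<comment> \<open>Needed at depth \<open>N\<close>: it leaves \<open>w0\<close> as the only word
    of its length with constant term \<open>c\<close>, so that the roots below all others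
    exist.\<close>
  have inj: "u = w" if "u \<in> words d" "w \<in> words d" "length u = length w" "length w \<le> N"
    "fps_nth (lab u) 0 = fps_nth (lab w) 0" for u w
    using that
  proof (induction u arbitrary: w rule: rev_induct)
    case Nil
    then show ?case by simp
  next
    case (snoc x u)
    then obtain y v where w: "w = v @ [y]" by (cases w rule: rev_cases) auto
    have lv: "length v < N" "length u < N" "length u = length v" using snoc.prems w by auto
    have dth: "fps_nth (lab (v @ [y])) 0 = \<xi> ^ y * fps_nth (rt (rev v) (lab v)) 0 \<and>
       fps_nth (lab (v @ [y])) 0 ^ d = fps_nth (lab v) 0 - c \<and> fps_nth (lab v) 0 \<noteq> c"
      if "v \<in> words d" "length v < N" for v y
    proof -
      have nc: "fps_nth (lab v) 0 \<noteq> c"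
        using main[of v] it_inj[of "length v" N] that unfolding it_def by auto
      then have "good (rev v) (lab v) (rt (rev v) (lab v))"
        using main[of v] that by (intro good_rt) auto
      then have r: "rt (rev v) (lab v) ^ d = lab v - fps_const c" by (simp add: good_def)
      then have "fps_nth (rt (rev v) (lab v)) 0 ^ d = fps_nth (lab v) 0 - c"
        by (metis fps_power_zeroth fps_sub_nth fps_nth_fps_const)
      moreover have "(\<xi> ^ n) ^ d = 1" for n using xd by (metis mult.commute power_mult power_one)
      ultimately show ?thesis using nc by (simp add: lab_snoc fps_power_zeroth power_mult_distrib)
    qed
    have "fps_nth (lab u) 0 = fps_nth (lab v) 0"
      using dth[of u x] dth[of v y] snoc.prems(1,2,5) unfolding w by (metis add_diff_cancel_right' diff_add_cancel lv(1,2) words_simps(2))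
    then have "u = v" using snoc w lv by auto
    moreover have "\<xi> ^ x = \<xi> ^ y"
      using dth[of u x] dth[of v y] snoc.prems w lv \<open>u = v\<close> d by (auto simp: power_0_left)
    then have "x mod d = y mod d" using prim_root_pow_eq_iff[OF \<xi> d(1)] by blast
    then have "x = y" using snoc.prems w
      by (cases "x = d"; cases "y = d") (auto simp: mod_less)
    ultimately show ?case using w by simp
  qed
  have w0c: "fps_nth (lab w0) 0 = c"
    using main[of w0] w0 by (simp add: N_def it_def)
  have notc: "fps_nth (lab w) 0 \<noteq> c" if "w \<in> words d" "length w \<le> N" "w \<noteq> w0" for w
  proof (cases "length w = N")
    case True
    then show ?thesis using inj[of w w0] that w0 w0c by (auto simp: N_def)
  next
    case False
    then show ?thesis using main[of w] it_inj[of "length w" N] that unfolding it_def by auto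
  qed
  have pow: "lab (w @ [d]) ^ d = lab w - fps_const c" if "w \<in> words d" "length w \<le> N" "w \<noteq> w0" for w
    using good_rt[OF notc[OF that], of "rev w"] main[of w] that unfolding lab_d by (auto simp: good_def)
  have up: "(unit_map d (fps_const c) ^^ length w) (lab w) = lab []" if "w \<in> words d" "length w \<le> N" for w
    using that
  proof (induction w rule: rev_induct)
    case (snoc x w)
    then have "w \<noteq> w0" by (auto simp: N_def)
    then have p: "lab (w @ [d]) ^ d = lab w - fps_const c" using snoc.prems pow[of w] by auto
    have "lab (w @ [x]) ^ d = (fps_const \<xi> ^ d) ^ x * lab (w @ [d]) ^ d"
      unfolding lab_d lab_snoc[of w x] by (simp add: power_mult_distrib mult.commute flip: power_mult)
    then have "lab (w @ [x]) ^ d = lab w - fps_const c" by (simp only: fcd p power_one mult_1_left)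
    then show ?case using snoc
      by (simp add: funpow_Suc_right del: funpow.simps)
  qed simp
  have "(lab w0 - fps_const c) dvd
      ((unit_map d (fps_const c) ^^ N) (lab w0) - (unit_map d (fps_const c) ^^ N) (fps_const c))"
    by (rule iterate_diff_dvd)
  also have "(unit_map d (fps_const c) ^^ N) (lab w0) - (unit_map d (fps_const c) ^^ N) (fps_const c) = fps_X"
    using up[of w0] w0 by (simp add: lab_Nil fps_const_iterate it_def N_def)
  finally obtain T where T: "fps_X = (lab w0 - fps_const c) * T" by (elim dvdE)
  have "fps_nth ((lab w0 - fps_const c) * T) 1 = 1" unfolding T[symmetric] by simp
  then have "fps_nth (lab w0) 1 \<noteq> 0"
    using w0c by (auto simp: fps_mult_nth)
  show ?thesis
  proof (rule that[of lab])
    show "lab [] = fps_const ((unit_map d c ^^ Suc (length w0)) 0) + fps_X"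
      unfolding it0 lab_Nil N_def ..
    show "lab (w @ [x]) = fps_const \<xi> ^ x * lab (w @ [d])" for w x by (simp only: lab_d lab_snoc[of w x])
  qed (use pow w0c \<open>fps_nth (lab w0) 1 \<noteq> 0\<close> in \<open>auto simp: N_def\<close>)
qed

text \<open>The coefficients of \<open>p\<close> are constants, so reading off
  \<open>fls_nth _ 0\<close> pulls the equation back to power series.\<close>

lemma fls_const_transcendental:
  assumes p: "coeffs_in (fls_const ` F) p" "poly p (fps_to_fls (fps_const a + fps_X)) = (0 :: 'a::field fls)"
  shows "p = 0"
proof -
  define q where "q = map_poly (\<lambda>f. fls_nth f 0) p"
  have pq: "p = map_poly fls_const q"
    using p(1) by (auto intro!: poly_eqI simp: q_def coeffs_in_def coeff_map_poly) (metis fls_const_nth image_iff)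
  have "poly (map_poly fls_const q) (fps_to_fls r) = fps_to_fls (poly (map_poly fps_const q) r)" for q and r :: "'a fps"
    by (induction q) (auto simp: map_poly_pCons fls_times_fps_to_fls)
  then have "fps_to_fls (poly (map_poly fps_const q) (fps_const a + fps_X)) = 0"
    using p(2) pq by (simp only:)
  then have "poly (map_poly fps_const q) (fps_const a + fps_X) = 0" by simp
  then show "p = 0" using transcendental_fps_const pq by fastforce
qed

text \<open>Closure under parents is what puts \<open>\<alpha> w\<close> into the field generated so
  far when \<open>\<beta> w\<close> is about to be adjoined: it is \<open>\<xi> ^ x\<close> times
  the generator at the parent.\<close>

definition tree_closed :: "nat \<Rightarrow> nat list set \<Rightarrow> bool" where
  "tree_closed d A \<longleftrightarrow> A \<subseteq> words d \<and> (\<forall>w x. w @ [x] \<in> A \<longrightarrow> w \<in> A)"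

section \<open>The Kummer tower of preimages\<close>

text \<open>The hypotheses of the theorem in working form: separable closedness becomes the
  existence of \<open>d\<close>-th roots, and post-critical infiniteness is phrased with
  \<open>unit_map\<close>, which also makes sense for power series.\<close>

locale unicritical_tower =
  fixes d :: nat and K :: "'a::field set" and t c \<xi> :: 'a and \<alpha> :: "nat list \<Rightarrow> 'a"
  assumes d2: "d \<ge> 2" and K: "sfield K" and d_nz: "of_nat d \<noteq> (0::'a)"
    and t_trans: "ring.transcendental TR K t" and cK: "c \<in> K"
    and roots: "\<And>u::'a. u \<noteq> 0 \<Longrightarrow> \<exists>r. r ^ d = u"
    and \<xi>: "primitive_root_of_unity d \<xi>"
    and pci: "\<And>n m. n \<noteq> m \<Longrightarrow> (unit_map d c ^^ n) 0 \<noteq> (unit_map d c ^^ m) 0"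
    and lab: "preimage_labelling d \<xi> c t \<alpha>"
begin

definition E0 :: "'a set" where "E0 = adjoin K {\<xi>, t}"

definition \<beta> :: "nat list \<Rightarrow> 'a" where "\<beta> w = \<alpha> (w @ [d])"

definition F :: "nat list set \<Rightarrow> 'a set" where "F A = adjoin E0 (\<beta> ` A)"

lemma d0: "d > 0" using d2 by simp

lemma \<xi>_d: "\<xi> ^ d = 1" and \<xi>_nz: "\<xi> \<noteq> 0"
  using \<xi> d0 by (auto simp: primitive_root_of_unity_def power_0_left)

lemma \<xi>_pow_d: "(\<xi> ^ n) ^ d = 1"
  by (metis \<xi>_d mult.commute power_mult power_one)

lemma \<alpha>_Nil: "\<alpha> [] = t" using lab by (simp add: preimage_labelling_def)

lemma \<beta>_pow: "w \<in> words d \<Longrightarrow> \<beta> w ^ d = \<alpha> w - c"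
  using lab by (simp add: preimage_labelling_def \<beta>_def)

lemma \<alpha>_snoc: "w \<in> words d \<Longrightarrow> x \<in> {1..d} \<Longrightarrow> \<alpha> (w @ [x]) = \<xi> ^ x * \<beta> w"
  using lab unfolding preimage_labelling_def \<beta>_def by blast

lemma \<alpha>_snoc_pow: "w \<in> words d \<Longrightarrow> x \<in> {1..d} \<Longrightarrow> \<alpha> (w @ [x]) ^ d = \<alpha> w - c"
  by (simp add: \<alpha>_snoc power_mult_distrib \<xi>_pow_d \<beta>_pow)

lemma iterate_\<alpha>: "w \<in> words d \<Longrightarrow> (unit_map d c ^^ length w) (\<alpha> w) = t"
proof (induction w rule: rev_induct)
  case (snoc x w)
  then have w: "w \<in> words d" "x \<in> {1..d}" by auto
  have "(unit_map d c ^^ length (w @ [x])) (\<alpha> (w @ [x])) = (unit_map d c ^^ length w) (unit_map d c (\<alpha> (w @ [x])))"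
    by (simp only: length_append_singleton funpow_Suc_right o_apply)
  also have "unit_map d c (\<alpha> (w @ [x])) = \<alpha> w" by (simp only: \<alpha>_snoc_pow[OF w] diff_add_cancel)
  finally show ?case using snoc.IH w(1) by (simp only:)
qed (simp add: \<alpha>_Nil)

lemma K_trans: "coeffs_in K p \<Longrightarrow> poly p t = 0 \<Longrightarrow> p = 0"
  using iffD1[OF transcendental_iff_poly[OF iffD1[OF sfield_iff_subfield K]] t_trans] by blast

text \<open>\<open>\<xi>\<close> is a root of \<open>X^d - 1\<close>, hence algebraic over
  \<open>K\<close>, and transcendence of \<open>t\<close> survives an algebraic extension.\<close>

lemma K\<xi>_trans:
  assumes "coeffs_in (adjoin K {\<xi>}) p" "poly p t = 0"
  shows "p = 0"
proof -
  have "\<not> ring.transcendental TR K \<xi>"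
  proof -
    have "coeffs_in K (Polynomial.monom 1 d - [:1:])"
      using sfieldD(2)[OF K] by (intro coeffs_in_simps[OF K])
    moreover have "poly (Polynomial.monom 1 d - [:1:]) \<xi> = 0" by (simp add: poly_monom \<xi>_d)
    moreover have "Polynomial.monom 1 d - [:1::'a:] \<noteq> 0"
      using d0 by (auto simp: poly_eq_iff coeff_pCons split: nat.splits intro!: exI[of _ d])
    ultimately show ?thesis
      using transcendental_iff_poly[OF iffD1[OF sfield_iff_subfield K], of \<xi>] by blast
  qed
  from transcendental_over_algebraic_extension[OF iffD1[OF sfield_iff_subfield K] this t_trans]
  show ?thesis
    using transcendental_iff_poly[OF iffD1[OF sfield_iff_subfield sfield_adjoin], of K "{\<xi>}" t] assms by blast
qed

lemma t_notin_K: "t \<notin> K"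
proof
  assume "t \<in> K"
  then have "coeffs_in K [:- t, 1:]" by (intro coeffs_in_simps[OF K] sfieldD[OF K])
  from K_trans[OF this] show False by simp
qed

lemma iterate_in_K: "x \<in> K \<Longrightarrow> (unit_map d c ^^ n) x \<in> K"
  by (induction n) (auto intro!: sfieldD[OF K] cK)

lemma \<alpha>_notin_K: "w \<in> words d \<Longrightarrow> \<alpha> w \<notin> K"
  using iterate_\<alpha> iterate_in_K t_notin_K by metis

text \<open>\<open>\<beta> w = 0\<close> would force \<open>\<alpha> w = c\<close>, an element of
  \<open>K\<close>, while iteration from \<open>\<alpha> w\<close> leads to \<open>t\<close>, which
  is not in \<open>K\<close>.\<close>

lemma \<beta>_nz: "w \<in> words d \<Longrightarrow> \<beta> w \<noteq> 0"
  using \<alpha>_notin_K[of w] \<beta>_pow[of w] cK d0 by (auto simp: power_0_left)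

lemma E0: "sfield E0" "K \<subseteq> E0" "\<xi> \<in> E0" "t \<in> E0"
  unfolding E0_def using adjoin_incl[where K=K and S="{\<xi>, t}"] by (blast intro: sfield_adjoin)+

lemma E0_eq: "E0 = adjoin (adjoin K {\<xi>}) {t}"
  unfolding adjoin_adjoin E0_def by (simp add: insert_commute)

lemma F: "sfield (F A)" "E0 \<subseteq> F A" "w \<in> A \<Longrightarrow> \<beta> w \<in> F A"
  unfolding F_def using adjoin_incl[where K=E0 and S="\<beta> ` A"] by (blast intro: sfield_adjoin)+

lemma F_empty: "F {} = E0"
proof
  show "F {} \<subseteq> E0" unfolding F_def by (rule adjoin_least[OF E0(1)]) simp_all
qed (rule F(2))

lemma F_insert: "F (insert w A) = adjoin (F A) {\<beta> w}"
  unfolding F_def adjoin_adjoin by simp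

lemma F_mono: "A \<subseteq> B \<Longrightarrow> F A \<subseteq> F B"
  unfolding F_def by (rule adjoin_mono) auto

lemma \<alpha>_in_F:
  assumes "A \<subseteq> words d" "w = [] \<or> (\<exists>v\<in>A. \<exists>x\<in>{1..d}. w = v @ [x])"
  shows "\<alpha> w \<in> F A"
proof (cases "w = []")
  case True
  then show ?thesis using F(2) E0(4) \<alpha>_Nil by auto
next
  case False
  then obtain v x where v: "v \<in> A" "x \<in> {1..d}" "w = v @ [x]" using assms by blast
  then have "\<alpha> w = \<xi> ^ x * \<beta> v" using assms \<alpha>_snoc by blast
  then show ?thesis using F(3)[OF v(1)] F(2)[of A] E0(3) by (auto intro!: sfieldD[OF F(1)])
qed

lemma tree_closedD:
  assumes "tree_closed d A" "w \<in> A"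
  shows "w = [] \<or> (\<exists>v\<in>A. \<exists>x\<in>{1..d}. w = v @ [x])"
proof (cases w rule: rev_cases)
  case (snoc v x)
  then have "v \<in> A" "v @ [x] \<in> words d" using assms by (auto simp: tree_closed_def)
  then show ?thesis using snoc by auto
qed simp

text \<open>The relations of \<open>preimage_labelling\<close> transported by \<open>\<phi>\<close>,
  for a prospective family of images \<open>\<alpha>'\<close>. It is used with labels in Laurent
  series and with the original labels permuted by a tree automorphism.\<close>

definition compatible :: "('a \<Rightarrow> 'b::field) \<Rightarrow> (nat list \<Rightarrow> 'b) \<Rightarrow> nat list set \<Rightarrow> bool" where
  "compatible \<phi> \<alpha>' A \<longleftrightarrow> \<alpha>' [] = \<phi> t \<and>
     (\<forall>w\<in>A. \<alpha>' (w @ [d]) ^ d = \<alpha>' w - \<phi> c \<and> (\<forall>x\<in>{1..d}. \<alpha>' (w @ [x]) = \<phi> \<xi> ^ x * \<alpha>' (w @ [d])))"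

lemma compatibleD:
  assumes "compatible \<phi> \<alpha>' A"
  shows "\<alpha>' [] = \<phi> t" "w \<in> A \<Longrightarrow> \<alpha>' (w @ [d]) ^ d = \<alpha>' w - \<phi> c"
    "w \<in> A \<Longrightarrow> x \<in> {1..d} \<Longrightarrow> \<alpha>' (w @ [x]) = \<phi> \<xi> ^ x * \<alpha>' (w @ [d])"
  using assms unfolding compatible_def by blast+

lemma compatible_subset: "compatible \<phi> \<alpha>' A \<Longrightarrow> B \<subseteq> A \<Longrightarrow> compatible \<phi> \<alpha>' B"
  unfolding compatible_def by blast

lemma hom_\<alpha>:
  assumes "hom_on (F A) \<phi>" "\<And>x. x \<in> E0 \<Longrightarrow> \<phi> x = \<phi>0 x" "\<And>w. w \<in> A \<Longrightarrow> \<phi> (\<beta> w) = \<alpha>' (w @ [d])"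
    and "compatible \<phi>0 \<alpha>' A" "A \<subseteq> words d" "w = [] \<or> (\<exists>v\<in>A. \<exists>x\<in>{1..d}. w = v @ [x])"
  shows "\<phi> (\<alpha> w) = \<alpha>' w"
proof (cases "w = []")
  case True
  then show ?thesis using assms(2)[OF E0(4)] compatibleD(1)[OF assms(4)] by (simp add: \<alpha>_Nil)
next
  case False
  then obtain v x where v: "v \<in> A" "x \<in> {1..d}" "w = v @ [x]" using assms(6) by blast
  have v': "v \<in> words d" by (rule subsetD[OF assms(5) v(1)])
  have \<xi>F: "\<xi> \<in> F A" by (rule subsetD[OF F(2) E0(3)])
  have "\<phi> (\<alpha> w) = \<phi> (\<xi> ^ x * \<beta> v)" by (simp only: v(3) \<alpha>_snoc[OF v' v(2)])
  also have "\<dots> = \<phi> (\<xi> ^ x) * \<phi> (\<beta> v)"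
    by (rule hom_onD(4)[OF F(1) assms(1) sfieldD(9)[OF F(1) \<xi>F] F(3)[OF v(1)]])
  also have "\<phi> (\<xi> ^ x) = \<phi>0 \<xi> ^ x"
    by (simp only: hom_onD(9)[OF F(1) assms(1) \<xi>F] assms(2)[OF E0(3)])
  also have "\<phi> (\<beta> v) = \<alpha>' (v @ [d])" by (rule assms(3)[OF v(1)])
  also have "\<phi>0 \<xi> ^ x * \<alpha>' (v @ [d]) = \<alpha>' w"
    unfolding v(3) by (rule compatibleD(3)[OF assms(4) v(1,2), symmetric])
  finally show ?thesis .
qed

text \<open>Independence is left as the premise \<open>indep\<close>, since it will itself be
  deduced from this lemma for smaller sets. Generators are adjoined in order of length, each by one
  Kummer extension.\<close>

lemma extend_hom_aux:
  fixes \<phi>0 :: "'a \<Rightarrow> 'b::field"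
  assumes "finite A" "tree_closed d A" "hom_on E0 \<phi>0" "compatible \<phi>0 \<alpha>' A"
    and indep: "\<And>B w m. B \<subset> A \<Longrightarrow> tree_closed d B \<Longrightarrow> w \<in> A - B \<Longrightarrow> tree_closed d (insert w B) \<Longrightarrow>
        (\<And>u. u \<in> B \<Longrightarrow> length u \<le> length w) \<Longrightarrow> 0 < m \<Longrightarrow> m < d \<Longrightarrow> \<beta> w ^ m \<notin> F B"
  shows "\<exists>\<phi>. hom_on (F A) \<phi> \<and> (\<forall>x\<in>E0. \<phi> x = \<phi>0 x) \<and> (\<forall>w\<in>A. \<phi> (\<beta> w) = \<alpha>' (w @ [d]))"
  using assms(1,2,4,5)
proof (induction A rule: finite_psubset_induct)
  case (psubset A)
  show ?case
  proof (cases "A = {}")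
    case True
    then show ?thesis using assms(3) by (auto simp: F_empty)
  next
    case False
    \<comment> \<open>A longest word has no child in \<open>A\<close>, so removing it keeps the set
      closed under parents, and the length bound in \<open>indep\<close> holds.\<close>
    have "Max (length ` A) \<in> length ` A" using False psubset.hyps(1) by (intro Max_in) auto
    then obtain w where w: "w \<in> A" "length w = Max (length ` A)" by force
    have w_max: "length u \<le> length w" if "u \<in> A" for u
      unfolding w(2) using psubset.hyps(1) that by (intro Max_ge) auto
    define B where "B = A - {w}"
    have BA: "B \<subset> A" "A = insert w B" "w \<in> A - B" using w by (auto simp: B_def)
    have Bt: "tree_closed d B"
      unfolding tree_closed_def
    proof (intro conjI allI impI)
      show "B \<subseteq> words d" using psubset.prems(1) BA by (auto simp: tree_closed_def)
      fix v x assume "v @ [x] \<in> B"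
      then have "v @ [x] \<in> A" "v \<in> A" using psubset.prems(1) BA by (auto simp: tree_closed_def)
      moreover have "v \<noteq> w" using w_max[OF \<open>v @ [x] \<in> A\<close>] by auto
      ultimately show "v \<in> B" by (simp add: B_def)
    qed
    have "compatible \<phi>0 \<alpha>' B" using compatible_subset[OF psubset.prems(2)] BA(1) by blast
    from psubset.IH[OF BA(1) Bt this]
    have "\<exists>\<phi>. hom_on (F B) \<phi> \<and> (\<forall>x\<in>E0. \<phi> x = \<phi>0 x) \<and> (\<forall>w\<in>B. \<phi> (\<beta> w) = \<alpha>' (w @ [d]))"
      by (rule meta_mp) (rule psubset.prems(3), use BA in auto)
    then obtain \<phi> where
      \<phi>: "hom_on (F B) \<phi>" "\<And>x. x \<in> E0 \<Longrightarrow> \<phi> x = \<phi>0 x" "\<And>w. w \<in> B \<Longrightarrow> \<phi> (\<beta> w) = \<alpha>' (w @ [d])"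
      by blast
    have wd: "w \<in> words d" "B \<subseteq> words d" using psubset.prems(1) w by (auto simp: tree_closed_def B_def)
    have wB: "w = [] \<or> (\<exists>v\<in>B. \<exists>x\<in>{1..d}. w = v @ [x])"
      using tree_closedD[OF psubset.prems(1) w(1)] by (auto simp: B_def)
    have \<alpha>w: "\<phi> (\<alpha> w) = \<alpha>' w"
      by (rule hom_\<alpha>[OF \<phi> \<open>compatible \<phi>0 \<alpha>' B\<close> wd(2) wB]) auto
    have \<alpha>wF: "\<alpha> w \<in> F B" by (rule \<alpha>_in_F[OF wd(2) wB])
    have cF: "c \<in> F B" "c \<in> E0" using cK E0 F by blast+
    have "\<alpha>' (w @ [d]) ^ d = \<alpha>' w - \<phi>0 c"
      by (rule compatibleD(2)[OF psubset.prems(2) w(1)])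
    also have "\<dots> = \<phi> (\<beta> w ^ d)"
      using hom_onD(6)[OF F(1) \<phi>(1) \<alpha>wF cF(1)] \<alpha>w \<phi>(2)[OF cF(2)] by (simp add: \<beta>_pow[OF wd(1)])
    finally have g: "\<alpha>' (w @ [d]) ^ d = \<phi> (\<beta> w ^ d)" .
    have bF: "\<beta> w ^ d \<in> F B" unfolding \<beta>_pow[OF wd(1)] by (rule sfieldD(7)[OF F(1) \<alpha>wF cF(1)])
    have im: "\<beta> w ^ m \<notin> F B" if "0 < m" "m < d" for m
      by (rule psubset.prems(3)[OF BA(1) Bt BA(3) _ _ that]) (use psubset.prems(1) BA(2) w_max in auto)
    have \<xi>F: "\<xi> \<in> F B" by (rule subsetD[OF F(2) E0(3)])
    from hom_extend_kummer[OF F(1) \<xi>F \<xi> d0 \<beta>_nz[OF wd(1)] bF im \<phi>(1) g]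
    obtain \<psi> where \<psi>: "hom_on (adjoin (F B) {\<beta> w}) \<psi>" "\<forall>a\<in>F B. \<psi> a = \<phi> a" "\<psi> (\<beta> w) = \<alpha>' (w @ [d])"
      by blast
    show ?thesis
    proof (intro exI[of _ \<psi>] conjI ballI)
      show "hom_on (F A) \<psi>" using \<psi>(1) unfolding BA(2) F_insert .
      show "\<psi> x = \<phi>0 x" if "x \<in> E0" for x
        using bspec[OF \<psi>(2) subsetD[OF F(2) that]] \<phi>(2)[OF that] by (rule trans)
      show "\<psi> (\<beta> v) = \<alpha>' (v @ [d])" if "v \<in> A" for v
      proof (cases "v = w")
        case True
        then show ?thesis using \<psi>(3) by simp
      next
        case False
        then have v: "v \<in> B" using that BA(2) by blast
        show ?thesis using bspec[OF \<psi>(2) F(3)[OF v]] \<phi>(3)[OF v] by (rule trans)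
      qed
    qed
  qed
qed

text \<open>Specialisation at the word \<open>w\<close>: as \<open>\<alpha> w - c\<close> goes to a
  series of order 1, an element \<open>\<beta> w ^ m\<close> of \<open>F B\<close> would have an
  image whose order times \<open>d\<close> equals \<open>m\<close>, impossible for
  \<open>0 < m < d\<close>. The words of \<open>B\<close> are at most as long as \<open>w\<close>
  because the local labels satisfy the root relations only up to that depth.\<close>

lemma power_\<beta>_notin_F:
  assumes "finite B" "tree_closed d B" "w \<in> words d" "w \<notin> B" "tree_closed d (insert w B)"
    "\<And>u. u \<in> B \<Longrightarrow> length u \<le> length w" "0 < m" "m < d"
  shows "\<beta> w ^ m \<notin> F B"
  using assms
proof (induction B arbitrary: w m rule: finite_psubset_induct)
  case (psubset B)
  note w = \<open>w \<in> words d\<close> and m = \<open>0 < m\<close> \<open>m < d\<close>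
  obtain lb :: "nat list \<Rightarrow> 'a fps" where
    lb: "lb [] = fps_const ((unit_map d c ^^ Suc (length w)) 0) + fps_X"
    "\<And>u. u \<in> words d \<Longrightarrow> length u \<le> length w \<Longrightarrow> u \<noteq> w \<Longrightarrow> lb (u @ [d]) ^ d = lb u - fps_const c"
    "\<And>u x. u \<in> words d \<Longrightarrow> x \<in> {1..d} \<Longrightarrow> lb (u @ [x]) = fps_const \<xi> ^ x * lb (u @ [d])"
    "fps_nth (lb w) 0 = c" "fps_nth (lb w) 1 \<noteq> 0"
    using local_labelling[OF d0 d_nz \<xi> roots pci w] by blast
  \<comment> \<open>Constant term of the image of \<open>t\<close>: the point of the critical orbit
    for which \<open>c\<close> appears at depth \<open>length w\<close>.\<close>
  define a where "a = (unit_map d c ^^ Suc (length w)) 0"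
  let ?\<tau> = "fps_to_fls (fps_const a + fps_X)"
  let ?Kx = "adjoin K {\<xi>}"
  have hc: "hom_on ?Kx fls_const"
    by (auto simp: hom_on_def fls_plus_const fls_const_mult_const)
  have Kx: "sfield ?Kx" by (rule sfield_adjoin)
  have "\<exists>\<phi>0. hom_on (adjoin ?Kx {t}) \<phi>0 \<and> (\<forall>z\<in>?Kx. \<phi>0 z = fls_const z) \<and> \<phi>0 t = ?\<tau>"
    by (rule hom_extend_transcendental[OF Kx hc]) (erule (1) K\<xi>_trans, erule (1) fls_const_transcendental)
  then obtain \<phi>0 where "hom_on (adjoin ?Kx {t}) \<phi>0" "\<forall>z\<in>?Kx. \<phi>0 z = fls_const z" and \<phi>0t: "\<phi>0 t = ?\<tau>"
    by blast
  then have \<phi>0: "hom_on E0 \<phi>0" and const: "\<forall>z\<in>?Kx. \<phi>0 z = fls_const z"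
    unfolding E0_eq by simp_all
  have Kx_mem: "c \<in> ?Kx" "\<xi> \<in> ?Kx" using adjoin_incl[where K=K and S="{\<xi>}"] cK by blast+
  have \<phi>0c: "\<phi>0 c = fls_const c" "\<phi>0 \<xi> = fls_const \<xi>"
    by (rule bspec[OF const Kx_mem(1)], rule bspec[OF const Kx_mem(2)])
  have Bw: "B \<subseteq> words d" using psubset.prems(1) by (simp add: tree_closed_def)
  have comp: "compatible \<phi>0 (fps_to_fls \<circ> lb) B"
    unfolding compatible_def
  proof (intro conjI ballI)
    show "(fps_to_fls \<circ> lb) [] = \<phi>0 t" using lb(1) \<phi>0t by (simp add: a_def)
    fix u assume u: "u \<in> B"
    have u': "u \<in> words d" "length u \<le> length w" by (rule subsetD[OF Bw u], rule psubset.prems(5)[OF u])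
    have u'': "u \<noteq> w" using psubset.prems(3) u by metis
    have "(fps_to_fls \<circ> lb) (u @ [d]) ^ d = fps_to_fls (lb (u @ [d]) ^ d)"
      by (simp only: o_apply fps_to_fls_power)
    also have "\<dots> = (fps_to_fls \<circ> lb) u - \<phi>0 c"
      unfolding lb(2)[OF u' u''] \<phi>0c by simp
    finally show "(fps_to_fls \<circ> lb) (u @ [d]) ^ d = (fps_to_fls \<circ> lb) u - \<phi>0 c" .
    fix x assume "x \<in> {1..d}"
    from lb(3)[OF u'(1) this]
    have "(fps_to_fls \<circ> lb) (u @ [x]) = fps_to_fls (fps_const \<xi> ^ x) * (fps_to_fls \<circ> lb) (u @ [d])"
      by (simp only: o_apply fls_times_fps_to_fls)
    then show "(fps_to_fls \<circ> lb) (u @ [x]) = \<phi>0 \<xi> ^ x * (fps_to_fls \<circ> lb) (u @ [d])"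
      by (simp add: \<phi>0c fls_const_power)
  qed
  \<comment> \<open>The independence required within proper subsets of \<open>B\<close> is the
    induction hypothesis.\<close>
  have "\<exists>\<phi>. hom_on (F B) \<phi> \<and> (\<forall>x\<in>E0. \<phi> x = \<phi>0 x) \<and> (\<forall>w\<in>B. \<phi> (\<beta> w) = (fps_to_fls \<circ> lb) (w @ [d]))"
    by (rule extend_hom_aux[OF psubset.hyps(1) psubset.prems(1) \<phi>0 comp])
      (rule psubset.IH, use Bw in auto)
  then obtain \<phi> where \<phi>: "hom_on (F B) \<phi>" "\<And>x. x \<in> E0 \<Longrightarrow> \<phi> x = \<phi>0 x"
    "\<And>w. w \<in> B \<Longrightarrow> \<phi> (\<beta> w) = (fps_to_fls \<circ> lb) (w @ [d])" by blast
  have wB: "w = [] \<or> (\<exists>v\<in>B. \<exists>x\<in>{1..d}. w = v @ [x])"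
    using tree_closedD[OF psubset.prems(4), of w] by auto
  have \<alpha>w: "\<phi> (\<alpha> w) = fps_to_fls (lb w)"
    using hom_\<alpha>[OF \<phi> comp Bw wB] by simp
  have \<alpha>wF: "\<alpha> w \<in> F B" by (rule \<alpha>_in_F[OF Bw wB])
  have cF: "c \<in> F B" "c \<in> E0" using cK E0 F by blast+
  show ?case
  proof
    assume y: "\<beta> w ^ m \<in> F B"
    have "\<phi> (\<beta> w ^ m) ^ d = \<phi> ((\<beta> w ^ m) ^ d)"
      by (rule hom_onD(9)[OF F(1) \<phi>(1) y, symmetric])
    also have "(\<beta> w ^ m) ^ d = (\<alpha> w - c) ^ m"
      unfolding \<beta>_pow[OF w, symmetric] by (simp add: mult.commute flip: power_mult)
    also have "\<phi> \<dots> = \<phi> (\<alpha> w - c) ^ m"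
      by (rule hom_onD(9)[OF F(1) \<phi>(1) sfieldD(7)[OF F(1) \<alpha>wF cF(1)]])
    also have "\<phi> (\<alpha> w - c) = \<phi> (\<alpha> w) - \<phi> c"
      by (rule hom_onD(6)[OF F(1) \<phi>(1) \<alpha>wF cF(1)])
    also have "\<phi> (\<alpha> w) - \<phi> c = fps_to_fls (lb w - fps_const c)"
      using \<alpha>w \<phi>(2)[OF cF(2)] \<phi>0c by simp
    finally have "fls_subdegree (\<phi> (\<beta> w ^ m) ^ d) = fls_subdegree (fps_to_fls (lb w - fps_const c) ^ m)"
      by (rule arg_cong)
    moreover have "subdegree (lb w - fps_const c) = 1"
      by (rule subdegreeI) (use lb(4,5) in auto)
    ultimately have "int d * fls_subdegree (\<phi> (\<beta> w ^ m)) = int m"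
      by (simp only: fls_subdegree_pow fls_subdegree_fls_to_fps of_nat_1 mult_1_right)
    then have "int d dvd int m" by (metis dvd_triv_left)
    then show False using m by (auto dest: dvd_imp_le)
  qed
qed

lemma extend_hom:
  fixes \<phi>0 :: "'a \<Rightarrow> 'b::field"
  assumes "finite A" "tree_closed d A" "hom_on E0 \<phi>0" "compatible \<phi>0 \<alpha>' A"
  shows "\<exists>\<phi>. hom_on (F A) \<phi> \<and> (\<forall>x\<in>E0. \<phi> x = \<phi>0 x) \<and> (\<forall>w\<in>A. \<phi> (\<beta> w) = \<alpha>' (w @ [d]))"
proof (rule extend_hom_aux[OF assms])
  show "\<beta> w ^ m \<notin> F B"
    if "B \<subset> A" "tree_closed d B" "w \<in> A - B" "tree_closed d (insert w B)"
        "\<And>u. u \<in> B \<Longrightarrow> length u \<le> length w" "0 < m" "m < d" for B w m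
  proof (rule power_\<beta>_notin_F)
    show "finite B" using that(1) assms(1) by (meson finite_subset psubset_imp_subset)
    show "w \<in> words d" "w \<notin> B" using that(3) assms(2) by (auto simp: tree_closed_def)
  qed (use that in blast)+
qed

end

section \<open>Tree automorphisms and their portraits\<close>

text \<open>\<open>p w\<close> is the letter map at the vertex \<open>w\<close>; it is looked up at
  prefixes of the source word, not of the image, which determines the twist in
  \<open>act_compose\<close>.\<close>

definition act :: "(nat list \<Rightarrow> nat \<Rightarrow> nat) \<Rightarrow> nat list \<Rightarrow> nat list" where
  "act p w = map (\<lambda>i. p (take i w) (w ! i)) [0..<length w]"

lemma act_Nil [simp]: "act p [] = []"
  by (simp add: act_def)

lemma length_act [simp]: "length (act p w) = length w"
  by (simp add: act_def)

lemma act_snoc: "act p (w @ [x]) = act p w @ [p w x]"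
  by (simp add: act_def nth_append)

lemma act_Cons: "act p (x # w) = p [] x # act (\<lambda>u. p (x # u)) w"
proof (induction w rule: rev_induct)
  case Nil
  then show ?case using act_snoc[of p "[]" x] by simp
next
  case (snoc z w)
  then show ?case using act_snoc[of p "x # w" z] by (simp add: act_snoc)
qed

definition aut :: "nat \<Rightarrow> (nat list \<Rightarrow> nat \<Rightarrow> nat) \<Rightarrow> nat list \<Rightarrow> nat list" where
  "aut d p = (\<lambda>w\<in>words d. act p w)"

definition portrait :: "nat \<Rightarrow> (nat list \<Rightarrow> nat \<Rightarrow> nat) \<Rightarrow> bool" where
  "portrait d p \<longleftrightarrow> (\<forall>w\<in>words d. bij_betw (p w) {1..d} {1..d})"

lemma portraitD: "portrait d p \<Longrightarrow> w \<in> words d \<Longrightarrow> x \<in> {1..d} \<Longrightarrow> p w x \<in> {1..d}"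
  unfolding portrait_def by (meson bij_betw_apply)

lemma act_in_words: "portrait d p \<Longrightarrow> w \<in> words d \<Longrightarrow> act p w \<in> words d"
proof (induction w rule: rev_induct)
  case (snoc x w)
  then show ?case using portraitD[of d p w x] by (simp add: act_snoc)
qed simp

lemma act_inj:
  assumes "portrait d p" "v \<in> words d" "w \<in> words d" "act p v = act p w"
  shows "v = w"
  using assms
proof (induction v arbitrary: w rule: rev_induct)
  case Nil
  then have "length (act p w) = 0" by simp
  then show ?case by simp
next
  case (snoc x v)
  then have "length w = Suc (length v)" by (metis length_act length_append_singleton)
  then obtain u y where w: "w = u @ [y]" by (cases w rule: rev_cases) auto
  have "act p v = act p u" "p v x = p u y" using snoc.prems w by (simp_all add: act_snoc)
  moreover have uv: "v \<in> words d" "u \<in> words d" "x \<in> {1..d}" "y \<in> {1..d}" using snoc.prems w by auto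
  moreover have "v = u" by (rule snoc.IH[OF snoc.prems(1) uv(1,2) \<open>act p v = act p u\<close>])
  moreover have "inj_on (p v) {1..d}" using snoc.prems(1) uv(1) by (auto simp: portrait_def bij_betw_def)
  ultimately have "x = y" by (metis inj_onD)
  then show ?case using \<open>v = u\<close> w by simp
qed

lemma act_surj:
  assumes "portrait d p" "w \<in> words d"
  shows "\<exists>v\<in>words d. act p v = w"
  using assms
proof (induction w rule: rev_induct)
  case Nil
  then show ?case by (intro bexI[of _ "[]"]) auto
next
  case (snoc y w)
  have "w \<in> words d" using snoc.prems by simp
  from snoc.IH[OF snoc.prems(1) this] obtain v where v: "v \<in> words d" "act p v = w" by blast
  have "p v ` {1..d} = {1..d}" using snoc.prems(1) v(1) by (simp add: portrait_def bij_betw_def)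
  moreover have "y \<in> {1..d}" using snoc.prems by simp
  ultimately obtain x where "x \<in> {1..d}" "p v x = y" by (metis imageE)
  then show ?case using v by (intro bexI[of _ "v @ [x]"]) (auto simp: act_snoc)
qed

lemma aut_in_Aut:
  assumes "portrait d p"
  shows "aut d p \<in> carrier (Aut_tree d)"
proof -
  have "bij_betw (act p) (words d) (words d)"
    unfolding bij_betw_def inj_on_def using act_inj[OF assms] act_in_words[OF assms] act_surj[OF assms] by blast
  then have "aut d p \<in> Bij (words d)"
    by (simp add: Bij_def aut_def cong: bij_betw_cong)
  moreover have "adjacent v w \<longleftrightarrow> adjacent (act p v) (act p w)" if vw: "v \<in> words d" "w \<in> words d" for v w
  proof -
    have *: "(\<exists>y. act p w = act p v @ [y]) \<longleftrightarrow> (\<exists>x. w = v @ [x])" if vw: "v \<in> words d" "w \<in> words d" for v w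
    proof
      assume "\<exists>y. act p w = act p v @ [y]"
      then obtain y where y: "act p w = act p v @ [y]" by blast
      then have "length (act p w) = Suc (length (act p v))" by simp
      then obtain u x where u: "w = u @ [x]" by (cases w rule: rev_cases) auto
      then have "act p u = act p v" using y by (simp add: act_snoc)
      then have "u = v" using act_inj[OF assms, of u v] vw u by simp
      then show "\<exists>x. w = v @ [x]" using u by blast
    qed (auto simp: act_snoc)
    show ?thesis unfolding adjacent_def ex_disj_distrib *[OF vw] *[OF vw(2,1)] by blast
  qed
  ultimately show ?thesis by (simp add: Aut_tree_def aut_def)
qed

lemma Aut_BijD: "g \<in> carrier (Aut_tree d) \<Longrightarrow> g \<in> Bij (words d)"
  by (simp add: Aut_tree_def)

lemma Aut_adjacent:
  "g \<in> carrier (Aut_tree d) \<Longrightarrow> v \<in> words d \<Longrightarrow> w \<in> words d \<Longrightarrow> adjacent (g v) (g w) \<longleftrightarrow> adjacent v w"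
  by (simp add: Aut_tree_def)

text \<open>Adjacency alone allows \<open>g (v @ [x])\<close> to be a child or the parent of
  \<open>g v\<close>. The parent is already taken by the image of the parent of \<open>v\<close>, so
  injectivity excludes it; the root has no parent.\<close>

lemma Aut_snoc:
  assumes g: "g \<in> carrier (Aut_tree d)" and "v @ [x] \<in> words d"
  shows "\<exists>y\<in>{1..d}. g (v @ [x]) = g v @ [y]"
  using assms(2)
proof (induction v arbitrary: x rule: rev_induct)
  have words: "g w \<in> words d" if "w \<in> words d" for w
    using Bij_imp_funcset[OF Aut_BijD[OF g]] that by blast
  have inj: "u = w" if "u \<in> words d" "w \<in> words d" "g u = g w" for u w
    using Aut_BijD[OF g] that by (auto simp: Bij_def bij_betw_def inj_on_def)
  have step: "(\<exists>y. g (v @ [x]) = g v @ [y]) \<or> (\<exists>y. g v = g (v @ [x]) @ [y])" if "v @ [x] \<in> words d" for v x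
  proof -
    have "adjacent v (v @ [x])" by (auto simp: adjacent_def)
    then have "adjacent (g v) (g (v @ [x]))"
      using Aut_adjacent[OF g, of v "v @ [x]"] that by simp
    then show ?thesis unfolding adjacent_def by blast
  qed
  have last: "y \<in> {1..d}" if "g (v @ [x]) = g v @ [y]" "v @ [x] \<in> words d" for v x y
    using words[OF that(2)] that(1) by simp
  {
    case Nil
    have "g [] = []" using g by (simp add: Aut_tree_def)
    then show ?case using step[OF Nil] last[OF _ Nil] by auto
  next
    case (snoc z u)
    have u: "u @ [z] \<in> words d" "u \<in> words d" using snoc.prems by simp_all
    obtain y where y: "g (u @ [z]) = g u @ [y]" using snoc.IH[OF u(1)] by blast
    have "\<not> (\<exists>y'. g (u @ [z]) = g ((u @ [z]) @ [x]) @ [y'])"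
    proof
      assume "\<exists>y'. g (u @ [z]) = g ((u @ [z]) @ [x]) @ [y']"
      then have "g ((u @ [z]) @ [x]) = g u" using y by auto
      from inj[OF snoc.prems u(2) this] show False by simp
    qed
    then show ?case using step[OF snoc.prems] last[OF _ snoc.prems] by blast
  }
qed

text \<open>The letter map at \<open>w\<close> is read off from the last letters of the images of
  the children; being injective on a finite set, it is a bijection.\<close>

lemma Aut_eq_aut:
  assumes g: "g \<in> carrier (Aut_tree d)"
  obtains p where "portrait d p" "g = aut d p"
proof -
  define p where "p = (\<lambda>w x. last (g (w @ [x])))"
  have p: "g (w @ [x]) = g w @ [p w x] \<and> p w x \<in> {1..d}" if "w @ [x] \<in> words d" for w x
    using Aut_snoc[OF g that] by (auto simp: p_def)
  have ga: "g w = act p w" if "w \<in> words d" for w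
    using that
  proof (induction w rule: rev_induct)
    case Nil
    then show ?case using g by (simp add: Aut_tree_def)
  next
    case (snoc x w)
    then show ?case using p[OF snoc.prems] by (simp add: act_snoc)
  qed
  have inj: "u = w" if "u \<in> words d" "w \<in> words d" "g u = g w" for u w
    using Aut_BijD[OF g] that by (auto simp: Bij_def bij_betw_def inj_on_def)
  have "portrait d p"
    unfolding portrait_def
  proof
    fix w assume w: "w \<in> words d"
    have "p w ` {1..d} \<subseteq> {1..d}" using p[of w] w by auto
    moreover have "inj_on (p w) {1..d}"
    proof (rule inj_onI)
      fix x y assume xy: "x \<in> {1..d}" "y \<in> {1..d}" "p w x = p w y"
      then have "g (w @ [x]) = g (w @ [y])" using p[of w x] p[of w y] w by simp
      then show "x = y" using inj[of "w @ [x]" "w @ [y]"] w xy by simp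
    qed
    ultimately show "bij_betw (p w) {1..d} {1..d}"
      by (simp add: bij_betw_def endo_inj_surj)
  qed
  moreover have "g = aut d p"
  proof (rule extensionalityI[of _ "words d"])
    show "g \<in> extensional (words d)" using Aut_BijD[OF g] by (simp add: Bij_def)
  qed (auto simp: aut_def ga)
  ultimately show ?thesis using that by blast
qed

lemma act_compose: "act p (act q w) = act (\<lambda>u. p (act q u) \<circ> q u) w"
  by (induction w rule: rev_induct) (simp_all add: act_snoc)

lemma portrait_compose:
  "portrait d p \<Longrightarrow> portrait d q \<Longrightarrow> portrait d (\<lambda>u. p (act q u) \<circ> q u)"
  unfolding portrait_def using act_in_words[of d q] by (auto simp: portrait_def intro: bij_betw_trans)

lemma Aut_mult: "g \<in> carrier (Aut_tree d) \<Longrightarrow> h \<in> carrier (Aut_tree d) \<Longrightarrow> g \<otimes>\<^bsub>Aut_tree d\<^esub> h = compose (words d) g h"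
  by (simp add: Aut_tree_def BijGroup_def)

lemma aut_mult:
  assumes "portrait d p" "portrait d q"
  shows "aut d p \<otimes>\<^bsub>Aut_tree d\<^esub> aut d q = aut d (\<lambda>u. p (act q u) \<circ> q u)"
  unfolding Aut_mult[OF aut_in_Aut[OF assms(1)] aut_in_Aut[OF assms(2)]]
  by (rule ext) (auto simp: compose_def aut_def act_in_words[OF assms(2)] act_compose restrict_def)

lemma aut_eqI: "(\<And>w x. w \<in> words d \<Longrightarrow> x \<in> {1..d} \<Longrightarrow> p w x = q w x) \<Longrightarrow> aut d p = aut d q"
proof -
  assume *: "\<And>w x. w \<in> words d \<Longrightarrow> x \<in> {1..d} \<Longrightarrow> p w x = q w x"
  have "act p w = act q w" if "w \<in> words d" for w
    using that by (induction w rule: rev_induct) (auto simp: act_snoc *)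
  then show ?thesis by (auto simp: aut_def restrict_def)
qed

lemma Aut_one: "\<one>\<^bsub>Aut_tree d\<^esub> = aut d (\<lambda>w x. x)"
proof -
  have "act (\<lambda>w x. x) w = w" for w by (induction w rule: rev_induct) (auto simp: act_snoc)
  then show ?thesis by (simp add: Aut_tree_def BijGroup_def aut_def restrict_def)
qed

text \<open>The letter map of the inverse at \<open>u\<close> undoes the one at the vertex that is
  moved to \<open>u\<close>.\<close>

definition inv_portrait :: "nat \<Rightarrow> (nat list \<Rightarrow> nat \<Rightarrow> nat) \<Rightarrow> nat list \<Rightarrow> nat \<Rightarrow> nat" where
  "inv_portrait d p u = inv_into {1..d} (p (inv_into (words d) (act p) u))"

lemma inv_portrait:
  assumes p: "portrait d p"
  shows "portrait d (inv_portrait d p)"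
    "aut d (inv_portrait d p) \<otimes>\<^bsub>Aut_tree d\<^esub> aut d p = \<one>\<^bsub>Aut_tree d\<^esub>"
proof -
  have inj: "inj_on (act p) (words d)" using act_inj[OF p] by (auto simp: inj_on_def)
  have im: "act p ` words d = words d" using act_in_words[OF p] act_surj[OF p] by blast
  show q: "portrait d (inv_portrait d p)"
    unfolding portrait_def inv_portrait_def
  proof
    fix u assume "u \<in> words d"
    then have "inv_into (words d) (act p) u \<in> words d" using im by (intro inv_into_into) simp
    then show "bij_betw (inv_into {1..d} (p (inv_into (words d) (act p) u))) {1..d} {1..d}"
      using p by (auto simp: portrait_def intro: bij_betw_inv_into)
  qed
  show "aut d (inv_portrait d p) \<otimes>\<^bsub>Aut_tree d\<^esub> aut d p = \<one>\<^bsub>Aut_tree d\<^esub>"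
    unfolding aut_mult[OF q p] Aut_one
  proof (rule aut_eqI)
    fix w x assume w: "w \<in> words d" "x \<in> {1..d}"
    have "inj_on (p w) {1..d}" using p w by (auto simp: portrait_def bij_betw_def)
    then show "(inv_portrait d p (act p w) \<circ> p w) x = x"
      using w by (simp add: inv_portrait_def inv_into_f_f[OF inj])
  qed
qed

lemma portrait_id: "portrait d (\<lambda>w x. x)"
  by (simp add: portrait_def bij_betw_def)

lemma Aut_group: "group (Aut_tree d)"
proof (rule groupI)
  show "\<one>\<^bsub>Aut_tree d\<^esub> \<in> carrier (Aut_tree d)"
    unfolding Aut_one by (rule aut_in_Aut[OF portrait_id])
  fix g assume "g \<in> carrier (Aut_tree d)"
  then obtain p where p: "portrait d p" "g = aut d p" by (rule Aut_eq_aut)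
  show "\<one>\<^bsub>Aut_tree d\<^esub> \<otimes>\<^bsub>Aut_tree d\<^esub> g = g"
    unfolding Aut_one p(2) aut_mult[OF portrait_id p(1)] by (simp add: o_def)
  show "\<exists>h\<in>carrier (Aut_tree d). h \<otimes>\<^bsub>Aut_tree d\<^esub> g = \<one>\<^bsub>Aut_tree d\<^esub>"
    using inv_portrait[OF p(1)] aut_in_Aut p(2) by blast
  fix h assume "h \<in> carrier (Aut_tree d)"
  then obtain q where q: "portrait d q" "h = aut d q" by (rule Aut_eq_aut)
  show "g \<otimes>\<^bsub>Aut_tree d\<^esub> h \<in> carrier (Aut_tree d)"
    unfolding p(2) q(2) aut_mult[OF p(1) q(1)] by (intro aut_in_Aut portrait_compose p q)
  fix k assume "k \<in> carrier (Aut_tree d)"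
  then obtain r where r: "portrait d r" "k = aut d r" by (rule Aut_eq_aut)
  show "g \<otimes>\<^bsub>Aut_tree d\<^esub> h \<otimes>\<^bsub>Aut_tree d\<^esub> k = g \<otimes>\<^bsub>Aut_tree d\<^esub> (h \<otimes>\<^bsub>Aut_tree d\<^esub> k)"
    unfolding p(2) q(2) r(2)
    by (simp add: aut_mult portrait_compose p q r o_assoc act_compose)
qed

lemma section_aut:
  assumes "portrait d p" "v \<in> words d"
  shows "section_at d (aut d p) v = aut d (\<lambda>u. p (v @ u))"
proof -
  have "act p (v @ w) = act p v @ act (\<lambda>u. p (v @ u)) w" for w
    by (induction w rule: rev_induct) (simp_all add: act_snoc flip: append_assoc)
  then show ?thesis using assms by (auto simp: section_at_def aut_def restrict_def)
qed

section \<open>Affine local actions\<close>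

text \<open>Letters run over \<open>1..d\<close>, with \<open>d\<close> in the role of residue 0,
  matching the exponents in \<open>\<xi> ^ x\<close>; subtracting 1 before the reduction and adding
  1 after it yields representatives in this range.\<close>

definition affine_mod :: "nat \<Rightarrow> int \<Rightarrow> int \<Rightarrow> nat \<Rightarrow> nat" where
  "affine_mod d a b x = nat ((a * int x + b - 1) mod int d) + 1"

lemma affine_mod_eq_iff:
  assumes "d > 0"
  shows "affine_mod d a b x = y \<longleftrightarrow> y \<in> {1..d} \<and> [int y = a * int x + b] (mod int d)"
proof -
  let ?e = "(a * int x + b - 1) mod int d"
  have e: "0 \<le> ?e" "?e < int d" using assms by auto
  have "affine_mod d a b x = y \<longleftrightarrow> int y - 1 = ?e"
    using e by (auto simp: affine_mod_def)
  also have "\<dots> \<longleftrightarrow> 0 \<le> int y - 1 \<and> int y - 1 < int d \<and> (int y - 1) mod int d = ?e"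
    using e by auto
  also have "(int y - 1) mod int d = ?e \<longleftrightarrow> [int y = a * int x + b] (mod int d)"
    unfolding cong_iff_dvd_diff mod_eq_dvd_iff by (simp add: algebra_simps)
  finally show ?thesis by auto
qed

lemma affine_mod_in: "d > 0 \<Longrightarrow> affine_mod d a b x \<in> {1..d}"
  using affine_mod_eq_iff by blast

lemma affine_mod_cong: "d > 0 \<Longrightarrow> [int (affine_mod d a b x) = a * int x + b] (mod int d)"
  using affine_mod_eq_iff by blast

lemma residue_unique: "x \<in> {1..d} \<Longrightarrow> y \<in> {1..d} \<Longrightarrow> [int x = int y] (mod int d) \<Longrightarrow> x = y"
proof -
  assume xy: "x \<in> {1..d}" "y \<in> {1..d}" "[int x = int y] (mod int d)"
  then have "[int x - 1 = int y - 1] (mod int d)" by (intro cong_diff cong_refl)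
  then have "int x - 1 = int y - 1"
    using xy by (intro cong_less_imp_eq_int) auto
  then show "x = y" by simp
qed

lemma affine_mod_bij:
  assumes "d > 0" "coprime a (int d)"
  shows "bij_betw (affine_mod d a b) {1..d} {1..d}"
proof -
  have "inj_on (affine_mod d a b) {1..d}"
  proof (rule inj_onI)
    fix x y assume xy: "x \<in> {1..d}" "y \<in> {1..d}" "affine_mod d a b x = affine_mod d a b y"
    then have "[a * int x + b = a * int y + b] (mod int d)"
      using cong_trans[OF cong_sym[OF affine_mod_cong[OF assms(1), of a b x]]] affine_mod_cong[OF assms(1), of a b y]
      by simp
    then have "[a * int x = a * int y] (mod int d)" by (simp add: cong_add_rcancel)
    then have "[int x = int y] (mod int d)" by (simp only: cong_mult_lcancel[OF assms(2)])
    then show "x = y" by (rule residue_unique[OF xy(1,2)])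
  qed
  moreover have "affine_mod d a b ` {1..d} \<subseteq> {1..d}" using affine_mod_in[OF assms(1)] by blast
  ultimately show ?thesis by (simp add: bij_betw_def endo_inj_surj)
qed

lemma affine_mod_compose:
  assumes "d > 0"
  shows "affine_mod d a b (affine_mod d a' b' x) = affine_mod d (a * a' mod int d) (a * b' + b) x"
proof -
  have "[a * int (affine_mod d a' b' x) + b = a * (a' * int x + b') + b] (mod int d)"
    by (intro cong_add cong_mult cong_refl affine_mod_cong assms)
  moreover have "[(a * a' mod int d) * int x + (a * b' + b) = a * (a' * int x + b') + b] (mod int d)"
  proof -
    have "[(a * a' mod int d) * int x + (a * b' + b) = (a * a') * int x + (a * b' + b)] (mod int d)"
      by (intro cong_add cong_mult cong_refl) (simp add: unique_euclidean_semiring_class.cong_def)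
    then show ?thesis by (simp add: algebra_simps)
  qed
  ultimately have "[int (affine_mod d a b (affine_mod d a' b' x)) = (a * a' mod int d) * int x + (a * b' + b)] (mod int d)"
    by (rule cong_trans[OF cong_trans[OF affine_mod_cong[OF assms]] cong_sym])
  then have "affine_mod d (a * a' mod int d) (a * b' + b) x = affine_mod d a b (affine_mod d a' b' x)"
    unfolding affine_mod_eq_iff[OF assms] using affine_mod_in[OF assms] by blast
  then show ?thesis by (rule sym)
qed

lemma affine_mod_cong_arg:
  assumes "d > 0" "[a = a'] (mod int d)" "[b = b'] (mod int d)"
  shows "affine_mod d a b x = affine_mod d a' b' x"
proof -
  have "[a * int x + b - 1 = a' * int x + b' - 1] (mod int d)"
    using assms(2,3) by (intro cong_diff cong_add cong_mult cong_refl)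
  then have "(a * int x + b - 1) mod int d = (a' * int x + b' - 1) mod int d" by (simp only: unique_euclidean_semiring_class.cong_def)
  then show ?thesis by (simp only: affine_mod_def)
qed

text \<open>\<open>b\<close> takes arbitrary integer values, of which only the residues modulo
  \<open>d\<close> matter; \<open>trunc\<close> later selects representatives.\<close>

definition affine_aut :: "nat \<Rightarrow> int \<Rightarrow> (nat list \<Rightarrow> int) \<Rightarrow> nat list \<Rightarrow> nat list" where
  "affine_aut d a b = aut d (\<lambda>w. affine_mod d a (b w))"

definition affine_group :: "nat \<Rightarrow> int set \<Rightarrow> (nat list \<Rightarrow> nat list) set" where
  "affine_group d I = {affine_aut d a b |a b. a \<in> I}"

section \<open>The affine group attached to a group of multipliers\<close>

locale unit_group_mod =
  fixes d :: nat and I :: "int set"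
  assumes d2: "d \<ge> 2" and sub: "I \<subseteq> {0..<int d}" and cop: "\<And>a. a \<in> I \<Longrightarrow> coprime a (int d)"
    and one: "1 \<in> I" and mult: "\<And>a b. a \<in> I \<Longrightarrow> b \<in> I \<Longrightarrow> a * b mod int d \<in> I"
begin

lemma d0: "d > 0" using d2 by simp

lemma finite_I: "finite I" using sub finite_subset by blast

text \<open>By Euler's theorem the inverse of \<open>a\<close> is the power
  \<open>a ^ (totient d - 1)\<close>, which closure under products keeps in
  \<open>I\<close>.\<close>

lemma inverse_ex:
  assumes "a \<in> I"
  obtains a' where "a' \<in> I" "a' * a mod int d = 1"
proof -
  have pow: "a ^ n mod int d \<in> I" for n
  proof (induction n)
    case 0
    then show ?case using one d2 by simp
  next
    case (Suc n)
    from mult[OF assms Suc] show ?case by (simp add: mod_mult_right_eq)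
  qed
  have "totient d > 0" using d0 by simp
  then have "a ^ (totient d - 1) * a = a ^ totient d" by (metis Suc_diff_1 power_Suc2)
  moreover have "[a ^ totient d = 1] (mod int d)"
  proof -
    have a: "a \<ge> 0" using assms sub by auto
    then have "coprime (nat a) d" using cop[OF assms] by (metis coprime_int_iff nat_0_le)
    from euler_theorem[OF this] have "[int (nat a ^ totient d) = int 1] (mod int d)" by (simp only: cong_int_iff)
    then show ?thesis using a by simp
  qed
  ultimately have "(a ^ (totient d - 1) mod int d) * a mod int d = 1"
    using d2 by (simp add: mod_mult_left_eq unique_euclidean_semiring_class.cong_def)
  then show ?thesis using that pow by blast
qed

lemma portrait_affine: "a \<in> I \<Longrightarrow> portrait d (\<lambda>w. affine_mod d a (b w))"
  unfolding portrait_def using affine_mod_bij[OF d0 cop] by blast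

lemma affine_aut_in: "a \<in> I \<Longrightarrow> affine_aut d a b \<in> carrier (Aut_tree d)"
  unfolding affine_aut_def by (intro aut_in_Aut portrait_affine)

lemma affine_aut_mult:
  assumes "a \<in> I" "a' \<in> I"
  shows "affine_aut d a b \<otimes>\<^bsub>Aut_tree d\<^esub> affine_aut d a' b' =
    affine_aut d (a * a' mod int d) (\<lambda>w. a * b' w + b (act (\<lambda>w. affine_mod d a' (b' w)) w))"
  unfolding affine_aut_def aut_mult[OF portrait_affine[OF assms(1)] portrait_affine[OF assms(2)]]
  by (rule aut_eqI) (simp only: o_apply affine_mod_compose[OF d0])

lemma affine_mod_id: "x \<in> {1..d} \<Longrightarrow> [a = 1] (mod int d) \<Longrightarrow> [b = 0] (mod int d) \<Longrightarrow> affine_mod d a b x = x"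
proof -
  assume x: "x \<in> {1..d}" and ab: "[a = 1] (mod int d)" "[b = 0] (mod int d)"
  have "[a * int x + b = 1 * int x + 0] (mod int d)" using ab by (intro cong_add cong_mult cong_refl)
  then show "affine_mod d a b x = x"
    unfolding affine_mod_eq_iff[OF d0] using x by (simp add: cong_sym)
qed

lemma affine_aut_left_inverse:
  assumes "a \<in> I"
  shows "\<exists>a'\<in>I. \<exists>b'. affine_aut d a' b' \<otimes>\<^bsub>Aut_tree d\<^esub> affine_aut d a b = \<one>\<^bsub>Aut_tree d\<^esub>"
proof -
  obtain a' where a': "a' \<in> I" "a' * a mod int d = 1" using inverse_ex[OF assms] by blast
  let ?p = "\<lambda>w. affine_mod d a (b w)"
  \<comment> \<open>Solves \<open>a' * b w + b' u = 0\<close> with \<open>u\<close> the image of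
    \<open>w\<close>: the inverse carries its translation at the image vertex.\<close>
  define b' where "b' u = - a' * b (inv_into (words d) (act ?p) u)" for u
  have inj: "inj_on (act ?p) (words d)"
    using act_inj[OF portrait_affine[OF assms]] by (auto simp: inj_on_def)
  have "affine_aut d a' b' \<otimes>\<^bsub>Aut_tree d\<^esub> affine_aut d a b = \<one>\<^bsub>Aut_tree d\<^esub>"
    unfolding affine_aut_mult[OF a'(1) assms] a'(2) unfolding affine_aut_def Aut_one
  proof (rule aut_eqI)
    fix w x assume "w \<in> words d" "x \<in> {1..d}"
    then show "affine_mod d 1 (a' * b w + b' (act ?p w)) x = x"
      by (intro affine_mod_id) (simp_all add: b'_def inv_into_f_f[OF inj])
  qed
  then show ?thesis using a' by blast
qed

lemma affine_subgroup: "subgroup (affine_group d I) (Aut_tree d)"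
proof (rule group.subgroupI[OF Aut_group])
  show "affine_group d I \<subseteq> carrier (Aut_tree d)"
    using affine_aut_in by (auto simp: affine_group_def)
  show "affine_group d I \<noteq> {}" using one by (auto simp: affine_group_def)
  fix g assume "g \<in> affine_group d I"
  then obtain a b where g: "a \<in> I" "g = affine_aut d a b" by (auto simp: affine_group_def)
  obtain a' b' where "a' \<in> I" and inv: "affine_aut d a' b' \<otimes>\<^bsub>Aut_tree d\<^esub> g = \<one>\<^bsub>Aut_tree d\<^esub>"
    using affine_aut_left_inverse[OF g(1)] g(2) by blast
  have "inv\<^bsub>Aut_tree d\<^esub> g = affine_aut d a' b'"
    using group.inv_equality[OF Aut_group inv] g affine_aut_in \<open>a' \<in> I\<close> by simp
  then show "inv\<^bsub>Aut_tree d\<^esub> g \<in> affine_group d I" using \<open>a' \<in> I\<close> by (auto simp: affine_group_def)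
  fix h assume "h \<in> affine_group d I"
  then obtain a'' b'' where h: "a'' \<in> I" "h = affine_aut d a'' b''" by (auto simp: affine_group_def)
  show "g \<otimes>\<^bsub>Aut_tree d\<^esub> h \<in> affine_group d I"
    unfolding g(2) h(2) affine_aut_mult[OF g(1) h(1)] affine_group_def using mult[OF g(1) h(1)] by blast
qed

text \<open>Translations suffice: at depth \<open>i\<close> shift by the difference of the
  \<open>i\<close>-th letters of \<open>w\<close> and \<open>v\<close>, the same at all vertices of
  that depth.\<close>

lemma affine_transitive: "level_transitive d (affine_group d I)"
  unfolding level_transitive_def
proof (intro allI ballI)
  fix n v w assume vw: "v \<in> level d n" "w \<in> level d n"
  define b where "b u = int (w ! length u) - int (v ! length u)" for u :: "nat list"
  have "act (\<lambda>w. affine_mod d 1 (b w)) v = w"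
  proof (rule nth_equalityI)
    show "length (act (\<lambda>w. affine_mod d 1 (b w)) v) = length w" using vw by (simp add: level_def)
    fix i assume "i < length (act (\<lambda>w. affine_mod d 1 (b w)) v)"
    then have i: "i < length v" "i < length w" using vw by (auto simp: level_def)
    have "w ! i \<in> {1..d}" using vw i nth_mem[OF i(2)] by (auto simp: level_def words_def)
    then have "affine_mod d 1 (int (w ! i) - int (v ! i)) (v ! i) = w ! i"
      unfolding affine_mod_eq_iff[OF d0] by simp
    then show "act (\<lambda>w. affine_mod d 1 (b w)) v ! i = w ! i"
      using i by (simp add: act_def b_def)
  qed
  then have "affine_aut d 1 b v = w" using vw by (simp add: affine_aut_def aut_def level_def)
  then show "\<exists>g\<in>affine_group d I. g v = w" using one by (auto simp: affine_group_def)
qed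

end

section \<open>Finite index and branching\<close>

text \<open>Elements with equal \<open>\<phi>\<close> lie in one coset, so finitely many values
  leave finitely many cosets. The condition uses \<open>z \<otimes> y = x\<close> in place of a
  quotient, which keeps inverses in a restricted carrier out of its applications.\<close>

lemma finite_rcosets_by_invariant:
  fixes G (structure)
  assumes G: "group G" and H: "subgroup H G" and fin: "finite (\<phi> ` carrier G)"
    and inv: "\<And>x y z. x \<in> carrier G \<Longrightarrow> y \<in> carrier G \<Longrightarrow> z \<in> carrier G \<Longrightarrow> z \<otimes>\<^bsub>G\<^esub> y = x \<Longrightarrow> \<phi> x = \<phi> y \<Longrightarrow> z \<in> H"
  shows "finite (rcosets\<^bsub>G\<^esub> H)"
proof -
  interpret group G by (rule G)
  have eq: "H #>\<^bsub>G\<^esub> x = H #>\<^bsub>G\<^esub> y" if xy: "x \<in> carrier G" "y \<in> carrier G" "\<phi> x = \<phi> y" for x y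
  proof -
    have "(x \<otimes> inv y) \<otimes> y = x" using xy by (simp add: m_assoc)
    then have z: "x \<otimes> inv y \<in> H" using inv[of x y "x \<otimes> inv y"] xy by simp
    then have "x \<in> H #>\<^bsub>G\<^esub> y"
      using \<open>(x \<otimes> inv y) \<otimes> y = x\<close> by (force simp: r_coset_def)
    from repr_independence[OF this xy(2) H] show ?thesis by simp
  qed
  have "rcosets\<^bsub>G\<^esub> H \<subseteq> (\<lambda>c. H #>\<^bsub>G\<^esub> (SOME y. y \<in> carrier G \<and> \<phi> y = c)) ` (\<phi> ` carrier G)"
  proof
    fix C assume "C \<in> rcosets\<^bsub>G\<^esub> H"
    then obtain x where x: "x \<in> carrier G" "C = H #>\<^bsub>G\<^esub> x" by (auto simp: RCOSETS_def)
    let ?y = "SOME y. y \<in> carrier G \<and> \<phi> y = \<phi> x"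
    have "?y \<in> carrier G \<and> \<phi> ?y = \<phi> x" by (rule someI[of _ x]) (use x in simp)
    then have "C = H #>\<^bsub>G\<^esub> ?y" using eq[of x ?y] x by simp
    then show "C \<in> (\<lambda>c. H #>\<^bsub>G\<^esub> (SOME y. y \<in> carrier G \<and> \<phi> y = c)) ` (\<phi> ` carrier G)"
      by (rule image_eqI) (rule imageI[OF x(1)])
  qed
  then show ?thesis using fin finite_subset by blast
qed

context unit_group_mod
begin

lemma affine_aut_letter: "x \<in> {1..d} \<Longrightarrow> affine_aut d a b [x] = [affine_mod d a (b []) x]"
  using act_snoc[of "\<lambda>w. affine_mod d a (b w)" "[]" x] by (simp add: affine_aut_def aut_def)

text \<open>For an affine root action the translation cancels in the difference of the images of 2
  and 1, letters that exist because \<open>d \<ge> 2\<close>.\<close>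

definition multiplier_of :: "(nat list \<Rightarrow> nat list) \<Rightarrow> int" where
  "multiplier_of g = (int (hd (g [2])) - int (hd (g [1]))) mod int d"

lemma multiplier:
  assumes "a \<in> I"
  shows "multiplier_of (affine_aut d a b) = a"
proof -
  have "[int (affine_mod d a (b []) 2) - int (affine_mod d a (b []) 1) = (a * int 2 + b []) - (a * int 1 + b [])] (mod int d)"
    by (intro cong_diff affine_mod_cong d0)
  then have "(int (affine_mod d a (b []) 2) - int (affine_mod d a (b []) 1)) mod int d = a mod int d"
    by (simp add: unique_euclidean_semiring_class.cong_def)
  also have "a mod int d = a" using assms sub by auto
  finally show ?thesis using d2 by (simp add: affine_aut_letter multiplier_of_def)
qed

lemma one_group: "unit_group_mod d {1}"
  using d2 by unfold_locales auto

text \<open>Sections share the multiplier of the whole element, so independent choices of sections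
  in the full group would not glue. With multiplier 1 they glue freely, which makes
  \<open>?B1\<close> just the stabiliser of the first level in \<open>?B\<close>.\<close>

lemma affine_regular_branch: "regular_branch d (affine_group d I)"
proof -
  let ?A = "Aut_tree d" and ?G = "affine_group d I" and ?B = "affine_group d {1}"
  let ?B1 = "first_level_sections_in d ?B"
  interpret A: group ?A by (rule Aut_group)
  note subG = affine_subgroup and subB = unit_group_mod.affine_subgroup[OF one_group]
  have BG: "?B \<subseteq> ?G" using one by (auto simp: affine_group_def)
  have "subgroup ?B (?A\<lparr>carrier := ?G\<rparr>)"
    by (rule A.subgroup_incl[OF subB subG BG])
  moreover have "finite (rcosets\<^bsub>?A\<lparr>carrier := ?G\<rparr>\<^esub> ?B)"
  proof (rule finite_rcosets_by_invariant[where \<phi> = multiplier_of])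
    show "group (?A\<lparr>carrier := ?G\<rparr>)" by (rule subgroup.subgroup_is_group[OF subG Aut_group])
    show "finite (multiplier_of ` carrier (?A\<lparr>carrier := ?G\<rparr>))"
      by (rule finite_subset[OF _ finite_I]) (auto simp: affine_group_def multiplier)
    fix x y z assume "x \<in> carrier (?A\<lparr>carrier := ?G\<rparr>)" "y \<in> carrier (?A\<lparr>carrier := ?G\<rparr>)" "z \<in> carrier (?A\<lparr>carrier := ?G\<rparr>)"
      and zy: "z \<otimes>\<^bsub>?A\<lparr>carrier := ?G\<rparr>\<^esub> y = x"
      and eq: "multiplier_of x = multiplier_of y"
    then obtain a b a' b' where y: "a \<in> I" "y = affine_aut d a b" and z: "a' \<in> I" "z = affine_aut d a' b'"
      by (auto simp: affine_group_def)
    have "x = affine_aut d (a' * a mod int d) (\<lambda>w. a' * b w + b' (act (\<lambda>w. affine_mod d a (b w)) w))"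
      using zy affine_aut_mult[OF z(1) y(1)] by (simp add: y z)
    then have "a' * a mod int d = a"
      using eq multiplier[OF mult[OF z(1) y(1)]] multiplier[OF y(1)] y(2) by simp
    then have "[a' * a = 1 * a] (mod int d)" using sub y(1) by (auto simp: unique_euclidean_semiring_class.cong_def)
    then have "[a' = 1] (mod int d)" by (simp only: cong_mult_rcancel[OF cop[OF y(1)]])
    then have "a' = 1" using sub z(1) d2 by (auto simp: unique_euclidean_semiring_class.cong_def)
    then show "z \<in> ?B" using z by (auto simp: affine_group_def)
  qed (rule A.subgroup_incl[OF subB subG BG])
  ultimately have fi1: "finite_index_subgroup ?B (?A\<lparr>carrier := ?G\<rparr>)"
    by (simp add: finite_index_subgroup_def)
  have inB: "affine_aut d 1 b \<in> ?B" for b by (auto simp: affine_group_def)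
  have St1: "g \<in> St d 1 \<longleftrightarrow> g \<in> carrier ?A \<and> (\<forall>x\<in>{1..d}. g [x] = [x])" for g
  proof -
    have "level d 1 = (\<lambda>x. [x]) ` {1..d}"
    proof (intro equalityI subsetI)
      fix v assume "v \<in> level d 1"
      then have "v \<in> words d" "length v = Suc 0" by (auto simp: level_def)
      then obtain x where "v = [x]" by (auto simp: length_Suc_conv)
      with \<open>v \<in> words d\<close> show "v \<in> (\<lambda>x. [x]) ` {1..d}" by auto
    qed (auto simp: level_def)
    then show ?thesis by (auto simp: St_def)
  qed
  have B1: "?B1 = {g \<in> ?B. \<forall>x\<in>{1..d}. g [x] = [x]}"
  proof (intro equalityI subsetI)
    fix g assume "g \<in> ?B1"
    then have g: "g \<in> carrier ?A" "\<forall>x\<in>{1..d}. g [x] = [x]" and s: "\<forall>x\<in>{1..d}. section_at d g [x] \<in> ?B"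
      using St1[of g] by (auto simp: first_level_sections_in_def level_def)
    obtain p where p: "portrait d p" "g = aut d p" using Aut_eq_aut[OF g(1)] by blast
    have p0: "p [] x = x" if "x \<in> {1..d}" for x
      using g(2) that act_Cons[of p x "[]"] by (simp add: p(2) aut_def)
    have "\<forall>x\<in>{1..d}. \<exists>b. aut d (\<lambda>u. p (x # u)) = affine_aut d 1 b"
      using s section_aut[OF p(1)] by (auto simp: p(2) affine_group_def)
    then obtain bb where bb: "\<And>x. x \<in> {1..d} \<Longrightarrow> aut d (\<lambda>u. p (x # u)) = affine_aut d 1 (bb x)" by metis
    \<comment> \<open>Translation 0 at the root, and below the letter \<open>x\<close> the
      translations of the section at \<open>x\<close>.\<close>
    define b where "b w = (case w of [] \<Rightarrow> 0 | x # u \<Rightarrow> bb x u)" for w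
    have "g = affine_aut d 1 b"
    proof (rule extensionalityI[of _ "words d"])
      fix w assume w: "w \<in> words d"
      show "g w = affine_aut d 1 b w"
      proof (cases w)
        case (Cons x u)
        then have xu: "x \<in> {1..d}" "u \<in> words d" using w by auto
        have "affine_mod d 1 0 x = x" using xu by (intro affine_mod_id) auto
        moreover have "act (\<lambda>u. p (x # u)) u = act (\<lambda>w. affine_mod d 1 (bb x w)) u"
          using fun_cong[OF bb[OF xu(1)], of u] xu(2) by (simp add: aut_def affine_aut_def)
        ultimately show ?thesis using xu w Cons
          by (simp add: p(2) aut_def affine_aut_def act_Cons p0 b_def)
      qed (simp add: p(2) aut_def affine_aut_def)
    qed (auto simp: p(2) aut_def affine_aut_def)
    then show "g \<in> {g \<in> ?B. \<forall>x\<in>{1..d}. g [x] = [x]}" using inB g by simp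
  next
    fix g assume "g \<in> {g \<in> ?B. \<forall>x\<in>{1..d}. g [x] = [x]}"
    then obtain b where g: "g = affine_aut d 1 b" "\<forall>x\<in>{1..d}. g [x] = [x]" by (auto simp: affine_group_def)
    have "section_at d g v \<in> ?B" if "v \<in> words d" for v
    proof -
      have "section_at d g v = affine_aut d 1 (\<lambda>u. b (v @ u))"
        unfolding g(1) affine_aut_def by (rule section_aut[OF portrait_affine[OF one] that])
      then show ?thesis using inB by simp
    qed
    then show "g \<in> ?B1"
      using g(2) affine_aut_in[OF one] St1[of g] by (auto simp: first_level_sections_in_def level_def g(1))
  qed
  have subB1: "subgroup ?B1 (?A\<lparr>carrier := ?B\<rparr>)"
  proof (rule group.subgroupI)
    show gB: "group (?A\<lparr>carrier := ?B\<rparr>)" by (rule subgroup.subgroup_is_group[OF subB Aut_group])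
    have c: "?B \<subseteq> carrier ?A" by (rule subgroup.subset[OF subB])
    have one_in: "\<one>\<^bsub>?A\<^esub> \<in> ?B1" unfolding B1 using subgroup.one_closed[OF subB]
      by (simp add: Aut_one aut_def act_Cons)
    then show "?B1 \<noteq> {}" by blast
    show "?B1 \<subseteq> carrier (?A\<lparr>carrier := ?B\<rparr>)" unfolding B1 by auto
    fix g assume g: "g \<in> ?B1"
    then have gc: "g \<in> ?B" "g \<in> carrier ?A" "\<forall>x\<in>{1..d}. g [x] = [x]" using c by (auto simp: B1)
    have invB: "inv\<^bsub>?A\<^esub> g \<in> ?B" by (rule subgroup.m_inv_closed[OF subB gc(1)])
    have "(inv\<^bsub>?A\<^esub> g) [x] = [x]" if "x \<in> {1..d}" for x
    proof -
      have "(inv\<^bsub>?A\<^esub> g \<otimes>\<^bsub>?A\<^esub> g) [x] = \<one>\<^bsub>?A\<^esub> [x]" using gc by simp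
      moreover have "(inv\<^bsub>?A\<^esub> g \<otimes>\<^bsub>?A\<^esub> g) [x] = (inv\<^bsub>?A\<^esub> g) (g [x])"
        using that gc by (simp add: Aut_mult compose_def)
      ultimately show ?thesis using that gc by (simp add: Aut_one aut_def act_Cons)
    qed
    then have "inv\<^bsub>?A\<^esub> g \<in> ?B1" using invB by (simp add: B1)
    then show "inv\<^bsub>?A\<lparr>carrier := ?B\<rparr>\<^esub> g \<in> ?B1" using A.m_inv_consistent[OF subB gc(1)] by simp
    fix h assume "h \<in> ?B1"
    then have hc: "h \<in> ?B" "h \<in> carrier ?A" "\<forall>x\<in>{1..d}. h [x] = [x]" using c by (auto simp: B1)
    have "g \<otimes>\<^bsub>?A\<^esub> h \<in> ?B" by (rule subgroup.m_closed[OF subB gc(1) hc(1)])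
    moreover have "(g \<otimes>\<^bsub>?A\<^esub> h) [x] = [x]" if "x \<in> {1..d}" for x
      using that gc hc by (simp add: Aut_mult compose_def)
    ultimately show "g \<otimes>\<^bsub>?A\<lparr>carrier := ?B\<rparr>\<^esub> h \<in> ?B1" by (simp add: B1)
  qed
  have "finite (rcosets\<^bsub>?A\<lparr>carrier := ?B\<rparr>\<^esub> ?B1)"
  \<comment> \<open>With multiplier 1 the root acts by a translation, which the image of the letter
    1 determines.\<close>
  proof (rule finite_rcosets_by_invariant[where \<phi> = "\<lambda>g. hd (g [1])"])
    show "group (?A\<lparr>carrier := ?B\<rparr>)" by (rule subgroup.subgroup_is_group[OF subB Aut_group])
    show "finite ((\<lambda>g. hd (g [1])) ` carrier (?A\<lparr>carrier := ?B\<rparr>))"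
      by (rule finite_subset[of _ "{1..d}"]) (use affine_mod_in[OF d0] d0 in \<open>auto simp: affine_group_def affine_aut_letter\<close>)
    fix x y z assume "x \<in> carrier (?A\<lparr>carrier := ?B\<rparr>)" "y \<in> carrier (?A\<lparr>carrier := ?B\<rparr>)" "z \<in> carrier (?A\<lparr>carrier := ?B\<rparr>)"
      and zy: "z \<otimes>\<^bsub>?A\<lparr>carrier := ?B\<rparr>\<^esub> y = x" and eq: "hd (x [1]) = hd (y [1])"
    then obtain b b' where y: "y = affine_aut d 1 b" and z: "z = affine_aut d 1 b'"
      by (auto simp: affine_group_def)
    define u where "u = affine_mod d 1 (b []) 1"
    have u: "u \<in> {1..d}" using affine_mod_in[OF d0] by (simp only: u_def)
    have y1: "y [1] = [u]" using d0 by (simp add: y affine_aut_letter u_def)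
    have "x [1] = z (y [1])"
      using zy affine_aut_in[OF one] d0 by (auto simp: y z Aut_mult compose_def)
    then have "x [1] = [affine_mod d 1 (b' []) u]" unfolding y1 z affine_aut_letter[OF u] .
    then have "affine_mod d 1 (b' []) u = u" using eq y1 by simp
    then have "[int u = 1 * int u + b' []] (mod int d)"
      unfolding affine_mod_eq_iff[OF d0] by (rule conjunct2)
    then have z0: "[b' [] = 0] (mod int d)" by (simp add: cong_iff_dvd_diff)
    have "affine_mod d 1 (b' []) x = x" if "x \<in> {1..d}" for x
      by (rule affine_mod_id[OF that cong_refl z0])
    then show "z \<in> ?B1" unfolding B1 using inB by (auto simp: z affine_aut_letter)
  qed (rule subB1)
  with subB1 have "finite_index_subgroup ?B1 (?A\<lparr>carrier := ?B\<rparr>)"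
    by (simp add: finite_index_subgroup_def)
  then show ?thesis
    unfolding regular_branch_def using affine_subgroup affine_transitive fi1 by blast
qed

end

section \<open>Counting finite quotients\<close>

lemma Aut_level:
  assumes "g \<in> carrier (Aut_tree d)" "v \<in> level d n"
  shows "g v \<in> level d n"
proof -
  obtain p where "portrait d p" "g = aut d p" using Aut_eq_aut[OF assms(1)] .
  then show ?thesis using assms(2) act_in_words[of d p v] by (auto simp: level_def aut_def)
qed

lemma Aut_one_apply: "v \<in> words d \<Longrightarrow> \<one>\<^bsub>Aut_tree d\<^esub> v = v"
  by (simp add: Aut_tree_def BijGroup_def)

text \<open>The coset consists of the products of \<open>g\<close> followed by some \<open>s\<close>
  trivial on the level; since \<open>g\<close> preserves the level, they agree with \<open>g\<close>
  there. This turns cosets into restrictions to the level.\<close>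

lemma proj_iff:
  assumes g: "g \<in> carrier (Aut_tree d)"
  shows "h \<in> proj d n g \<longleftrightarrow> h \<in> carrier (Aut_tree d) \<and> (\<forall>v\<in>level d n. h v = g v)"
proof -
  interpret A: group "Aut_tree d" by (rule Aut_group)
  have app: "(x \<otimes>\<^bsub>Aut_tree d\<^esub> y) v = x (y v)"
    if "x \<in> carrier (Aut_tree d)" "y \<in> carrier (Aut_tree d)" "v \<in> level d n" for x y v
    using that by (simp add: Aut_mult compose_def level_def)
  show ?thesis
  proof
    assume "h \<in> proj d n g"
    then obtain s where s: "s \<in> St d n" "h = s \<otimes>\<^bsub>Aut_tree d\<^esub> g" by (auto simp: proj_def r_coset_def)
    then show "h \<in> carrier (Aut_tree d) \<and> (\<forall>v\<in>level d n. h v = g v)"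
      using g Aut_level[OF g] by (auto simp: St_def app)
  next
    assume h: "h \<in> carrier (Aut_tree d) \<and> (\<forall>v\<in>level d n. h v = g v)"
    let ?i = "inv\<^bsub>Aut_tree d\<^esub> g"
    let ?s = "h \<otimes>\<^bsub>Aut_tree d\<^esub> ?i"
    have "?s v = v" if v: "v \<in> level d n" for v
    proof -
      have "v = (g \<otimes>\<^bsub>Aut_tree d\<^esub> ?i) v"
        using g v by (simp add: Aut_one_apply level_def)
      then have "v = g (?i v)" using app[of g ?i v] g v by simp
      then show ?thesis using app[of h ?i v] h v Aut_level[of ?i d v n] g by simp
    qed
    then have "?s \<in> St d n" using h g by (simp add: St_def)
    moreover have "h = ?s \<otimes>\<^bsub>Aut_tree d\<^esub> g" using h g by (simp add: A.m_assoc)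
    ultimately show "h \<in> proj d n g" by (auto simp: proj_def r_coset_def)
  qed
qed

lemma proj_eq_iff:
  assumes "g \<in> carrier (Aut_tree d)" "h \<in> carrier (Aut_tree d)"
  shows "proj d n g = proj d n h \<longleftrightarrow> (\<forall>v\<in>level d n. g v = h v)"
proof
  assume "proj d n g = proj d n h"
  then have "g \<in> proj d n h" using proj_iff[OF assms(1), of g] assms by auto
  then show "\<forall>v\<in>level d n. g v = h v" using proj_iff[OF assms(2)] by blast
next
  assume "\<forall>v\<in>level d n. g v = h v"
  then show "proj d n g = proj d n h"
    unfolding set_eq_iff proj_iff[OF assms(1)] proj_iff[OF assms(2)] by simp
qed

text \<open>Exactly the vertices whose letter maps are visible on level \<open>n\<close>, so the
  finite quotients are counted by functions on this set.\<close>

definition short_words :: "nat \<Rightarrow> nat \<Rightarrow> nat list set" where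
  "short_words d n = {w \<in> words d. length w < n}"

lemma finite_short_words: "finite (short_words d n)"
proof (rule finite_subset)
  show "short_words d n \<subseteq> {w. set w \<subseteq> {1..d} \<and> length w \<le> n}"
    by (auto simp: short_words_def words_def)
qed (rule finite_lists_length_le, simp)

text \<open>The words \<open>1^k\<close> already give this crude bound, which serves to let the
  number of visible vertices tend to infinity.\<close>

lemma card_short_words:
  assumes "d > 0" shows "n \<le> card (short_words d n)"
proof -
  have "(\<lambda>k. replicate k 1) ` {..<n} \<subseteq> short_words d n"
    using assms by (auto simp: short_words_def words_def)
  then have "card ((\<lambda>k. replicate k (1::nat)) ` {..<n}) \<le> card (short_words d n)"
    by (rule card_mono[OF finite_short_words])
  moreover have "inj_on (\<lambda>k. replicate k (1::nat)) {..<n}" by (auto simp: inj_on_def)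
  ultimately show ?thesis by (simp add: card_image)
qed

lemma act_nth: "i < length w \<Longrightarrow> act p w ! i = p (take i w) (w ! i)"
  by (simp add: act_def)

lemma act_eq_on_level_iff:
  assumes d: "d > 0"
  shows "(\<forall>v\<in>level d n. act p v = act q v) \<longleftrightarrow> (\<forall>w\<in>short_words d n. \<forall>x\<in>{1..d}. p w x = q w x)"
proof
  assume *: "\<forall>v\<in>level d n. act p v = act q v"
  show "\<forall>w\<in>short_words d n. \<forall>x\<in>{1..d}. p w x = q w x"
  proof (intro ballI)
    fix w x assume w: "w \<in> short_words d n" "x \<in> {1..d}"
    \<comment> \<open>Padding to length \<open>n\<close> makes \<open>p w x\<close> visible as one
      letter of the image.\<close>
    define v where "v = w @ [x] @ replicate (n - Suc (length w)) 1"
    have "v \<in> level d n"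
      using w d by (auto simp: v_def level_def short_words_def words_def)
    then have "act p v = act q v" using * by blast
    then have "act p v ! length w = act q v ! length w" by simp
    moreover have "length w < length v" by (simp add: v_def)
    moreover have "take (length w) v = w" "v ! length w = x" by (simp_all add: v_def)
    ultimately show "p w x = q w x" by (simp only: act_nth)
  qed
next
  assume *: "\<forall>w\<in>short_words d n. \<forall>x\<in>{1..d}. p w x = q w x"
  show "\<forall>v\<in>level d n. act p v = act q v"
  proof
    fix v assume v: "v \<in> level d n"
    have "p (take i v) (v ! i) = q (take i v) (v ! i)" if "i < length v" for i
    proof -
      have "take i v \<in> short_words d n" using v that by (auto simp: short_words_def level_def words_take)
      moreover have "v ! i \<in> {1..d}" using v nth_mem[OF that] by (auto simp: level_def words_def)
      ultimately show ?thesis using * by blast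
    qed
    then show "act p v = act q v" by (simp add: act_def)
  qed
qed

lemma proj_aut_eq_iff:
  assumes "d > 0" "portrait d p" "portrait d q"
  shows "proj d n (aut d p) = proj d n (aut d q) \<longleftrightarrow> (\<forall>w\<in>short_words d n. \<forall>x\<in>{1..d}. p w x = q w x)"
proof -
  have "proj d n (aut d p) = proj d n (aut d q) \<longleftrightarrow> (\<forall>v\<in>level d n. act p v = act q v)"
    unfolding proj_eq_iff[OF aut_in_Aut[OF assms(2)] aut_in_Aut[OF assms(3)]]
    by (auto simp: aut_def level_def)
  then show ?thesis unfolding act_eq_on_level_iff[OF assms(1)] .
qed

text \<open>One of the \<open>d!\<close> permutations is chosen freely at each visible vertex.
  Demanding \<open>permutes\<close> pins down the values off \<open>{1..d}\<close>, so that choices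
  correspond to cosets one to one.\<close>

lemma card_proj_Aut:
  assumes d: "d > 0"
  shows "card (proj d n ` carrier (Aut_tree d)) = fact d ^ card (short_words d n)"
proof -
  let ?P = "PiE (short_words d n) (\<lambda>_. {f. f permutes {1..d}})"
  define e where "e P = (\<lambda>w. if w \<in> short_words d n then P w else id)" for P :: "nat list \<Rightarrow> nat \<Rightarrow> nat"
  have e: "portrait d (e P)" if "P \<in> ?P" for P
    unfolding portrait_def
  proof
    fix w assume "w \<in> words d"
    show "bij_betw (e P w) {1..d} {1..d}"
    proof (cases "w \<in> short_words d n")
      case True
      then have "P w permutes {1..d}" using that by (auto dest: PiE_mem)
      then show ?thesis using True by (simp add: e_def permutes_imp_bij)
    qed (simp add: e_def bij_betw_def)
  qed
  have "bij_betw (\<lambda>P. proj d n (aut d (e P))) ?P (proj d n ` carrier (Aut_tree d))"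
    unfolding bij_betw_def
  proof (intro conjI equalityI subsetI)
    show "inj_on (\<lambda>P. proj d n (aut d (e P))) ?P"
    proof (rule inj_onI)
      fix P Q assume PQ: "P \<in> ?P" "Q \<in> ?P" "proj d n (aut d (e P)) = proj d n (aut d (e Q))"
      then have eq: "\<forall>w\<in>short_words d n. \<forall>x\<in>{1..d}. e P w x = e Q w x"
        using proj_aut_eq_iff[OF d e e] by blast
      show "P = Q"
      proof (rule PiE_ext[OF PQ(1,2)])
        fix w assume w: "w \<in> short_words d n"
        have pm: "P w permutes {1..d}" "Q w permutes {1..d}" using PQ w by (auto dest: PiE_mem)
        have "P w x = Q w x" if "x \<notin> {1..d}" for x
          by (simp only: permutes_not_in[OF pm(1) that] permutes_not_in[OF pm(2) that])
        moreover have "P w x = Q w x" if "x \<in> {1..d}" for x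
          using bspec[OF bspec[OF eq w] that] w by (simp add: e_def)
        ultimately show "P w = Q w" by blast
      qed
    qed
    fix C assume "C \<in> (\<lambda>P. proj d n (aut d (e P))) ` ?P"
    then show "C \<in> proj d n ` carrier (Aut_tree d)" using e aut_in_Aut by blast
  next
    fix C assume "C \<in> proj d n ` carrier (Aut_tree d)"
    then obtain g where g: "g \<in> carrier (Aut_tree d)" "C = proj d n g" by blast
    obtain p where p: "portrait d p" "g = aut d p" using Aut_eq_aut[OF g(1)] .
    define P where "P = (\<lambda>w\<in>short_words d n. \<lambda>x. if x \<in> {1..d} then p w x else x)"
    have P: "P \<in> ?P"
    proof (rule PiE_I)
      fix w assume w: "w \<in> short_words d n"
      then have "bij_betw (p w) {1..d} {1..d}" using p by (simp add: portrait_def short_words_def)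
      then have "bij_betw (\<lambda>x. if x \<in> {1..d} then p w x else x) {1..d} {1..d}"
        by (rule bij_betw_cong[THEN iffD1, rotated]) simp
      then show "P w \<in> {f. f permutes {1..d}}" using w
        by (auto simp: P_def intro!: bij_imp_permutes)
    qed (simp add: P_def)
    have "proj d n (aut d (e P)) = proj d n (aut d p)"
      unfolding proj_aut_eq_iff[OF d e[OF P] p(1)] by (simp add: e_def P_def)
    then show "C \<in> (\<lambda>P. proj d n (aut d (e P))) ` ?P" using P g p by blast
  qed
  then have "card (proj d n ` carrier (Aut_tree d)) = card ?P"
    by (simp add: bij_betw_same_card)
  also have "\<dots> = fact d ^ card (short_words d n)"
    by (simp add: card_PiE finite_short_words card_permutations)
  finally show ?thesis .
qed

context unit_group_mod
begin

abbreviation R :: "int set" where "R \<equiv> {0..<int d}"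

definition trunc :: "nat \<Rightarrow> (nat list \<Rightarrow> int) set" where
  "trunc n = PiE (short_words d n) (\<lambda>_. R)"

lemma finite_trunc: "finite (trunc n)"
  unfolding trunc_def by (rule finite_PiE[OF finite_short_words]) simp

lemma card_trunc: "card (trunc n) = d ^ card (short_words d n)"
  by (simp add: trunc_def card_PiE finite_short_words)

lemma proj_affine_eq_iff:
  assumes "a \<in> I" "a' \<in> I"
  shows "proj d n (affine_aut d a b) = proj d n (affine_aut d a' b') \<longleftrightarrow>
    (\<forall>w\<in>short_words d n. \<forall>x\<in>{1..d}. affine_mod d a (b w) x = affine_mod d a' (b' w) x)"
  unfolding affine_aut_def by (rule proj_aut_eq_iff[OF d0 portrait_affine portrait_affine]) fact+

text \<open>At the letter \<open>d\<close> the linear term vanishes modulo \<open>d\<close> and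
  \<open>b w\<close> can be read off; the letter 1 at the root then gives \<open>a\<close>. On level
  0 no letter is visible, hence \<open>n > 0\<close>.\<close>

lemma proj_affine_bij:
  assumes n: "n > 0"
  shows "bij_betw (\<lambda>(a, b). proj d n (affine_aut d a b)) (I \<times> trunc n) (proj d n ` affine_group d I)"
  unfolding bij_betw_def
proof (intro conjI equalityI subsetI)
  show "inj_on (\<lambda>(a, b). proj d n (affine_aut d a b)) (I \<times> trunc n)"
  proof (rule inj_onI, clarify)
    fix a b a' b' assume a: "a \<in> I" "a' \<in> I" and b: "b \<in> trunc n" "b' \<in> trunc n"
      and "proj d n (affine_aut d a b) = proj d n (affine_aut d a' b')"
    then have eq: "affine_mod d a (b w) x = affine_mod d a' (b' w) x" if "w \<in> short_words d n" "x \<in> {1..d}" for w x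
      unfolding proj_affine_eq_iff[OF a] using that by blast
    have cg: "[a * int x + b w = a' * int x + b' w] (mod int d)" if "w \<in> short_words d n" "x \<in> {1..d}" for w x
      using cong_trans[OF cong_sym[OF affine_mod_cong[OF d0, of a "b w" x]]] affine_mod_cong[OF d0, of a' "b' w" x]
        eq[OF that] by simp
    have "b w = b' w" if "w \<in> short_words d n" for w
    proof -
      have "[a * int d + b w = a' * int d + b' w] (mod int d)" using cg[OF that, of d] d0 by simp
      then have "[b w = b' w] (mod int d)" by (simp add: unique_euclidean_semiring_class.cong_def)
      moreover have "b w \<in> R" "b' w \<in> R" using b that by (auto simp: trunc_def dest: PiE_mem)
      ultimately show ?thesis by (intro cong_less_imp_eq_int[of "b w" "int d" "b' w"]) auto
    qed
    then have bb: "b = b'" using b unfolding trunc_def by (metis PiE_ext)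
    moreover have "[] \<in> short_words d n" using n by (simp add: short_words_def)
    then have "[a * int 1 + b [] = a' * int 1 + b []] (mod int d)" using cg[of "[]" 1] d0 bb by simp
    then have "[a = a'] (mod int d)" by (simp add: cong_add_rcancel)
    then have "a = a'" using a sub by (intro cong_less_imp_eq_int[of a "int d" a']) auto
    ultimately show "a = a' \<and> b = b'" by blast
  qed
  fix C assume "C \<in> (\<lambda>(a, b). proj d n (affine_aut d a b)) ` (I \<times> trunc n)"
  then show "C \<in> proj d n ` affine_group d I" by (auto simp: affine_group_def)
next
  fix C assume "C \<in> proj d n ` affine_group d I"
  then obtain a b where a: "a \<in> I" "C = proj d n (affine_aut d a b)" by (auto simp: affine_group_def)
  define b' where "b' = (\<lambda>w\<in>short_words d n. b w mod int d)"
  have "b' \<in> trunc n" using d0 by (auto simp: trunc_def b'_def)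
  moreover have "C = proj d n (affine_aut d a b')"
    unfolding a(2) proj_affine_eq_iff[OF a(1) a(1)]
    by (auto simp: b'_def intro!: affine_mod_cong_arg[OF d0] simp: unique_euclidean_semiring_class.cong_def)
  ultimately show "C \<in> (\<lambda>(a, b). proj d n (affine_aut d a b)) ` (I \<times> trunc n)"
    using a(1) by (intro image_eqI[where x = "(a, b')"]) simp_all
qed

lemma card_proj_affine: "n > 0 \<Longrightarrow> card (proj d n ` affine_group d I) = card I * d ^ card (short_words d n)"
  using bij_betw_same_card[OF proj_affine_bij] by (simp add: card_cartesian_product card_trunc)

lemma card_I_pos: "card I > 0"
  using one finite_I card_gt_0_iff by blast

text \<open>With \<open>N\<close> visible vertices the ratio is
  \<open>(ln |I| + N ln d) / (N ln d!)\<close>; the contribution of the multipliers is divided by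
  \<open>N\<close> and vanishes, so the lower limit is a limit.\<close>

lemma affine_Hausdorff: "Hausdorff_dim d (affine_group d I) = ereal (ln (real d) / ln (fact d))"
proof -
  let ?N = "\<lambda>n. real (card (short_words d n))"
  let ?f = "\<lambda>n. ln (real (card (proj d n ` affine_group d I))) / ln (real (card (proj d n ` carrier (Aut_tree d))))"
  let ?g = "\<lambda>n. ln (real (card I)) / ln (fact d) * (1 / ?N n) + ln (real d) / ln (fact d)"
  have "fact d \<ge> (fact 2 :: real)" using d2 by (rule fact_mono)
  then have f2: "ln (fact d :: real) > 0" by (intro ln_gt_zero) (simp add: fact_numeral)
  have N: "filterlim ?N at_top sequentially"
    by (rule filterlim_at_top_mono[OF filterlim_real_sequentially]) (use card_short_words[OF d0] in auto)
  have "?g \<longlonglongrightarrow> ln (real (card I)) / ln (fact d) * 0 + ln (real d) / ln (fact d)"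
    by (intro tendsto_intros tendsto_divide_0[OF tendsto_const] filterlim_at_top_imp_at_infinity N)
  moreover have "eventually (\<lambda>n. ?g n = ?f n) sequentially"
    using eventually_gt_at_top[of 0]
  proof eventually_elim
    case (elim n)
    have N0: "?N n > 0" using card_short_words[OF d0, of n] elim by simp
    have "real (card (proj d n ` affine_group d I)) = real (card I) * real d ^ card (short_words d n)"
      using elim by (simp add: card_proj_affine)
    then have 1: "ln (real (card (proj d n ` affine_group d I))) = ln (real (card I)) + ?N n * ln (real d)"
      using d0 card_I_pos by (simp add: ln_mult ln_realpow)
    have "real (card (proj d n ` carrier (Aut_tree d))) = fact d ^ card (short_words d n)"
      using d0 by (simp add: card_proj_Aut)
    then have 2: "ln (real (card (proj d n ` carrier (Aut_tree d)))) = ?N n * ln (fact d)"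
      by (simp add: ln_realpow)
    have "A / C * (1 / M) + B / C = (A + M * B) / (M * C)" if "M > 0" "C > 0" for A B C M :: real
      using that by (simp add: add_divide_distrib)
    from this[OF N0 f2] show ?case unfolding 1 2 .
  qed
  ultimately have "?f \<longlonglongrightarrow> ln (real (card I)) / ln (fact d) * 0 + ln (real d) / ln (fact d)"
    by (rule Lim_transform_eventually)
  then have "?f \<longlonglongrightarrow> ln (real d) / ln (fact d)" by (simp only: mult_zero_right add_0_left)
  then have "(\<lambda>n. ereal (?f n)) \<longlonglongrightarrow> ereal (ln (real d) / ln (fact d))" by (simp only: tendsto_ereal)
  then show ?thesis unfolding Hausdorff_dim_def by (intro lim_imp_Liminf) simp_all
qed

end

section \<open>The fixed-point proportion\<close>

lemma level_0: "level d 0 = {[]}"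
  by (auto simp: level_def)

lemma level_Suc: "level d (Suc n) = (\<lambda>(x, w). x # w) ` ({1..d} \<times> level d n)"
proof (intro equalityI subsetI)
  fix v assume v: "v \<in> level d (Suc n)"
  then obtain x w where "v = x # w" by (auto simp: level_def length_Suc_conv)
  then show "v \<in> (\<lambda>(x, w). x # w) ` ({1..d} \<times> level d n)"
    using v by (auto simp: level_def image_iff)
qed (auto simp: level_def)

lemma short_words_Suc: "w \<in> short_words d (Suc n) \<longleftrightarrow> w = [] \<or> (\<exists>x\<in>{1..d}. \<exists>u\<in>short_words d n. w = x # u)"
  by (cases w) (auto simp: short_words_def)

lemma act_cong:
  assumes "v \<in> level d n" "\<And>w. w \<in> short_words d n \<Longrightarrow> p w = q w"
  shows "act p v = act q v"
proof -
  have "p (take i v) = q (take i v)" if "i < length v" for i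
    using assms(1) that by (intro assms(2)) (auto simp: short_words_def level_def words_take)
  then show ?thesis by (simp add: act_def)
qed

lemma card_Sigma_PiE:
  fixes S :: "'a \<Rightarrow> 'b \<Rightarrow> 'c set"
  assumes "finite A" "finite B" "\<And>a b. a \<in> A \<Longrightarrow> b \<in> B \<Longrightarrow> finite (S a b)"
  shows "card (SIGMA a:A. PiE B (S a)) = (\<Sum>a\<in>A. \<Prod>b\<in>B. card (S a b))"
proof -
  have "card (SIGMA a:A. PiE B (S a)) = (\<Sum>a\<in>A. card (PiE B (S a)))"
    using assms by (intro card_SigmaI) (auto intro!: finite_PiE)
  also have "\<dots> = (\<Sum>a\<in>A. \<Prod>b\<in>B. card (S a b))"
    using assms(2) by (intro sum.cong refl card_PiE) auto
  finally show ?thesis .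
qed

context unit_group_mod
begin

definition subportrait :: "nat \<Rightarrow> (nat list \<Rightarrow> int) \<Rightarrow> nat \<Rightarrow> nat list \<Rightarrow> int" where
  "subportrait n b x = (\<lambda>u\<in>short_words d n. b (x # u))"

text \<open>A truncated family splits into its root value and its restrictions below the
  \<open>d\<close> letters. Letting the admissible sets \<open>S\<close> depend on the root value
  covers both the total count and the count without fixed vertices.\<close>

lemma card_trunc_Suc:
  assumes S: "\<And>b0 x. S b0 x \<subseteq> trunc n"
  shows "card {b \<in> trunc (Suc n). \<forall>x\<in>{1..d}. subportrait n b x \<in> S (b []) x}
    = (\<Sum>b0\<in>R. \<Prod>x\<in>{1..d}. card (S b0 x))"
proof -
  let ?L = "{b \<in> trunc (Suc n). \<forall>x\<in>{1..d}. subportrait n b x \<in> S (b []) x}"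
  let ?M = "SIGMA b0:R. PiE {1..d} (S b0)"
  define f where "f b = (b [], \<lambda>x\<in>{1..d}. subportrait n b x)" for b :: "nat list \<Rightarrow> int"
  define g where "g = (\<lambda>(b0, \<beta>). \<lambda>w\<in>short_words d (Suc n). case w of [] \<Rightarrow> b0 | x # u \<Rightarrow> (\<beta> x u :: int))"
  have nil: "[] \<in> short_words d (Suc n)" by (simp add: short_words_Suc)
  have cons: "x # u \<in> short_words d (Suc n)" if "x \<in> {1..d}" "u \<in> short_words d n" for x u
    using that by (auto simp: short_words_Suc)
  have fM: "f b \<in> ?M" if "b \<in> ?L" for b
    using that nil by (auto simp: f_def trunc_def intro!: PiE_I dest: PiE_mem)
  have sub: "subportrait n (g (b0, \<beta>)) x = \<beta> x" if "\<beta> \<in> PiE {1..d} (S b0)" "x \<in> {1..d}" for b0 \<beta> x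
  proof
    fix u
    have bx: "\<beta> x \<in> PiE (short_words d n) (\<lambda>_. R)"
      using subsetD[OF S PiE_mem[OF that]] by (simp only: trunc_def)
    show "subportrait n (g (b0, \<beta>)) x u = \<beta> x u"
    proof (cases "u \<in> short_words d n")
      case True
      then show ?thesis using cons[OF that(2) True] by (simp add: subportrait_def g_def)
    next
      case False
      then show ?thesis using PiE_arb[OF bx False] by (simp add: subportrait_def)
    qed
  qed
  have gL: "g m \<in> ?L" if "m \<in> ?M" for m
  proof -
    obtain b0 \<beta> where m: "m = (b0, \<beta>)" "b0 \<in> R" "\<beta> \<in> PiE {1..d} (S b0)" using \<open>m \<in> ?M\<close> by auto
    have "g m \<in> trunc (Suc n)"
      unfolding trunc_def
    proof (rule PiE_I)
      fix w assume w: "w \<in> short_words d (Suc n)"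
      show "g m w \<in> R"
      proof (cases w)
        case Nil
        then show ?thesis using w m by (simp add: g_def)
      next
        case (Cons x u)
        then have xu: "x \<in> {1..d}" "u \<in> short_words d n" using w by (auto simp: short_words_Suc)
        have "\<beta> x \<in> trunc n" using PiE_mem[OF m(3) xu(1)] S by blast
        then have "\<beta> x u \<in> R" using xu(2) unfolding trunc_def by (rule PiE_mem)
        then show ?thesis using w m Cons by (simp add: g_def)
      qed
    qed (simp add: g_def m)
    moreover have "g m [] = b0" using nil by (simp add: g_def m)
    moreover have "subportrait n (g m) x \<in> S b0 x" if "x \<in> {1..d}" for x
      unfolding m(1) sub[OF m(3) that] by (rule PiE_mem[OF m(3) that])
    ultimately show ?thesis by simp
  qed
  have "bij_betw f ?L ?M"
  proof (rule bij_betw_byWitness[where f' = g])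
    show "\<forall>b\<in>?L. g (f b) = b"
    proof
      fix b assume b: "b \<in> ?L"
      show "g (f b) = b"
      proof
        fix w
        show "g (f b) w = b w"
        proof (cases "w \<in> short_words d (Suc n)")
          case True
          then show ?thesis
            by (cases w) (auto simp: g_def f_def subportrait_def short_words_Suc)
        next
          case False
          then show ?thesis using b PiE_arb[of b "short_words d (Suc n)" "\<lambda>_. R" w]
            by (simp add: g_def f_def trunc_def)
        qed
      qed
    qed
    show "\<forall>m\<in>?M. f (g m) = m"
    proof
      fix m assume "m \<in> ?M"
      then obtain b0 \<beta> where m: "m = (b0, \<beta>)" "b0 \<in> R" "\<beta> \<in> PiE {1..d} (S b0)" by auto
      have "g m [] = b0" using nil by (simp add: g_def m)
      moreover have "(\<lambda>x\<in>{1..d}. subportrait n (g m) x) = \<beta>"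
      proof
        fix x
        show "(\<lambda>x\<in>{1..d}. subportrait n (g m) x) x = \<beta> x"
          using sub[OF m(3), of x] PiE_arb[OF m(3), of x] by (cases "x \<in> {1..d}") (simp_all add: m(1))
      qed
      ultimately show "f (g m) = m" by (simp only: f_def m(1))
    qed
  qed (use fM gL in blast)+
  then have "card ?L = card ?M" by (rule bij_betw_same_card)
  also have "\<dots> = (\<Sum>b0\<in>R. \<Prod>x\<in>{1..d}. card (S b0 x))"
    by (rule card_Sigma_PiE) (simp, simp, rule finite_subset[OF S finite_trunc])
  finally show ?thesis .
qed

definition no_fix :: "int \<Rightarrow> nat \<Rightarrow> (nat list \<Rightarrow> int) set" where
  "no_fix a n = {b \<in> trunc n. \<forall>v\<in>level d n. act (\<lambda>w. affine_mod d a (b w)) v \<noteq> v}"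

definition no_fix_ratio :: "int \<Rightarrow> nat \<Rightarrow> real" where
  "no_fix_ratio a n = real (card (no_fix a n)) / real (card (trunc n))"

definition fixed_letters :: "int \<Rightarrow> int \<Rightarrow> nat set" where
  "fixed_letters a b0 = {x \<in> {1..d}. affine_mod d a b0 x = x}"

lemma subportrait_trunc: "b \<in> trunc (Suc n) \<Longrightarrow> x \<in> {1..d} \<Longrightarrow> subportrait n b x \<in> trunc n"
proof -
  assume b: "b \<in> trunc (Suc n)" and x: "x \<in> {1..d}"
  have "b (x # u) \<in> R" if "u \<in> short_words d n" for u
    using PiE_mem[of b "short_words d (Suc n)" "\<lambda>_. R" "x # u"] b x that
    by (simp add: trunc_def short_words_Suc)
  then show "subportrait n b x \<in> trunc n" by (simp add: trunc_def subportrait_def)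
qed

lemma card_trunc_Suc': "card (trunc (Suc n)) = d * card (trunc n) ^ d"
proof -
  have "trunc (Suc n) = {b \<in> trunc (Suc n). \<forall>x\<in>{1..d}. subportrait n b x \<in> trunc n}"
    using subportrait_trunc by blast
  then have "card (trunc (Suc n)) = card {b \<in> trunc (Suc n). \<forall>x\<in>{1..d}. subportrait n b x \<in> trunc n}"
    by (rule arg_cong)
  also have "\<dots> = d * card (trunc n) ^ d"
    by (subst card_trunc_Suc[where S = "\<lambda>_ _. trunc n"]) simp_all
  finally show ?thesis .
qed

text \<open>A vertex \<open>x # u\<close> is fixed iff the root fixes \<open>x\<close> and the
  section at \<open>x\<close> fixes \<open>u\<close>; letters moved by the root impose nothing on
  their subtrees.\<close>

lemma no_fix_Suc:
  "no_fix a (Suc n) = {b \<in> trunc (Suc n). \<forall>x\<in>{1..d}. subportrait n b x \<in>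
     (if affine_mod d a (b []) x = x then no_fix a n else trunc n)}"
proof -
  have "(\<forall>v\<in>level d (Suc n). act (\<lambda>w. affine_mod d a (b w)) v \<noteq> v) \<longleftrightarrow>
      (\<forall>x\<in>{1..d}. subportrait n b x \<in> (if affine_mod d a (b []) x = x then no_fix a n else trunc n))"
    if b: "b \<in> trunc (Suc n)" for b
  proof -
    have eq: "act (\<lambda>w. affine_mod d a (b (x # w))) u = act (\<lambda>w. affine_mod d a (subportrait n b x w)) u"
      if "u \<in> level d n" for x u
      by (rule act_cong[OF that]) (simp add: subportrait_def)
    have "(\<forall>v\<in>level d (Suc n). act (\<lambda>w. affine_mod d a (b w)) v \<noteq> v) \<longleftrightarrow>
        (\<forall>x\<in>{1..d}. \<forall>u\<in>level d n. affine_mod d a (b []) x = x \<longrightarrow> act (\<lambda>w. affine_mod d a (subportrait n b x w)) u \<noteq> u)"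
      unfolding level_Suc by (auto simp: act_Cons eq)
    also have "\<dots> \<longleftrightarrow> (\<forall>x\<in>{1..d}. subportrait n b x \<in> (if affine_mod d a (b []) x = x then no_fix a n else trunc n))"
      using subportrait_trunc[OF b] unfolding no_fix_def by auto
    finally show ?thesis .
  qed
  then show ?thesis unfolding no_fix_def[of a "Suc n"] by blast
qed

lemma card_no_fix_Suc:
  "card (no_fix a (Suc n)) = (\<Sum>b0\<in>R. card (no_fix a n) ^ card (fixed_letters a b0)
     * card (trunc n) ^ (d - card (fixed_letters a b0)))"
proof -
  have "card (no_fix a (Suc n)) = (\<Sum>b0\<in>R. \<Prod>x\<in>{1..d}. card (if affine_mod d a b0 x = x then no_fix a n else trunc n))"
    unfolding no_fix_Suc
    by (rule card_trunc_Suc[where S = "\<lambda>b0 x. if affine_mod d a b0 x = x then no_fix a n else trunc n"])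
      (auto simp: no_fix_def)
  also have "\<dots> = (\<Sum>b0\<in>R. card (no_fix a n) ^ card (fixed_letters a b0) * card (trunc n) ^ (d - card (fixed_letters a b0)))"
  proof (rule sum.cong[OF refl])
    fix b0
    have "(\<Prod>x\<in>{1..d}. card (if affine_mod d a b0 x = x then no_fix a n else trunc n)) =
      (\<Prod>x\<in>fixed_letters a b0. card (no_fix a n)) * (\<Prod>x\<in>{1..d} - fixed_letters a b0. card (trunc n))"
      by (subst prod.subset_diff[of "fixed_letters a b0" "{1..d}"])
        (auto simp: fixed_letters_def mult.commute intro!: arg_cong2[where f = "(*)"] prod.cong)
    also have "card ({1..d} - fixed_letters a b0) = d - card (fixed_letters a b0)"
      by (subst card_Diff_subset) (auto simp: fixed_letters_def)
    then have "(\<Prod>x\<in>{1..d} - fixed_letters a b0. card (trunc n)) = card (trunc n) ^ (d - card (fixed_letters a b0))"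
      by simp
    finally show "(\<Prod>x\<in>{1..d}. card (if affine_mod d a b0 x = x then no_fix a n else trunc n)) =
      card (no_fix a n) ^ card (fixed_letters a b0) * card (trunc n) ^ (d - card (fixed_letters a b0))" by simp
  qed
  finally show ?thesis .
qed

lemma card_trunc_pos: "card (trunc n) > 0"
  using d0 by (simp add: card_trunc)

lemma card_fixed_letters_le: "card (fixed_letters a b0) \<le> d"
proof -
  have "card (fixed_letters a b0) \<le> card {1..d}"
    by (rule card_mono) (auto simp: fixed_letters_def)
  then show ?thesis by simp
qed

text \<open>The right side is the probability generating function of the number of fixed letters for
  uniformly random \<open>b0\<close>, evaluated at the previous ratio.\<close>

lemma no_fix_ratio_Suc:
  "no_fix_ratio a (Suc n) = (\<Sum>b0\<in>R. no_fix_ratio a n ^ card (fixed_letters a b0)) / real d"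
proof -
  let ?T = "real (card (trunc n))" and ?U = "real (card (no_fix a n))"
  have T: "?T > 0" using card_trunc_pos by simp
  have "no_fix_ratio a (Suc n) = (\<Sum>b0\<in>R. ?U ^ card (fixed_letters a b0) * ?T ^ (d - card (fixed_letters a b0))) / (real d * ?T ^ d)"
    by (simp add: no_fix_ratio_def card_no_fix_Suc card_trunc_Suc')
  also have "\<dots> = (\<Sum>b0\<in>R. ?U ^ card (fixed_letters a b0) * ?T ^ (d - card (fixed_letters a b0)) / ?T ^ d) / real d"
    by (simp add: sum_divide_distrib mult.commute)
  also have "\<dots> = (\<Sum>b0\<in>R. no_fix_ratio a n ^ card (fixed_letters a b0)) / real d"
  proof (intro arg_cong2[where f = "(/)"] sum.cong refl)
    fix b0
    have "?T ^ d = ?T ^ card (fixed_letters a b0) * ?T ^ (d - card (fixed_letters a b0))"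
      using card_fixed_letters_le[of a b0] by (simp flip: power_add)
    then show "?U ^ card (fixed_letters a b0) * ?T ^ (d - card (fixed_letters a b0)) / ?T ^ d = no_fix_ratio a n ^ card (fixed_letters a b0)"
      using T by (simp add: no_fix_ratio_def power_divide)
  qed
  finally show ?thesis .
qed

lemma no_fix_ratio_0: "no_fix_ratio a 0 = 0"
  by (simp add: no_fix_ratio_def no_fix_def level_0)

lemma no_fix_ratio_bounds: "0 \<le> no_fix_ratio a n" "no_fix_ratio a n \<le> 1"
proof -
  show "0 \<le> no_fix_ratio a n" by (simp add: no_fix_ratio_def)
  have "card (no_fix a n) \<le> card (trunc n)"
    by (rule card_mono[OF finite_trunc]) (auto simp: no_fix_def)
  then show "no_fix_ratio a n \<le> 1" using card_trunc_pos[of n] by (simp add: no_fix_ratio_def)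
qed

lemma fixed_letters_iff: "x \<in> fixed_letters a b0 \<longleftrightarrow> x \<in> {1..d} \<and> int d dvd (a - 1) * int x + b0"
proof -
  have "[int x = a * int x + b0] (mod int d) \<longleftrightarrow> int d dvd (a - 1) * int x + b0"
    by (subst cong_sym_eq) (simp add: cong_iff_dvd_diff algebra_simps)
  then show ?thesis by (auto simp: fixed_letters_def affine_mod_eq_iff[OF d0])
qed

text \<open>Double counting: a letter \<open>x\<close> is fixed for exactly one residue
  \<open>b0\<close>, namely \<open>-(a - 1) x\<close>. Mean offspring 1 is what makes the branching
  process critical.\<close>

lemma sum_fixed_letters: "(\<Sum>b0\<in>R. card (fixed_letters a b0)) = d"
proof -
  have "(\<Sum>b0\<in>R. card (fixed_letters a b0)) = (\<Sum>b0\<in>R. \<Sum>x\<in>{1..d}. if x \<in> fixed_letters a b0 then 1 else 0)"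
    by (intro sum.cong refl) (auto simp: fixed_letters_def sum.If_cases intro!: arg_cong[where f = card])
  also have "\<dots> = (\<Sum>x\<in>{1..d}. \<Sum>b0\<in>R. if x \<in> fixed_letters a b0 then 1 else 0)"
    by (rule sum.swap)
  also have "\<dots> = (\<Sum>x\<in>{1..d}. 1)"
  proof (rule sum.cong[OF refl])
    fix x assume x: "x \<in> {1..d}"
    let ?b = "- ((a - 1) * int x) mod int d"
    have "x \<in> fixed_letters a b0 \<longleftrightarrow> b0 = ?b" if "b0 \<in> R" for b0
    proof -
      have "int d dvd (a - 1) * int x + b0 \<longleftrightarrow> b0 mod int d = ?b"
        by (simp only: mod_eq_dvd_iff) (simp add: add.commute)
      then show ?thesis using x that by (auto simp: fixed_letters_iff)
    qed
    then have "(\<Sum>b0\<in>R. if x \<in> fixed_letters a b0 then 1 else 0) = (\<Sum>b0\<in>R. if b0 = ?b then 1 else (0::nat))"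
      by (intro sum.cong) auto
    also have "\<dots> = 1" using d0 by (simp add: sum.delta)
    finally show "(\<Sum>b0\<in>R. if x \<in> fixed_letters a b0 then 1 else 0) = (1::nat)" .
  qed
  finally show ?thesis by simp
qed

text \<open>With \<open>a - 1\<close> invertible each map has at most one fixed letter; as the
  average is 1, it has exactly one, and the recursion stays at its initial value 0.\<close>

lemma no_fix_ratio_coprime:
  assumes "coprime (a - 1) (int d)"
  shows "no_fix_ratio a n = 0"
proof -
  have le1: "card (fixed_letters a b0) \<le> 1" for b0
  proof -
    have "x = y" if "x \<in> fixed_letters a b0" "y \<in> fixed_letters a b0" for x y
    proof -
      have "int d dvd ((a - 1) * int x + b0) - ((a - 1) * int y + b0)"
        using that by (intro dvd_diff) (auto simp: fixed_letters_iff)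
      then have "int d dvd (a - 1) * (int x - int y)" by (simp add: algebra_simps)
      then have "int d dvd int x - int y"
        using assms by (simp add: coprime_dvd_mult_right_iff coprime_commute)
      then show ?thesis using that by (intro residue_unique) (auto simp: fixed_letters_iff cong_iff_dvd_diff)
    qed
    moreover have "finite (fixed_letters a b0)" by (simp add: fixed_letters_def)
    ultimately show ?thesis by (metis One_nat_def card_le_Suc0_iff_eq)
  qed
  \<comment> \<open>Truncated subtraction is harmless because of \<open>le1\<close>; a vanishing sum
    of natural numbers then forces every term to vanish.\<close>
  have "(\<Sum>b0\<in>R. 1 - card (fixed_letters a b0)) = 0"
    using sum_fixed_letters[of a] le1 by (subst sum_subtractf_nat) auto
  then have ge1: "\<forall>b0\<in>R. 1 - card (fixed_letters a b0) = 0"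
    by (simp only: sum_eq_0_iff finite_atLeastLessThan_int)
  have "card (fixed_letters a b0) = 1" if "b0 \<in> R" for b0
    using le1[of b0] bspec[OF ge1 that] by linarith
  then have "no_fix_ratio a (Suc n) = no_fix_ratio a n" for n
    using d0 by (simp add: no_fix_ratio_Suc)
  then show ?thesis by (induction n) (simp_all add: no_fix_ratio_0)
qed

text \<open>Bernoulli for the exponent \<open>k - 1\<close>, multiplied by \<open>u\<close>, leaves
  the surplus \<open>(k - 1) (1 - u)^2\<close>, positive because \<open>k \<ge> 2\<close> and
  \<open>u < 1\<close>.\<close>

lemma power_gt_Bernoulli:
  fixes u :: real
  assumes "0 \<le> u" "u < 1" "k \<ge> 2"
  shows "1 - real k * (1 - u) < u ^ k"
proof -
  obtain m where k: "k = Suc m" "m \<ge> 1" using assms(3) by (cases k) auto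
  have "1 + real m * (u - 1) \<le> (1 + (u - 1)) ^ m"
    by (rule Bernoulli_inequality) (use assms in auto)
  then have "u * (1 - real m * (1 - u)) \<le> u * u ^ m"
    using assms by (intro mult_left_mono) (auto simp: algebra_simps)
  moreover have "0 < real m * ((1 - u) * (1 - u))" using k assms by simp
  ultimately show ?thesis using k by (simp add: algebra_simps)
qed

text \<open>The numbers of fixed letters average to 1 but are not all 1, so by Bernoulli's inequality
  1 is the only fixed point of the recursion in the unit interval.\<close>

lemma no_fix_ratio_not_coprime:
  assumes "\<not> coprime (a - 1) (int d)"
  shows "no_fix_ratio a \<longlonglongrightarrow> 1"
proof -
  let ?k = "\<lambda>b0. card (fixed_letters a b0)"
  \<comment> \<open>With \<open>g = gcd (a - 1) d > 1\<close> and \<open>d = g * e\<close>, the map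
    \<open>x \<mapsto> a x\<close> fixes both \<open>e\<close> and \<open>d\<close>.\<close>
  have k2: "?k 0 \<ge> 2"
  proof -
    let ?g = "gcd (a - 1) (int d)"
    have g1: "?g > 1" using assms d0 by (metis coprime_iff_gcd_eq_1 gcd_ge_0_int gcd_pos_int less_le
      of_nat_0_less_iff zless_imp_add1_zle add_0 int_one_le_iff_zero_less not_le)
    obtain e where e: "int d = ?g * e" by (metis dvdE gcd_dvd2)
    obtain f where f: "a - 1 = ?g * f" by (metis dvdE gcd_dvd1)
    have "e > 0" using e d0 g1 by (metis of_nat_0_less_iff zero_less_mult_pos less_trans zero_less_one)
    then have "e < int d" using e g1 by (metis mult.commute mult_less_cancel_left1 not_less_iff_gr_or_eq mult_less_cancel_left_pos mult_1_right)
    have "int d dvd (a - 1) * e" by (metis dvd_triv_left e f mult.assoc mult.commute)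
    then have "nat e \<in> fixed_letters a 0" "d \<in> fixed_letters a 0"
      using \<open>e > 0\<close> \<open>e < int d\<close> d0 by (auto simp: fixed_letters_iff)
    moreover have "nat e \<noteq> d" using \<open>e < int d\<close> \<open>e > 0\<close> by auto
    moreover have "finite (fixed_letters a 0)" by (simp add: fixed_letters_def)
    ultimately have "card {nat e, d} \<le> ?k 0" by (intro card_mono) auto
    then show ?thesis using \<open>nat e \<noteq> d\<close> by simp
  qed
  \<comment> \<open>The recursion is monotone and starts at the least possible value 0, so the
    iterates increase to a fixed point \<open>L\<close>.\<close>
  have inc: "incseq (no_fix_ratio a)"
  proof (rule incseq_SucI)
    fix n
    show "no_fix_ratio a n \<le> no_fix_ratio a (Suc n)"
    proof (induction n)
      case 0
      then show ?case by (simp add: no_fix_ratio_0 no_fix_ratio_bounds)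
    next
      case (Suc n)
      have "(\<Sum>b0\<in>R. no_fix_ratio a n ^ ?k b0) \<le> (\<Sum>b0\<in>R. no_fix_ratio a (Suc n) ^ ?k b0)"
        by (intro sum_mono power_mono Suc no_fix_ratio_bounds)
      then show ?case unfolding no_fix_ratio_Suc[of a n] no_fix_ratio_Suc[of a "Suc n"]
        by (intro divide_right_mono) (simp_all add: no_fix_ratio_Suc)
    qed
  qed
  then obtain L where L: "no_fix_ratio a \<longlonglongrightarrow> L" "\<And>n. no_fix_ratio a n \<le> L"
    using incseq_convergent[OF inc, of 1] no_fix_ratio_bounds by blast
  have L0: "0 \<le> L" using L(2)[of 0] by (simp add: no_fix_ratio_0)
  have L1: "L \<le> 1" by (rule LIMSEQ_le_const2[OF L(1)]) (use no_fix_ratio_bounds in auto)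
  have "(\<lambda>n. (\<Sum>b0\<in>R. no_fix_ratio a n ^ ?k b0) / real d) \<longlonglongrightarrow> (\<Sum>b0\<in>R. L ^ ?k b0) / real d"
    by (intro tendsto_intros L(1)) (use d0 in auto)
  then have "(\<lambda>n. no_fix_ratio a (Suc n)) \<longlonglongrightarrow> (\<Sum>b0\<in>R. L ^ ?k b0) / real d"
    by (simp only: no_fix_ratio_Suc)
  then have "L = (\<Sum>b0\<in>R. L ^ ?k b0) / real d"
    using LIMSEQ_unique[OF LIMSEQ_Suc[OF L(1)]] by blast
  then have fp: "real d * L = (\<Sum>b0\<in>R. L ^ ?k b0)" using d0 by (simp add: field_simps)
  have "L = 1"
  proof (rule ccontr)
    assume "L \<noteq> 1"
    then have Ll: "L < 1" using L1 by simp
    \<comment> \<open>The tangent lines at 1 add up to \<open>d * L\<close>, and the term at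
      \<open>b0 = 0\<close> is strict, contradicting the fixed point equation.\<close>
    have "(\<Sum>b0\<in>R. 1 - real (?k b0) * (1 - L)) < (\<Sum>b0\<in>R. L ^ ?k b0)"
    proof (rule sum_strict_mono_ex1)
      have "1 - real k * (1 - L) \<le> L ^ k" for k
        using Bernoulli_inequality[of "L - 1" k] L0 by (simp add: algebra_simps)
      then show "\<forall>b0\<in>R. 1 - real (?k b0) * (1 - L) \<le> L ^ ?k b0" by blast
      have "1 - real (?k 0) * (1 - L) < L ^ ?k 0" by (rule power_gt_Bernoulli[OF L0 Ll k2])
      moreover have "0 \<in> R" using d0 by simp
      ultimately show "\<exists>b0\<in>R. 1 - real (?k b0) * (1 - L) < L ^ ?k b0" by blast
    qed simp
    also have "(\<Sum>b0\<in>R. 1 - real (?k b0) * (1 - L)) = real d - real (\<Sum>b0\<in>R. ?k b0) * (1 - L)"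
      by (simp add: sum_subtractf sum_distrib_right)
    also have "\<dots> = real d * L" unfolding sum_fixed_letters by (simp add: algebra_simps)
    finally show False using fp by simp
  qed
  then show ?thesis using L(1) by simp
qed

text \<open>Cosets correspond to pairs \<open>(a, b)\<close>, and every member of a coset acts on
  the level like its affine representative; the proportion is therefore an average over the
  multipliers.\<close>

lemma fixed_ratio_affine:
  assumes n: "n > 0"
  shows "fixed_ratio d (affine_group d I) n = (\<Sum>a\<in>I. 1 - no_fix_ratio a n) / real (card I)"
proof -
  let ?\<Psi> = "\<lambda>(a, b). proj d n (affine_aut d a b)"
  let ?X = "SIGMA a:I. (trunc n - no_fix a n)"
  note bij = proj_affine_bij[OF n]
  have fix_iff: "(\<exists>g\<in>proj d n (affine_aut d a b). \<exists>v\<in>level d n. g v = v) \<longleftrightarrow> b \<notin> no_fix a n"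
    if "a \<in> I" "b \<in> trunc n" for a b
  proof -
    have in_A: "affine_aut d a b \<in> carrier (Aut_tree d)" by (rule affine_aut_in[OF that(1)])
    have "(\<exists>g\<in>proj d n (affine_aut d a b). \<exists>v\<in>level d n. g v = v) \<longleftrightarrow> (\<exists>v\<in>level d n. affine_aut d a b v = v)"
      using proj_iff[OF in_A, of _ n] in_A by metis
    also have "\<dots> \<longleftrightarrow> (\<exists>v\<in>level d n. act (\<lambda>w. affine_mod d a (b w)) v = v)"
      by (auto simp: affine_aut_def aut_def level_def)
    finally show ?thesis using that by (auto simp: no_fix_def)
  qed
  have "{C \<in> proj d n ` affine_group d I. \<exists>g\<in>C. \<exists>v\<in>level d n. g v = v} = ?\<Psi> ` ?X"
  proof (intro equalityI subsetI)
    fix C assume C: "C \<in> {C \<in> proj d n ` affine_group d I. \<exists>g\<in>C. \<exists>v\<in>level d n. g v = v}"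
    then have "C \<in> ?\<Psi> ` (I \<times> trunc n)" using bij by (simp add: bij_betw_def)
    then obtain a b where ab: "a \<in> I" "b \<in> trunc n" "C = proj d n (affine_aut d a b)" by auto
    then have "b \<notin> no_fix a n" using C fix_iff by blast
    then show "C \<in> ?\<Psi> ` ?X" using ab by (intro image_eqI[where x = "(a, b)"]) simp_all
  next
    fix C assume "C \<in> ?\<Psi> ` ?X"
    then obtain a b where ab: "a \<in> I" "b \<in> trunc n" "b \<notin> no_fix a n" "C = proj d n (affine_aut d a b)" by auto
    then have "C \<in> proj d n ` affine_group d I" by (auto simp: affine_group_def)
    then show "C \<in> {C \<in> proj d n ` affine_group d I. \<exists>g\<in>C. \<exists>v\<in>level d n. g v = v}"
      using ab fix_iff by blast
  qed
  moreover have "card (?\<Psi> ` ?X) = card ?X"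
    by (rule card_image, rule inj_on_subset[OF bij_betw_imp_inj_on[OF bij]]) auto
  moreover have "card ?X = (\<Sum>a\<in>I. card (trunc n - no_fix a n))"
    using finite_I finite_trunc by (intro card_SigmaI) auto
  moreover have "card (trunc n - no_fix a n) = card (trunc n) - card (no_fix a n)" for a
    by (rule card_Diff_subset) (auto simp: no_fix_def finite_trunc)
  moreover have "card (no_fix a n) \<le> card (trunc n)" for a
    by (rule card_mono[OF finite_trunc]) (auto simp: no_fix_def)
  ultimately have "real (card {C \<in> proj d n ` affine_group d I. \<exists>g\<in>C. \<exists>v\<in>level d n. g v = v})
      = (\<Sum>a\<in>I. real (card (trunc n)) - real (card (no_fix a n)))"
    by (simp add: of_nat_diff)
  also have "\<dots> = (\<Sum>a\<in>I. real (card (trunc n)) * (1 - no_fix_ratio a n))"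
    using card_trunc_pos[of n] by (intro sum.cong) (auto simp: no_fix_ratio_def algebra_simps)
  also have "\<dots> = real (card (trunc n)) * (\<Sum>a\<in>I. 1 - no_fix_ratio a n)" by (rule sum_distrib_left[symmetric])
  finally show ?thesis
    using card_trunc_pos[of n] by (simp add: fixed_ratio_def card_proj_affine[OF n] flip: card_trunc)
qed

lemma affine_FPP:
  "fixed_ratio d (affine_group d I) \<longlonglongrightarrow> real (card {a \<in> I. coprime (a - 1) (int d)}) / real (card I)"
proof -
  let ?c = "\<lambda>a. if coprime (a - 1) (int d) then 1 else 0 :: real"
  have "(\<lambda>n. 1 - no_fix_ratio a n) \<longlonglongrightarrow> ?c a" for a
  proof (cases "coprime (a - 1) (int d)")
    case True
    then show ?thesis by (simp add: no_fix_ratio_coprime)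
  next
    case False
    from tendsto_diff[OF tendsto_const no_fix_ratio_not_coprime[OF False], of 1] show ?thesis using False by simp
  qed
  then have "(\<lambda>n. (\<Sum>a\<in>I. 1 - no_fix_ratio a n) / real (card I)) \<longlonglongrightarrow> (\<Sum>a\<in>I. ?c a) / real (card I)"
    using card_I_pos by (intro tendsto_intros) auto
  moreover have "eventually (\<lambda>n. (\<Sum>a\<in>I. 1 - no_fix_ratio a n) / real (card I) = fixed_ratio d (affine_group d I) n) sequentially"
    using eventually_gt_at_top[of 0] by eventually_elim (simp add: fixed_ratio_affine)
  ultimately have "fixed_ratio d (affine_group d I) \<longlonglongrightarrow> (\<Sum>a\<in>I. ?c a) / real (card I)"
    by (rule Lim_transform_eventually)
  moreover have "(\<Sum>a\<in>I. ?c a) = real (card {a \<in> I. coprime (a - 1) (int d)})"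
    using finite_I by (simp add: sum.If_cases Int_def)
  ultimately show ?thesis by (simp only:)
qed

end

section \<open>Counting pairs of consecutive units\<close>

text \<open>Schemmel's totient of order 2. The pair \<open>k\<close>, \<open>Suc k\<close> stands
  for \<open>a - 1\<close>, \<open>a\<close>; at \<open>n = 1\<close> the value is 1, which starts
  the induction.\<close>

definition consecutive_units :: "nat \<Rightarrow> nat" where
  "consecutive_units n = card {k. k < n \<and> coprime k n \<and> coprime (Suc k) n}"

lemma coprime_mod_iffs:
  fixes k m :: nat
  shows "coprime (k mod m) m \<longleftrightarrow> coprime k m" "coprime (Suc (k mod m)) m \<longleftrightarrow> coprime (Suc k) m"
proof -
  have *: "coprime (k mod m) m \<longleftrightarrow> coprime k m" for k
    by (cases "m = 0") (simp_all add: coprime_mod_left_iff)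
  show "coprime (k mod m) m \<longleftrightarrow> coprime k m" by (rule *)
  have "coprime (Suc (k mod m)) m \<longleftrightarrow> coprime (Suc (k mod m) mod m) m" by (simp only: *)
  also have "\<dots> \<longleftrightarrow> coprime (Suc k) m" by (simp only: mod_Suc_eq *)
  finally show "coprime (Suc (k mod m)) m \<longleftrightarrow> coprime (Suc k) m" .
qed

text \<open>If \<open>p\<close> divides \<open>n\<close>, coprimality to \<open>p * n\<close>
  depends only on the residue modulo \<open>n\<close>, and there are \<open>p\<close> blocks of
  length \<open>n\<close>.\<close>

lemma consecutive_units_mult_dvd:
  assumes "p dvd n" "n > 0"
  shows "consecutive_units (p * n) = p * consecutive_units n"
proof -
  let ?S = "\<lambda>n. {k. k < n \<and> coprime k n \<and> coprime (Suc k) n}"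
  have cop: "coprime k (p * n) \<longleftrightarrow> coprime k n" for k
    using assms(1) by (auto intro: coprime_divisors[of k k p n])
  have cp: "coprime k n \<Longrightarrow> coprime k p" for k
    by (rule coprime_divisors[OF dvd_refl assms(1)])
  have "bij_betw (\<lambda>k. (k div n, k mod n)) (?S (p * n)) ({..<p} \<times> ?S n)"
  proof (rule bij_betw_byWitness[where f' = "\<lambda>(q, r). q * n + r"])
    show "\<forall>k\<in>?S (p * n). (case (k div n, k mod n) of (q, r) \<Rightarrow> q * n + r) = k" by simp
    show "\<forall>x\<in>{..<p} \<times> ?S n. (((case x of (q, r) \<Rightarrow> q * n + r) div n), ((case x of (q, r) \<Rightarrow> q * n + r) mod n)) = x"
      using assms(2) by auto
    show "(\<lambda>k. (k div n, k mod n)) ` ?S (p * n) \<subseteq> {..<p} \<times> ?S n"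
      using assms(2) by (auto simp: cop coprime_mod_iffs less_mult_imp_div_less)
    show "(\<lambda>(q, r). q * n + r) ` ({..<p} \<times> ?S n) \<subseteq> ?S (p * n)"
    proof (rule image_subsetI)
      fix x assume "x \<in> {..<p} \<times> ?S n"
      then obtain q r where x: "x = (q, r)" "q < p" "r < n" "coprime r n" "coprime (Suc r) n" by auto
      have "q * n + r < Suc q * n" using x by simp
      also have "\<dots> \<le> p * n" using x by (intro mult_le_mono1) simp
      finally have "q * n + r < p * n" .
      moreover have "(q * n + r) mod n = r" using x by simp
      ultimately show "(case x of (q, r) \<Rightarrow> q * n + r) \<in> ?S (p * n)"
        using x coprime_mod_iffs[of "q * n + r" n] cp by simp
    qed
  qed
  then have "card (?S (p * n)) = card ({..<p} \<times> ?S n)" by (rule bij_betw_same_card)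
  then show ?thesis by (simp add: consecutive_units_def card_cartesian_product)
qed

text \<open>Chinese remainder theorem; surjectivity follows from injectivity by counting.\<close>

lemma consecutive_units_mult_coprime:
  assumes "coprime m n" "m > 0" "n > 0"
  shows "consecutive_units (m * n) = consecutive_units m * consecutive_units n"
proof -
  let ?S = "\<lambda>n. {k. k < n \<and> coprime k n \<and> coprime (Suc k) n}"
  let ?f = "\<lambda>k. (k mod m, k mod n)"
  have inj: "inj_on ?f {..<m * n}"
  proof (rule inj_onI)
    fix x y assume "x \<in> {..<m * n}" "y \<in> {..<m * n}" "?f x = ?f y"
    then have "[x = y] (mod m)" "[x = y] (mod n)" "x < m * n" "y < m * n"
      by (auto simp: unique_euclidean_semiring_class.cong_def)
    then show "x = y" using coprime_cong_mult_nat[OF _ _ assms(1)] cong_less_modulus_unique_nat by blast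
  qed
  have im: "?f ` {..<m * n} = {..<m} \<times> {..<n}"
  proof (rule card_subset_eq)
    show "?f ` {..<m * n} \<subseteq> {..<m} \<times> {..<n}" using assms by auto
    show "card (?f ` {..<m * n}) = card ({..<m} \<times> {..<n})"
      using card_image[OF inj] by (simp add: card_cartesian_product)
  qed simp
  have S: "k \<in> ?S (m * n) \<longleftrightarrow> k \<in> {..<m * n} \<and> ?f k \<in> ?S m \<times> ?S n" for k
    using assms by (auto simp: coprime_mod_iffs)
  have imS: "?f ` ?S (m * n) = ?S m \<times> ?S n"
  proof (intro equalityI subsetI)
    fix x assume x: "x \<in> ?S m \<times> ?S n"
    then have "x \<in> {..<m} \<times> {..<n}" by auto
    then obtain k where k: "k \<in> {..<m * n}" "x = ?f k" unfolding im[symmetric] by (elim imageE)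
    then have "k \<in> ?S (m * n)" unfolding S using x by simp
    then show "x \<in> ?f ` ?S (m * n)" unfolding k(2) by (rule imageI)
  next
    fix x assume "x \<in> ?f ` ?S (m * n)"
    then obtain k where "x = ?f k" "k \<in> ?S (m * n)" by (elim imageE)
    then show "x \<in> ?S m \<times> ?S n" using S[of k] by simp
  qed
  have "inj_on ?f (?S (m * n))" by (rule inj_on_subset[OF inj]) auto
  from card_image[OF this] have "card (?S m \<times> ?S n) = card (?S (m * n))" unfolding imS .
  then show ?thesis by (simp add: consecutive_units_def card_cartesian_product)
qed

lemma consecutive_units_prime:
  assumes p: "prime p"
  shows "consecutive_units p = p - 2"
proof -
  have "p \<ge> 2" by (rule prime_ge_2_nat[OF p])
  have cop: "coprime k p \<longleftrightarrow> \<not> p dvd k" for k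
  proof
    show "\<not> p dvd k" if "coprime k p"
      using coprime_common_divisor[OF that, of p] p not_prime_unit by auto
    show "coprime k p" if "\<not> p dvd k"
      using prime_imp_coprime[OF p that] by (simp add: coprime_commute)
  qed
  have "{k. k < p \<and> coprime k p \<and> coprime (Suc k) p} = {1..<p - 1}"
    unfolding cop
  proof (intro equalityI subsetI)
    fix k assume "k \<in> {k. k < p \<and> \<not> p dvd k \<and> \<not> p dvd Suc k}"
    then have "k \<noteq> 0" "Suc k \<noteq> p" "k < p" by (auto intro!: gr0I)
    then show "k \<in> {1..<p - 1}" by auto
  next
    fix k assume "k \<in> {1..<p - 1}"
    then have "0 < k" "k < p" "Suc k < p" by auto
    then show "k \<in> {k. k < p \<and> \<not> p dvd k \<and> \<not> p dvd Suc k}"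
      using nat_dvd_not_less[of k p] nat_dvd_not_less[of "Suc k" p] by simp
  qed
  then show ?thesis by (simp add: consecutive_units_def)
qed

text \<open>One prime at a time: a new prime contributes the factor \<open>p - 2\<close>, a repeated
  one the factor \<open>p\<close>.\<close>

lemma consecutive_units_formula:
  "n > 0 \<Longrightarrow> real (consecutive_units n) = real n * (\<Prod>p\<in>prime_factors n. 1 - 2 / real p)"
proof (induction n rule: prime_divisors_induct)
  case (unit n)
  then show ?case by (simp add: consecutive_units_def)
next
  case (factor p n)
  then have p: "prime p" and n: "n > 0" by auto
  have pf: "prime_factors (p * n) = insert p (prime_factors n)"
    using p n by (simp add: prime_factors_product prime_prime_factors)
  show ?case
  proof (cases "p dvd n")
    case True
    then have "insert p (prime_factors n) = prime_factors n"
      using p n by (auto simp: in_prime_factors_iff)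
    then show ?thesis using factor.IH n consecutive_units_mult_dvd[OF True n] unfolding pf by simp
  next
    case False
    then have "coprime p n" using p by (simp add: prime_imp_coprime)
    then have "consecutive_units (p * n) = (p - 2) * consecutive_units n"
      using consecutive_units_mult_coprime[of p n] p n by (simp add: consecutive_units_prime prime_gt_0_nat)
    moreover have "p \<notin> prime_factors n" using False by (auto simp: in_prime_factors_iff)
    moreover have "real (p - 2) = real p * (1 - 2 / real p)"
      using prime_ge_2_nat[OF p] by (simp add: field_simps of_nat_diff)
    ultimately show ?thesis using factor.IH n unfolding pf by simp
  qed
qed simp

lemma consecutive_units_ratio:
  assumes "n > 0"
  shows "real (consecutive_units n) / real (totient n) = (\<Prod>p\<in>prime_factors n. (real p - 2) / (real p - 1))"
proof -
  have "real (totient n) = real n * (\<Prod>p\<in>prime_factors n. 1 - 1 / real p)"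
    by (rule totient_formula2)
  then have "real (consecutive_units n) / real (totient n)
      = (\<Prod>p\<in>prime_factors n. 1 - 2 / real p) / (\<Prod>p\<in>prime_factors n. 1 - 1 / real p)"
    using assms by (simp add: consecutive_units_formula)
  also have "\<dots> = (\<Prod>p\<in>prime_factors n. (1 - 2 / real p) / (1 - 1 / real p))"
    by (rule prod_dividef[symmetric])
  also have "\<dots> = (\<Prod>p\<in>prime_factors n. (real p - 2) / (real p - 1))"
  proof (rule prod.cong[OF refl])
    fix p assume "p \<in> prime_factors n"
    then have "real p > 1" using prime_gt_1_nat by (auto simp: in_prime_factors_iff)
    then show "(1 - 2 / real p) / (1 - 1 / real p) = (real p - 2) / (real p - 1)"
      by (simp add: field_simps)
  qed
  finally show ?thesis .
qed

section \<open>Irreducibility of the cyclotomic polynomials\<close>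

lemma freshman_dream:
  fixes x y :: "'a::comm_ring_1"
  assumes p: "prime p"
  shows "of_nat p dvd ((x + y) ^ p - (x ^ p + y ^ p))"
proof -
  have p0: "p > 0" using p by (rule prime_gt_0_nat)
  let ?f = "\<lambda>k. of_nat (p choose k) * x ^ k * y ^ (p - k)"
  have "(x + y) ^ p = (\<Sum>k\<le>p. ?f k)" by (rule binomial_ring)
  also have "{..p} = insert 0 (insert p {0<..<p})" using p0 by auto
  also have "sum ?f \<dots> = y ^ p + (x ^ p + (\<Sum>k\<in>{0<..<p}. ?f k))" using p0 by (simp add: sum.insert)
  finally have "(x + y) ^ p - (x ^ p + y ^ p) = (\<Sum>k\<in>{0<..<p}. ?f k)" by (simp add: algebra_simps)
  also have "of_nat p dvd \<dots>"
  proof (rule dvd_sum)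
    fix k assume "k \<in> {0<..<p}"
    then have "p dvd (p choose k)" using p0 p by (intro dvd_choose_prime) auto
    then have "(of_nat p :: 'a) dvd of_nat (p choose k)" by (auto elim!: dvdE)
    then show "of_nat p dvd ?f k" by (simp add: mult.assoc)
  qed
  finally show ?thesis .
qed

text \<open>Modulo \<open>p\<close> the mixed binomial terms vanish, and a constant satisfies
  \<open>a^p \<equiv> a\<close> by Fermat; Horner's scheme passes this on to all
  coefficients.\<close>

lemma int_poly_frobenius:
  fixes g :: "int poly"
  assumes p: "prime p"
  shows "of_nat p dvd (pcompose g (Polynomial.monom 1 p) - g ^ p)"
proof (induction g)
  case 0
  then show ?case using prime_gt_0_nat[OF p] by (simp add: power_0_left)
next
  case (pCons a g)
  let ?X = "Polynomial.monom (1::int) p" and ?P = "of_nat p :: int poly"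
  have eq: "pCons a g = [:a:] + [:0, 1:] * g" by simp
  have "[:0, 1::int:] ^ p = ?X" by (simp add: monom_altdef)
  then have X: "([:0, 1:] * g) ^ p = ?X * g ^ p" by (simp only: power_mult_distrib)
  have 1: "?P dvd (pCons a g ^ p - ([:a:] ^ p + ?X * g ^ p))"
    using freshman_dream[OF p, of "[:a:]" "[:0, 1:] * g"] by (simp only: X eq[symmetric])
  have "[a ^ p = a] (mod int p)"
  proof (cases "int p dvd a")
    case True
    then have "int p dvd a ^ p" using prime_gt_0_nat[OF p] dvd_trans[OF True dvd_power] by auto
    then show ?thesis using True by (simp add: cong_iff_dvd_diff)
  next
    case False
    define b where "b = nat (a mod int p)"
    have b: "int b = a mod int p" using prime_gt_0_nat[OF p] by (simp add: b_def)
    have "\<not> int p dvd int b" unfolding b using False by (simp add: dvd_mod_iff)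
    then have "\<not> p dvd b" by simp
    then have "[b ^ (p - 1) = 1] (mod p)" by (rule fermat_theorem[OF p])
    then have "[b ^ (p - 1) * b = 1 * b] (mod p)" by (intro cong_mult cong_refl)
    moreover have "b ^ (p - 1) * b = b ^ p" by (rule power_minus_mult[OF prime_gt_0_nat[OF p]])
    ultimately have "[b ^ p = b] (mod p)" by simp
    then have "[int (b ^ p) = int b] (mod int p)" by (simp only: cong_int_iff)
    then have 3: "[int b ^ p = int b] (mod int p)" by simp
    have 4: "[a = int b] (mod int p)" unfolding b by (simp add: unique_euclidean_semiring_class.cong_def)
    show ?thesis by (rule cong_trans[OF cong_trans[OF cong_pow[OF 4] 3] cong_sym[OF 4]])
  qed
  from cong_sym[OF this] have "int p dvd a - a ^ p" by (simp only: cong_iff_dvd_diff)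
  then obtain e where "a - a ^ p = int p * e" by (elim dvdE)
  then have "[:a:] - [:a:] ^ p = ?P * [:e:]" by (simp add: poly_const_pow of_nat_poly)
  then have 2: "?P dvd ([:a:] - [:a:] ^ p)" by (rule dvdI)
  have "pcompose (pCons a g) ?X - pCons a g ^ p =
      ([:a:] - [:a:] ^ p) + ?X * (pcompose g ?X - g ^ p) - (pCons a g ^ p - ([:a:] ^ p + ?X * g ^ p))"
    by (simp add: pcompose_pCons algebra_simps)
  also have "?P dvd \<dots>"
    by (intro dvd_diff dvd_add 1 2 dvd_mult pCons.IH)
  finally show ?case .
qed

text \<open>No coefficient has to be inverted, so integer polynomials have integer remainders.
  Integrality is essential for the divisibility argument about these remainders.\<close>

lemma monic_division:
  fixes g q :: "'a::comm_ring_1 poly"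
  assumes g: "lead_coeff g = 1"
  shows "\<exists>s r. q = g * s + r \<and> (r = 0 \<or> Polynomial.degree r < Polynomial.degree g)"
proof (induction "if q = 0 then 0 else Suc (Polynomial.degree q)" arbitrary: q rule: less_induct)
  case less
  show ?case
  proof (cases "q = 0 \<or> Polynomial.degree q < Polynomial.degree g")
    case True
    then show ?thesis by (intro exI[of _ 0] exI[of _ q]) auto
  next
    case False
    let ?m = "Polynomial.monom (lead_coeff q) (Polynomial.degree q - Polynomial.degree g)"
    let ?q = "q - g * ?m"
    have "Polynomial.degree (g * ?m) \<le> Polynomial.degree g + (Polynomial.degree q - Polynomial.degree g)"
      by (rule order_trans[OF degree_mult_le]) (simp add: degree_monom_le)
    then have "Polynomial.degree (g * ?m) \<le> Polynomial.degree q" using False by simp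
    then have "Polynomial.degree ?q \<le> Polynomial.degree q" by (intro degree_diff_le) auto
    moreover have "poly.coeff ?q (Polynomial.degree q) = 0"
      using g False by (simp add: mult.commute[of g] coeff_monom_mult)
    ultimately have "?q = 0 \<or> Polynomial.degree ?q < Polynomial.degree q"
      by (metis leading_coeff_0_iff nless_le)
    then have "(if ?q = 0 then 0 else Suc (Polynomial.degree ?q)) < (if q = 0 then 0 else Suc (Polynomial.degree q))"
      using False by auto
    from less.hyps[OF this] obtain s r where sr: "?q = g * s + r" "r = 0 \<or> Polynomial.degree r < Polynomial.degree g" by blast
    then have "q = g * (s + ?m) + r" by (simp add: algebra_simps)
    then show ?thesis using sr(2) by blast
  qed
qed

definition ev :: "int poly \<Rightarrow> 'a::field \<Rightarrow> 'a" where
  "ev q x = poly (map_poly of_int q) x"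

lemma ev_simps:
  fixes x :: "'a::field"
  shows "ev 0 x = 0" "ev (pCons a q) x = of_int a + x * ev q x"
    "ev (p + q) x = ev p x + ev q x" "ev (p - q) x = ev p x - ev q x"
    "ev (Polynomial.smult a q) x = of_int a * ev q x" "ev (p * q) x = ev p x * ev q x"
    "ev 1 x = 1" "ev (p ^ n) x = ev p x ^ n" "ev (Polynomial.monom 1 n) x = x ^ n"
proof -
  show 0: "ev 0 x = 0" and pc: "\<And>a q. ev (pCons a q) x = of_int a + x * ev q x"
    by (simp_all add: ev_def map_poly_pCons)
  have "map_poly (of_int :: int \<Rightarrow> 'a) (p + q) = map_poly of_int p + map_poly of_int q"
    "map_poly (of_int :: int \<Rightarrow> 'a) (p - q) = map_poly of_int p - map_poly of_int q"
    "map_poly (of_int :: int \<Rightarrow> 'a) (Polynomial.smult a q) = Polynomial.smult (of_int a) (map_poly of_int q)" for p q a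
    by (simp_all add: poly_eq_iff coeff_map_poly)
  then show add: "\<And>p q. ev (p + q) x = ev p x + ev q x" and "ev (p - q) x = ev p x - ev q x"
    and sm: "\<And>a q. ev (Polynomial.smult a q) x = of_int a * ev q x"
    by (simp_all add: ev_def)
  show mult: "ev (p * q) x = ev p x * ev q x" for p q
    by (induction p) (simp_all add: 0 pc add sm algebra_simps)
  show 1: "ev 1 x = 1" by (simp add: ev_def map_poly_pCons one_pCons)
  show "ev (p ^ n) x = ev p x ^ n" by (induction n) (simp_all add: 1 mult)
  show "ev (Polynomial.monom 1 n) x = x ^ n" by (simp add: ev_def map_poly_monom poly_monom)
qed

lemma ev_of_nat: "ev (of_nat n) x = of_nat n"
  by (induction n) (simp_all add: ev_simps)

lemma ev_pcompose: "ev (pcompose q r) x = ev q (ev r x)"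
  by (induction q) (simp_all add: pcompose_pCons ev_simps)

context
  fixes d :: nat and \<xi> :: "'a::field"
  assumes d0: "d > 0" and \<xi>: "primitive_root_of_unity d \<xi>"
    and char0: "\<And>n. of_int n = (0::'a) \<Longrightarrow> n = 0"
begin

text \<open>Gauss's lemma: the primitive polynomial of least degree killing \<open>\<xi>\<close>
  divides an integer multiple of \<open>X^d - 1\<close> over the integers. Comparing contents, then
  leading coefficients, shows that its own leading coefficient is a unit.\<close>

lemma monic_minimal_int_poly:
  obtains g :: "int poly" where "lead_coeff g = 1" "ev g \<xi> = 0"
    "\<And>r. ev r \<xi> = 0 \<Longrightarrow> r = 0 \<or> Polynomial.degree r < Polynomial.degree g \<Longrightarrow> r = 0"
proof -
  define U where "U = Polynomial.monom 1 d - (1 :: int poly)"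
  have lU: "lead_coeff U = 1"
  proof -
    have "Polynomial.degree U = Polynomial.degree (Polynomial.monom (1::int) d)"
      unfolding U_def diff_conv_add_uminus
      by (rule degree_add_eq_left) (use d0 in \<open>simp add: degree_monom_eq\<close>)
    then show ?thesis using d0 by (simp add: U_def degree_monom_eq)
  qed
  have U0: "ev U \<xi> = 0"
    using \<xi> by (simp add: U_def ev_simps primitive_root_of_unity_def)
  define Q where "Q n \<longleftrightarrow> (\<exists>g. g \<noteq> 0 \<and> ev g \<xi> = 0 \<and> Polynomial.degree g = n)" for n
  have "U \<noteq> 0" using lU by auto
  then have "Q (Polynomial.degree U)" using U0 by (auto simp: Q_def)
  then have "Q (LEAST n. Q n)" by (rule LeastI)
  then obtain g0 where g0: "g0 \<noteq> 0" "ev g0 \<xi> = 0" "Polynomial.degree g0 = (LEAST n. Q n)" by (auto simp: Q_def)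
  have min: "r = 0" if "ev r \<xi> = 0" "r = 0 \<or> Polynomial.degree r < (LEAST n. Q n)" for r
    using that not_less_Least[of "Polynomial.degree r" Q] by (auto simp: Q_def)
  define g where "g = primitive_part g0"
  have g0g: "g0 = Polynomial.smult (content g0) g" by (simp add: g_def)
  have cg: "content g = 1" using g0(1) by (simp add: g_def)
  have c0: "content g0 \<noteq> 0" using g0(1) by simp
  have "ev g0 \<xi> = of_int (content g0) * ev g \<xi>" by (subst g0g) (simp only: ev_simps)
  moreover have "(of_int (content g0) :: 'a) \<noteq> 0" using char0[of "content g0"] c0 by blast
  ultimately have evg: "ev g \<xi> = 0" using g0(2) by simp
  have dg: "Polynomial.degree g = (LEAST n. Q n)" using g0(3) by (simp add: g_def)
  have gne: "g \<noteq> 0" using g0(1) by (simp add: g_def)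
  obtain a q where aq: "a \<noteq> 0" "Polynomial.smult a U = g * q + pseudo_mod U g"
    using pseudo_mod(1)[OF gne, of U] by blast
  have "ev (Polynomial.smult a U) \<xi> = ev (g * q + pseudo_mod U g) \<xi>" by (rule arg_cong[OF aq(2)])
  then have "ev (pseudo_mod U g) \<xi> = 0" by (simp add: ev_simps U0 evg)
  then have "pseudo_mod U g = 0" using pseudo_mod(2)[OF gne, of U] dg by (intro min) auto
  then have aU: "Polynomial.smult a U = g * q" using aq(2) by simp
  have "content U dvd lead_coeff U" by (rule content_dvd_coeff)
  then have "is_unit (content U)" by (simp only: lU)
  then have cU: "content U = 1" by (simp only: is_unit_content_iff)
  then have "\<bar>a\<bar> = content q" using arg_cong[OF aU, of content] by (simp add: content_mult cg cU)
  then have qa: "q = Polynomial.smult \<bar>a\<bar> (primitive_part q)" using content_times_primitive_part[of q] by simp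
  have "lead_coeff (Polynomial.smult a U) = lead_coeff g * lead_coeff q" unfolding aU by (rule lead_coeff_mult)
  moreover have "lead_coeff q = \<bar>a\<bar> * lead_coeff (primitive_part q)" 
    using arg_cong[OF qa, of "\<lambda>p. lead_coeff p"] by (simp only: lead_coeff_smult)
  ultimately have "a = \<bar>a\<bar> * (lead_coeff g * lead_coeff (primitive_part q))" 
    using lU by (simp only: lead_coeff_smult mult_1_right mult.left_commute[of "lead_coeff g"])
  from arg_cong[OF this, of abs]
  have "\<bar>a\<bar> = \<bar>a\<bar> * \<bar>lead_coeff g * lead_coeff (primitive_part q)\<bar>"
    by (simp only: abs_mult abs_idempotent)
  then have "\<bar>lead_coeff g * lead_coeff (primitive_part q)\<bar> = 1" using aq(1) by simp
  then have lg: "lead_coeff g = 1 \<or> lead_coeff g = -1"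
    by (auto simp: abs_mult zmult_eq_1_iff)
  show ?thesis
  proof (rule that[of "Polynomial.smult (lead_coeff g) g"])
    show "lead_coeff (Polynomial.smult (lead_coeff g) g) = 1" using lg by (auto simp: lead_coeff_smult)
    show "ev (Polynomial.smult (lead_coeff g) g) \<xi> = 0" by (simp add: ev_simps evg)
    show "r = 0" if "ev r \<xi> = 0" "r = 0 \<or> Polynomial.degree r < Polynomial.degree (Polynomial.smult (lead_coeff g) g)" for r
    proof (rule min[OF that(1)])
      have "lead_coeff g \<noteq> 0" using lg by auto
      then show "r = 0 \<or> Polynomial.degree r < (LEAST n. Q n)" using that(2) dg by (simp add: degree_smult_eq)
    qed
  qed
qed

text \<open>Landau's proof: the residues of \<open>g(X\<^sup>k)\<close> modulo the minimal polynomial \<open>g\<close> take only finitely many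
  values, so their coefficients are bounded, while for a prime \<open>p\<close> they are divisible by \<open>p\<close>.\<close>

definition conjugate_power :: "nat \<Rightarrow> bool" where
  "conjugate_power n \<longleftrightarrow> (\<forall>q. ev q \<xi> = 0 \<longrightarrow> ev q (\<xi> ^ n) = 0)"

text \<open>Substituting \<open>X^m\<close> turns vanishing at \<open>\<xi>^m\<close> into vanishing
  at \<open>\<xi>\<close>, to which the second assumption applies.\<close>

lemma conjugate_power_mult:
  assumes "conjugate_power m" "conjugate_power n"
  shows "conjugate_power (m * n)"
  unfolding conjugate_power_def
proof (intro allI impI)
  fix q assume "ev q \<xi> = 0"
  then have "ev q (\<xi> ^ m) = 0" using assms(1) by (simp add: conjugate_power_def)
  then have "ev (pcompose q (Polynomial.monom 1 m)) \<xi> = 0" by (simp add: ev_pcompose ev_simps)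
  then have "ev (pcompose q (Polynomial.monom 1 m)) (\<xi> ^ n) = 0" using assms(2) by (simp add: conjugate_power_def)
  then show "ev q (\<xi> ^ (m * n)) = 0" by (simp add: ev_pcompose ev_simps mult.commute flip: power_mult)
qed

lemma conjugate_large_primes: "\<exists>M. \<forall>p. prime p \<longrightarrow> p > M \<longrightarrow> conjugate_power p"
proof -
  obtain g where g: "lead_coeff g = 1" "ev g \<xi> = 0"
    "\<And>r. ev r \<xi> = 0 \<Longrightarrow> r = 0 \<or> Polynomial.degree r < Polynomial.degree g \<Longrightarrow> r = 0"
    using monic_minimal_int_poly by blast
  have "\<exists>r. (r = 0 \<or> Polynomial.degree r < Polynomial.degree g) \<and> ev r \<xi> = ev g (\<xi> ^ k)" for k
  proof -
    obtain s r where sr: "pcompose g (Polynomial.monom 1 k) = g * s + r" "r = 0 \<or> Polynomial.degree r < Polynomial.degree g"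
      using monic_division[OF g(1)] by blast
    have "ev (pcompose g (Polynomial.monom 1 k)) \<xi> = ev (g * s + r) \<xi>" by (rule arg_cong[OF sr(1)])
    then have "ev r \<xi> = ev g (\<xi> ^ k)" by (simp add: ev_pcompose ev_simps g(2))
    then show ?thesis using sr(2) by blast
  qed
  \<comment> \<open>\<open>R k\<close> plays the remainder of \<open>g(X^k)\<close> modulo
    \<open>g\<close>. It depends only on \<open>k\<close> modulo \<open>d\<close>, because its value
    at \<open>\<xi>\<close> does and determines it.\<close>
  then obtain R where R: "\<And>k. R k = 0 \<or> Polynomial.degree (R k) < Polynomial.degree g" "\<And>k. ev (R k) \<xi> = ev g (\<xi> ^ k)"
    by metis
  have uniq: "u = v" if "u = 0 \<or> Polynomial.degree u < Polynomial.degree g" "v = 0 \<or> Polynomial.degree v < Polynomial.degree g"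
    "ev u \<xi> = ev v \<xi>" for u v
  proof -
    have "u - v = 0 \<or> Polynomial.degree (u - v) < Polynomial.degree g"
      using that(1,2) degree_diff_less[of u "Polynomial.degree g" v] by auto
    then have "u - v = 0" using g(3)[of "u - v"] that(3) by (simp add: ev_simps)
    then show ?thesis by simp
  qed
  have periodic: "R k = R (k mod d)" for k
  proof (rule uniq[OF R(1) R(1)])
    have "\<xi> ^ k = \<xi> ^ (k mod d)" using prim_root_pow_eq_iff[OF \<xi> d0] by simp
    then show "ev (R k) \<xi> = ev (R (k mod d)) \<xi>" by (simp only: R(2))
  qed
  define M where "M = Max ((\<lambda>(k, i). nat \<bar>poly.coeff (R k) i\<bar>) ` ({..<d} \<times> {..Polynomial.degree g}))"
  have bound: "nat \<bar>poly.coeff (R k) i\<bar> \<le> M" for k i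
  proof (cases "i \<le> Polynomial.degree g")
    case True
    have "nat \<bar>poly.coeff (R (k mod d)) i\<bar> \<le> M"
      unfolding M_def
    proof (rule Max_ge)
      show "nat \<bar>poly.coeff (R (k mod d)) i\<bar> \<in> (\<lambda>(k, i). nat \<bar>poly.coeff (R k) i\<bar>) ` ({..<d} \<times> {..Polynomial.degree g})"
        using True d0 by (intro image_eqI[where x = "(k mod d, i)"]) auto
    qed simp
    then show ?thesis by (simp only: periodic[of k])
  next
    case False
    then have "poly.coeff (R k) i = 0" using R(1)[of k] by (auto intro: coeff_eq_0)
    then show ?thesis by simp
  qed
  have "conjugate_power p" if p: "prime p" "p > M" for p
  proof -
    \<comment> \<open>As \<open>g^p\<close> vanishes at \<open>\<xi>\<close>, the value
      \<open>g(\<xi>^p)\<close> is \<open>p\<close> times an integer polynomial in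
      \<open>\<xi>\<close>; hence \<open>R p\<close> is \<open>p\<close> times another remainder,
      and its coefficients, bounded by \<open>M < p\<close>, must be 0.\<close>
    obtain w where w: "pcompose g (Polynomial.monom 1 p) - g ^ p = of_nat p * w"
      using int_poly_frobenius[OF p(1), of g] by (elim dvdE)
    obtain s r where sr: "w = g * s + r" "r = 0 \<or> Polynomial.degree r < Polynomial.degree g"
      using monic_division[OF g(1)] by blast
    have p0: "p > 0" by (rule prime_gt_0_nat[OF p(1)])
    have "ev (pcompose g (Polynomial.monom 1 p) - g ^ p) \<xi> = ev (of_nat p * w) \<xi>" by (rule arg_cong[OF w])
    then have "ev g (\<xi> ^ p) = of_nat p * ev r \<xi>"
      using p0 by (simp add: ev_simps ev_pcompose ev_of_nat g(2) sr(1) power_0_left)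
    then have "ev (R p) \<xi> = ev (Polynomial.smult (int p) r) \<xi>" by (simp add: R(2) ev_simps)
    moreover have "Polynomial.smult (int p) r = 0 \<or> Polynomial.degree (Polynomial.smult (int p) r) < Polynomial.degree g"
      using sr(2) p0 by auto
    ultimately have Rp: "R p = Polynomial.smult (int p) r" by (intro uniq[OF R(1)])
    have "poly.coeff (R p) i = 0" for i
    proof (rule ccontr)
      assume nz: "poly.coeff (R p) i \<noteq> 0"
      have "int p dvd poly.coeff (R p) i" unfolding Rp by simp
      then have "int p \<le> \<bar>poly.coeff (R p) i\<bar>" using nz by (intro zdvd_imp_le) auto
      then show False using bound[of p i] p(2) by linarith
    qed
    then have "R p = 0" by (simp add: poly_eq_iff)
    then have gp: "ev g (\<xi> ^ p) = 0" using R(2)[of p] by (simp add: ev_simps)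
    show "conjugate_power p"
      unfolding conjugate_power_def
    proof (intro allI impI)
      fix q assume q: "ev q \<xi> = 0"
      obtain s r where sr: "q = g * s + r" "r = 0 \<or> Polynomial.degree r < Polynomial.degree g"
        using monic_division[OF g(1)] by blast
      have "ev r \<xi> = 0" using q by (simp add: sr(1) ev_simps g(2))
      then have "r = 0" by (rule g(3)[OF _ sr(2)])
      then show "ev q (\<xi> ^ p) = 0" by (simp add: sr(1) ev_simps gp)
    qed
  qed
  then show ?thesis by blast
qed

text \<open>Only \<open>a\<close> modulo \<open>d\<close> matters, so it may be replaced by some
  \<open>n = a + d P\<close> without prime factors up to \<open>M\<close>. With \<open>P\<close> the
  product of the primes up to \<open>M\<close> not dividing \<open>a\<close>, each prime up to
  \<open>M\<close> divides exactly one of \<open>a\<close> and \<open>d P\<close>. Dirichlet's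
  theorem on primes in progressions is thereby avoided.\<close>

lemma conjugate_coprime:
  assumes a: "coprime a d"
  shows "conjugate_power a"
proof -
  from conjugate_large_primes obtain M where M: "\<forall>p. prime p \<longrightarrow> p > M \<longrightarrow> conjugate_power p" by (elim exE)
  have smooth: "conjugate_power n" if "n > 0" "\<And>p. prime p \<Longrightarrow> p dvd n \<Longrightarrow> p > M" for n
    using that
  proof (induction n rule: prime_divisors_induct)
    case (unit n)
    then show ?case by (simp add: conjugate_power_def)
  next
    case (factor p n)
    have "conjugate_power p" using M factor.hyps factor.prems(2)[of p] by simp
    moreover have "conjugate_power n"
      using factor.prems by (intro factor.IH) auto
    ultimately show ?case by (rule conjugate_power_mult)
  qed simp
  define P where "P = \<Prod>{q. prime q \<and> q \<le> M \<and> \<not> q dvd a}"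
  have fin: "finite {q. prime q \<and> q \<le> M \<and> \<not> q dvd a}" by (rule finite_subset[of _ "{..M}"]) auto
  define n where "n = a + d * P"
  have "P > 0" unfolding P_def by (intro prod_pos) (auto intro: prime_gt_0_nat)
  then have n0: "n > 0" using d0 by (simp add: n_def)
  have big: "p > M" if p: "prime p" "p dvd n" for p
  proof (rule ccontr)
    assume pM: "\<not> p > M"
    show False
    proof (cases "p dvd a")
      case True
      then have "p dvd d * P" using p(2) unfolding n_def by (simp add: dvd_add_right_iff)
      moreover have "\<not> p dvd d"
        using coprime_common_divisor[OF a True] p(1) not_prime_unit by blast
      ultimately have "p dvd P" using p(1) prime_dvd_mult_iff by blast
      then obtain q where q: "prime q" "\<not> q dvd a" "p dvd q"
        unfolding P_def prime_dvd_prod_iff[OF fin p(1)] by blast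
      then have "p = q" using primes_dvd_imp_eq[OF p(1)] by blast
      then show False using q True by simp
    next
      case False
      have "p dvd P" unfolding P_def by (rule dvd_prodI[OF fin, of p id, simplified]) (use p(1) pM False in auto)
      then have "p dvd d * P" by simp
      then have "p dvd a" using p(2) unfolding n_def by (simp add: dvd_add_left_iff)
      then show False using False by simp
    qed
  qed
  have "conjugate_power n" by (rule smooth[OF n0 big])
  moreover have "\<xi> ^ n = \<xi> ^ a" using prim_root_pow_eq_iff[OF \<xi> d0, of n a] by (simp add: n_def)
  ultimately show ?thesis by (simp add: conjugate_power_def)
qed

end

section \<open>The arboreal Galois group\<close>

lemma sfield_chain_Union:
  assumes "\<And>n::nat. sfield (F n)" "\<And>m n. m \<le> n \<Longrightarrow> F m \<subseteq> F n"
  shows "sfield (\<Union>n. F n)"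
  unfolding sfield_def
proof (intro conjI ballI)
  show "0 \<in> (\<Union>n. F n)" "1 \<in> (\<Union>n. F n)" using sfieldD(1,2)[OF assms(1)] by auto
  fix x assume "x \<in> (\<Union>n. F n)"
  then obtain m where x: "x \<in> F m" by blast
  show "- x \<in> (\<Union>n. F n)" "inverse x \<in> (\<Union>n. F n)"
    using sfieldD(5,6)[OF assms(1) x] by auto
  fix y assume "y \<in> (\<Union>n. F n)"
  then obtain n where y: "y \<in> F n" by blast
  have xy: "x \<in> F (max m n)" "y \<in> F (max m n)"
    using x y assms(2)[of m "max m n"] assms(2)[of n "max m n"] by auto
  show "x + y \<in> (\<Union>n. F n)" "x * y \<in> (\<Union>n. F n)"
    using sfieldD(3,4)[OF assms(1) xy] by auto
qed

lemma Gal_iff: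
  assumes M: "sfield M"
  shows "\<sigma> \<in> Gal M F \<longleftrightarrow> \<sigma> \<in> extensional M \<and> hom_on M \<sigma> \<and> \<sigma> ` M = M \<and> (\<forall>x\<in>F. \<sigma> x = x)"
proof -
  have "\<sigma> \<in> ring_iso (ring_of_type_algebra\<lparr>carrier := M\<rparr>) (ring_of_type_algebra\<lparr>carrier := M\<rparr>) \<longleftrightarrow>
      hom_on M \<sigma> \<and> \<sigma> ` M = M"
  proof
    assume "\<sigma> \<in> ring_iso (ring_of_type_algebra\<lparr>carrier := M\<rparr>) (ring_of_type_algebra\<lparr>carrier := M\<rparr>)"
    then show "hom_on M \<sigma> \<and> \<sigma> ` M = M"
      by (simp add: ring_iso_def ring_hom_def hom_on_def bij_betw_def)
  next
    assume h: "hom_on M \<sigma> \<and> \<sigma> ` M = M"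
    then have "inj_on \<sigma> M" using hom_on_inj[OF M] by blast
    then show "\<sigma> \<in> ring_iso (ring_of_type_algebra\<lparr>carrier := M\<rparr>) (ring_of_type_algebra\<lparr>carrier := M\<rparr>)"
      using h by (auto simp: ring_iso_def ring_hom_def hom_on_def bij_betw_def)
  qed
  then show ?thesis by (auto simp: Gal_def)
qed

lemma Units_residue_ring:
  assumes "d \<ge> 2"
  shows "Units (residue_ring (int d)) = {x. 0 < x \<and> x < int d \<and> coprime x (int d)}"
proof -
  interpret residues "int d" "residue_ring (int d)"
    using assms by (simp add: residues_def)
  show ?thesis by (rule res_units_eq)
qed

lemma unicritical_eq: "poly (unicritical d c) = unit_map d c"
  by (rule ext) (simp add: poly_monom)

lemma tree_closed_short_words: "tree_closed d (short_words d n)"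
  by (auto simp: tree_closed_def short_words_def)

lemma short_words_mono: "m \<le> n \<Longrightarrow> short_words d m \<subseteq> short_words d n"
  by (auto simp: short_words_def)

context unicritical_tower
begin

abbreviation K\<xi> :: "'a set" where "K\<xi> \<equiv> adjoin K {\<xi>}"

lemma K\<xi>: "sfield K\<xi>" "K \<subseteq> K\<xi>" "\<xi> \<in> K\<xi>"
  using sfield_adjoin adjoin_incl[where K=K and S="{\<xi>}"] by blast+

lemma \<xi>_pow_eq_iff: "\<xi> ^ i = \<xi> ^ j \<longleftrightarrow> [i = j] (mod d)"
  using prim_root_pow_eq_iff[OF \<xi> d0] by (simp add: unique_euclidean_semiring_class.cong_def)

text \<open>A homomorphism fixing \<open>K\<close> and sending \<open>\<xi>\<close> to
  \<open>\<xi>^a\<close> is automatically onto, as \<open>\<xi>\<close> is the image of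
  \<open>\<xi>^j\<close> with \<open>a j \<equiv> 1\<close>. Membership thus reduces to the
  existence of a homomorphism.\<close>

lemma cyclotomic_image_iff:
  "a \<in> cyclotomic_image d K \<xi> \<longleftrightarrow> 0 < a \<and> a < int d \<and> coprime a (int d) \<and>
     (\<exists>\<tau>. hom_on K\<xi> \<tau> \<and> (\<forall>x\<in>K. \<tau> x = x) \<and> \<tau> \<xi> = \<xi> ^ nat a)"
proof -
  have "(\<exists>\<sigma>\<in>Gal K\<xi> K. \<sigma> \<xi> = \<xi> ^ nat a) \<longleftrightarrow> (\<exists>\<tau>. hom_on K\<xi> \<tau> \<and> (\<forall>x\<in>K. \<tau> x = x) \<and> \<tau> \<xi> = \<xi> ^ nat a)"
    if a: "0 < a" "a < int d" "coprime a (int d)"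
  proof
    assume "\<exists>\<tau>. hom_on K\<xi> \<tau> \<and> (\<forall>x\<in>K. \<tau> x = x) \<and> \<tau> \<xi> = \<xi> ^ nat a"
    then obtain \<tau> where \<tau>: "hom_on K\<xi> \<tau>" "\<forall>x\<in>K. \<tau> x = x" "\<tau> \<xi> = \<xi> ^ nat a" by blast
    have into: "\<tau> x \<in> K\<xi>" if "x \<in> K\<xi>" for x
    proof (rule hom_on_image_adjoin[OF \<tau>(1) K\<xi>(1) _ that])
      fix y assume "y \<in> K \<union> {\<xi>}"
      then show "\<tau> y \<in> K\<xi>" using \<tau>(2,3) K\<xi>(2) sfieldD(9)[OF K\<xi>(1,3)] by auto
    qed
    have "coprime (nat a) d" using a by (metis coprime_int_iff int_nat_eq less_imp_le)
    from cong_solve_coprime_nat[OF this] obtain j where j: "[nat a * j = Suc 0] (mod d)" by blast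
    have "\<tau> (\<xi> ^ j) = \<xi> ^ (nat a * j)"
      using hom_onD(9)[OF K\<xi>(1) \<tau>(1) K\<xi>(3)] \<tau>(3) by (simp add: power_mult)
    also have "\<dots> = \<xi> ^ 1" unfolding \<xi>_pow_eq_iff using j by simp
    finally have "\<xi> \<in> \<tau> ` K\<xi>" using sfieldD(9)[OF K\<xi>(1,3)] by (metis image_eqI power_one_right)
    moreover have "K \<subseteq> \<tau> ` K\<xi>"
    proof
      fix x assume "x \<in> K"
      then show "x \<in> \<tau> ` K\<xi>" using \<tau>(2) K\<xi>(2) by (intro image_eqI[where x = x]) auto
    qed
    ultimately have "K\<xi> \<subseteq> \<tau> ` K\<xi>"
      by (intro adjoin_least sfield_hom_image K\<xi>(1) \<tau>(1)) simp_all
    then have im: "\<tau> ` K\<xi> = K\<xi>" using into by blast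
    have "restrict \<tau> K\<xi> \<in> Gal K\<xi> K"
      unfolding Gal_iff[OF K\<xi>(1)]
    proof (intro conjI ballI)
      show "hom_on K\<xi> (restrict \<tau> K\<xi>)"
        using \<tau>(1) sfieldD(2-4)[OF K\<xi>(1)] unfolding hom_on_def by simp
      show "restrict \<tau> K\<xi> ` K\<xi> = K\<xi>" using im by simp
      show "restrict \<tau> K\<xi> x = x" if "x \<in> K" for x using \<tau>(2) K\<xi>(2) that by auto
    qed simp
    then show "\<exists>\<sigma>\<in>Gal K\<xi> K. \<sigma> \<xi> = \<xi> ^ nat a"
      by (rule bexI[rotated]) (use \<tau>(3) K\<xi>(3) in simp)
  next
    assume "\<exists>\<sigma>\<in>Gal K\<xi> K. \<sigma> \<xi> = \<xi> ^ nat a"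
    then obtain \<sigma> where "\<sigma> \<in> Gal K\<xi> K" "\<sigma> \<xi> = \<xi> ^ nat a" by (rule bexE)
    then show "\<exists>\<tau>. hom_on K\<xi> \<tau> \<and> (\<forall>x\<in>K. \<tau> x = x) \<and> \<tau> \<xi> = \<xi> ^ nat a"
      unfolding Gal_iff[OF K\<xi>(1)] by (intro exI[of _ \<sigma>] conjI) simp_all
  qed
  then show ?thesis unfolding cyclotomic_image_def Units_residue_ring[OF d2] by blast
qed

abbreviation I :: "int set" where "I \<equiv> cyclotomic_image d K \<xi>"

lemma unit_group: "unit_group_mod d I"
proof
  show "2 \<le> d" by (rule d2)
  show "I \<subseteq> {0..<int d}" by (auto simp: cyclotomic_image_iff)
  show "coprime a (int d)" if "a \<in> I" for a using that by (simp add: cyclotomic_image_iff)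
  have "hom_on K\<xi> (\<lambda>x. x) \<and> (\<forall>x\<in>K. x = x) \<and> \<xi> = \<xi> ^ nat 1" by (simp add: hom_on_def)
  then show "1 \<in> I" unfolding cyclotomic_image_iff using d2 by auto
  fix a b assume a: "a \<in> I" and b: "b \<in> I"
  obtain \<sigma> where \<sigma>: "hom_on K\<xi> \<sigma>" "\<forall>x\<in>K. \<sigma> x = x" "\<sigma> \<xi> = \<xi> ^ nat a" using a by (auto simp: cyclotomic_image_iff)
  obtain \<tau> where \<tau>: "hom_on K\<xi> \<tau>" "\<forall>x\<in>K. \<tau> x = x" "\<tau> \<xi> = \<xi> ^ nat b" using b by (auto simp: cyclotomic_image_iff)
  have into: "\<tau> x \<in> K\<xi>" if "x \<in> K\<xi>" for x
  proof (rule hom_on_image_adjoin[OF \<tau>(1) K\<xi>(1) _ that])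
    fix y assume "y \<in> K \<union> {\<xi>}"
    then show "\<tau> y \<in> K\<xi>" using \<tau>(2,3) K\<xi>(2) sfieldD(9)[OF K\<xi>(1,3)] by auto
  qed
  have "hom_on K\<xi> (\<sigma> \<circ> \<tau>)" using \<sigma>(1) \<tau>(1) into unfolding hom_on_def by simp
  moreover have "\<forall>x\<in>K. (\<sigma> \<circ> \<tau>) x = x" using \<sigma>(2) \<tau>(2) by simp
  moreover have "(\<sigma> \<circ> \<tau>) \<xi> = \<xi> ^ nat (a * b mod int d)"
  proof -
    have "(\<sigma> \<circ> \<tau>) \<xi> = \<xi> ^ (nat a * nat b)"
      using \<tau>(3) \<sigma>(3) hom_onD(9)[OF K\<xi>(1) \<sigma>(1) K\<xi>(3)] by (simp add: power_mult)
    also have "\<dots> = \<xi> ^ nat (a * b mod int d)"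
      unfolding \<xi>_pow_eq_iff using a b
      by (simp add: unique_euclidean_semiring_class.cong_def cyclotomic_image_iff nat_mult_distrib nat_mod_distrib)
    finally show ?thesis .
  qed
  moreover have cop: "coprime (a * b mod int d) (int d)"
    using a b by (simp add: cyclotomic_image_iff coprime_mod_left_iff)
  moreover have "0 < a * b mod int d"
  proof -
    have "a * b mod int d \<noteq> 0"
    proof
      assume z: "a * b mod int d = 0"
      show False using cop d2 unfolding z by simp
    qed
    moreover have "0 \<le> a * b mod int d" using d0 by simp
    ultimately show ?thesis by linarith
  qed
  ultimately show "a * b mod int d \<in> I"
    unfolding cyclotomic_image_iff using d0 by (intro conjI exI[of _ "\<sigma> \<circ> \<tau>"]) simp_all
qed

lemma \<alpha>_d: "w \<in> words d \<Longrightarrow> \<alpha> (w @ [d]) = \<beta> w"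
  by (simp add: \<beta>_def)

text \<open>On one level, the \<open>d\<close>-th power of a label determines the parent, and the
  power of \<open>\<xi>\<close> then determines the letter. Equal labels on different levels would
  make \<open>t\<close> periodic under \<open>x^d + c\<close>, an algebraic relation of degree at
  least \<open>d > 1\<close> over \<open>K\<close>.\<close>

lemma \<alpha>_inj: "v \<in> words d \<Longrightarrow> w \<in> words d \<Longrightarrow> \<alpha> v = \<alpha> w \<Longrightarrow> v = w"
proof -
  have same: "v = w" if "v \<in> words d" "w \<in> words d" "length v = length w" "\<alpha> v = \<alpha> w" for v w
    using that
  proof (induction v arbitrary: w rule: rev_induct)
    case Nil
    then show ?case by simp
  next
    case (snoc x v)
    then obtain u y where w: "w = u @ [y]" by (cases w rule: rev_cases) auto
    have vu: "v \<in> words d" "u \<in> words d" "x \<in> {1..d}" "y \<in> {1..d}" using snoc.prems w by auto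
    have "\<alpha> v - c = \<alpha> u - c"
      using \<alpha>_snoc_pow[OF vu(1,3)] \<alpha>_snoc_pow[OF vu(2,4)] snoc.prems(4) w by metis
    then have "v = u" using snoc.IH[OF vu(1,2)] snoc.prems(3) w by simp
    have "\<xi> ^ x * \<beta> v = \<xi> ^ y * \<beta> v"
      using \<alpha>_snoc[OF vu(1,3)] \<alpha>_snoc[OF vu(2,4)] snoc.prems(4) w \<open>v = u\<close> by metis
    then have "\<xi> ^ x = \<xi> ^ y" using \<beta>_nz[OF vu(1)] by simp
    then have "[int x = int y] (mod int d)" unfolding \<xi>_pow_eq_iff by (simp only: cong_int_iff)
    then have "x = y" by (rule residue_unique[OF vu(3,4)])
    then show ?case using w \<open>v = u\<close> by simp
  qed
  have len: "length v \<le> length w" if "v \<in> words d" "w \<in> words d" "\<alpha> v = \<alpha> w" for v w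
  proof (rule ccontr)
    assume "\<not> length v \<le> length w"
    then obtain k where k: "length v = length w + Suc k" using less_imp_Suc_add by force
    define f where "f = unit_map d c"
    have "t = (f ^^ (Suc k + length w)) (\<alpha> v)" using iterate_\<alpha>[OF that(1)] k by (simp add: f_def add.commute)
    also have "\<dots> = (f ^^ Suc k) ((f ^^ length w) (\<alpha> w))" using that(3) by (simp only: funpow_add o_apply)
    finally have fix_t: "(f ^^ Suc k) t = t" using iterate_\<alpha>[OF that(2)] by (simp add: f_def)
    define P where "P n = ((\<lambda>p. p ^ d + [:c:]) ^^ n) [:0, 1:]" for n
    have P: "poly (P n) t = (f ^^ n) t \<and> coeffs_in K (P n) \<and> Polynomial.degree (P n) = d ^ n" for n
    proof (induction n)
      case 0
      then show ?case using sfieldD(1,2)[OF K] coeffs_in_simps(1,10)[OF K] by (simp add: P_def coeffs_in_def coeff_pCons split: nat.split)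
    next
      case (Suc n)
      have P_Suc: "P (Suc n) = P n ^ d + [:c:]" by (simp add: P_def)
      have "Polynomial.degree (P n) > 0" using Suc d0 by simp
      then have "Polynomial.degree (P n ^ d) = d * d ^ n" using Suc by (subst degree_power_eq) auto
      moreover have "0 < d * d ^ n" using d0 by simp
      ultimately have "Polynomial.degree (P (Suc n)) = d ^ Suc n"
        unfolding P_Suc by (subst degree_add_eq_left) simp_all
      moreover have "coeffs_in K (P (Suc n))"
        unfolding P_Suc using Suc cK by (simp add: coeffs_in_simps[OF K] coeffs_in_power[OF K])
      moreover have "poly (P (Suc n)) t = (f ^^ Suc n) t" unfolding P_Suc using Suc by (simp add: f_def)
      ultimately show ?case by blast
    qed
    have cP: "coeffs_in K (P n)" for n using P by blast
    have "coeffs_in K (P (Suc k) - P 0)" by (rule coeffs_in_simps(4)[OF K cP cP])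
    then have "coeffs_in K (P (Suc k) - [:0, 1:])" by (simp add: P_def)
    moreover have "poly (P (Suc k) - [:0, 1:]) t = 0" using P[of "Suc k"] fix_t by simp
    ultimately have "P (Suc k) - [:0, 1:] = 0" by (rule K_trans)
    then have "P (Suc k) = [:0, 1:]" by (simp only: right_minus_eq)
    then have "Polynomial.degree (P (Suc k)) = 1" by simp
    moreover have "Polynomial.degree (P (Suc k)) = d ^ Suc k" using P by blast
    ultimately have "d ^ Suc k = 1" by (simp only:)
    then have "d = 1" by simp
    then show False using d2 by simp
  qed
  assume vw: "v \<in> words d" "w \<in> words d" "\<alpha> v = \<alpha> w"
  have "length v = length w" by (rule le_antisym[OF len[OF vw] len[OF vw(2,1) vw(3)[symmetric]]])
  then show "v = w" by (rule same[OF vw(1,2) _ vw(3)])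
qed

lemma inv_\<alpha>: "w \<in> words d \<Longrightarrow> inv_into (words d) \<alpha> (\<alpha> w) = w"
  by (rule inv_into_f_f) (auto simp: inj_on_def intro: \<alpha>_inj)

lemma d_th_root:
  assumes "w \<in> words d" "x ^ d = \<alpha> w - c"
  obtains y where "y \<in> {1..d}" "x = \<alpha> (w @ [y])"
proof -
  have "x ^ d = \<beta> w ^ d" using assms \<beta>_pow by simp
  then obtain i where i: "i < d" "x = \<xi> ^ i * \<beta> w"
    using root_of_unity_multiple[OF \<xi> d0 \<beta>_nz[OF assms(1)]] by blast
  show ?thesis
  \<comment> \<open>The exponent 0 is represented by the letter \<open>d\<close>.\<close>
  proof (cases "i = 0")
    case True
    then have "x = \<alpha> (w @ [d])" using i by (simp add: \<beta>_def)
    then show ?thesis using that[of d] d0 by simp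
  next
    case False
    then show ?thesis using that[of i] i \<alpha>_snoc[OF assms(1), of i] by simp
  qed
qed

lemma preimages_level: "preimages (unicritical d c) n t = \<alpha> ` level d n"
proof (induction n)
  case 0
  then show ?case by (simp add: preimages_def level_0 \<alpha>_Nil)
next
  case (Suc n)
  show ?case
  proof (intro equalityI subsetI)
    fix x assume "x \<in> preimages (unicritical d c) (Suc n) t"
    then have "x ^ d + c \<in> preimages (unicritical d c) n t"
      by (simp only: preimages_def unicritical_eq mem_Collect_eq funpow_Suc_right o_apply)
    then obtain w where w: "w \<in> level d n" "x ^ d + c = \<alpha> w" using Suc by blast
    have wd: "w \<in> words d" using w by (simp add: level_def)
    have "x ^ d = \<alpha> w - c" unfolding w(2)[symmetric] by simp
    then obtain y where "y \<in> {1..d}" "x = \<alpha> (w @ [y])" by (rule d_th_root[OF wd])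
    then show "x \<in> \<alpha> ` level d (Suc n)" using w wd by (auto simp: level_def)
  next
    fix x assume "x \<in> \<alpha> ` level d (Suc n)"
    then obtain w where "w \<in> words d" "length w = Suc n" "x = \<alpha> w" by (auto simp: level_def)
    then show "x \<in> preimages (unicritical d c) (Suc n) t"
      using iterate_\<alpha>[of w] unfolding preimages_def unicritical_eq by simp
  qed
qed

definition Kinf :: "'a set" where "Kinf = K_inf K (unicritical d c) t"

lemma Kinf_eq: "Kinf = adjoin K (\<alpha> ` words d)"
proof -
  have "(\<Union>n. preimages (unicritical d c) n t) = \<alpha> ` words d"
    unfolding preimages_level by (auto simp: level_def)
  then show ?thesis by (simp only: Kinf_def K_inf_def)
qed

lemma Kinf: "sfield Kinf" "K \<subseteq> Kinf" "w \<in> words d \<Longrightarrow> \<alpha> w \<in> Kinf" "t \<in> Kinf" "\<xi> \<in> Kinf"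
proof -
  show s: "sfield Kinf" unfolding Kinf_eq by (rule sfield_adjoin)
  show "K \<subseteq> Kinf" and al: "\<And>w. w \<in> words d \<Longrightarrow> \<alpha> w \<in> Kinf"
    unfolding Kinf_eq using adjoin_incl[where K=K and S="\<alpha> ` words d"] by blast+
  show "t \<in> Kinf" using al[of "[]"] by (simp add: \<alpha>_Nil)
  \<comment> \<open>\<open>\<xi>\<close> is obtained as a quotient of two preimages on the first
    level.\<close>
  have "\<alpha> [1] = \<xi> * \<beta> []" "\<alpha> [d] = \<beta> []" using \<alpha>_snoc[of "[]" 1] \<alpha>_d[of "[]"] d0 by simp_all
  then have "\<xi> = \<alpha> [1] / \<alpha> [d]" using \<beta>_nz[of "[]"] by simp
  then show "\<xi> \<in> Kinf" using sfieldD(8)[OF s al[of "[1]"] al[of "[d]"]] d0 by simp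
qed

text \<open>The stages adjoin \<open>\<beta>\<close> on finite sets closed under parents, where
  \<open>extend_hom\<close> applies.\<close>

lemma Kinf_Union: "Kinf = (\<Union>n. F (short_words d n))"
proof
  have s: "sfield (\<Union>n. F (short_words d n))"
    by (rule sfield_chain_Union[OF F(1) F_mono[OF short_words_mono]])
  show "Kinf \<subseteq> (\<Union>n. F (short_words d n))"
    unfolding Kinf_eq
  proof (rule adjoin_least[OF s])
    show "K \<subseteq> (\<Union>n. F (short_words d n))" using E0(2) F(2) by blast
    show "\<alpha> ` words d \<subseteq> (\<Union>n. F (short_words d n))"
    proof (rule image_subsetI)
      fix w assume w: "w \<in> words d"
      have "w \<in> short_words d (Suc (length w))" using w by (simp add: short_words_def)
      from tree_closedD[OF tree_closed_short_words this]
      have "\<alpha> w \<in> F (short_words d (Suc (length w)))"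
        by (rule \<alpha>_in_F[rotated]) (auto simp: short_words_def)
      then show "\<alpha> w \<in> (\<Union>n. F (short_words d n))" by blast
    qed
  qed
  have "E0 \<subseteq> Kinf" unfolding E0_def
    by (rule adjoin_least[OF Kinf(1,2)]) (use Kinf(4,5) in simp)
  moreover have "\<beta> w \<in> Kinf" if "w \<in> words d" for w
    using Kinf(3)[of "w @ [d]"] that d0 by (simp add: \<beta>_def)
  ultimately show "(\<Union>n. F (short_words d n)) \<subseteq> Kinf"
    unfolding F_def by (intro UN_least adjoin_least[OF Kinf(1)]) (auto simp: short_words_def)
qed

lemma tree_action_apply:
  assumes "w \<in> words d" "v \<in> words d" "\<sigma> (\<alpha> w) = \<alpha> v"
  shows "tree_action d \<alpha> \<sigma> w = v"
  using assms by (simp add: tree_action_def inv_\<alpha>)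

lemma Gal_hom:
  assumes "\<sigma> \<in> Gal Kinf (adjoin K {t})"
  shows "hom_on Kinf \<sigma>" "x \<in> K \<Longrightarrow> \<sigma> x = x" "\<sigma> t = t"
  using assms adjoin_incl[where K=K and S="{t}"] unfolding Gal_iff[OF Kinf(1)] by (simp, blast, blast)

text \<open>An automorphism sends \<open>\<xi>\<close> to \<open>\<xi>^i\<close>, and
  \<open>\<beta> w\<close> to \<open>\<xi>^z\<close> times \<open>\<beta>\<close> at the image
  vertex. Hence \<open>\<xi>^x \<beta> w\<close> acquires the exponent \<open>i x + z\<close>: the
  factor \<open>i\<close> is global, the translation \<open>z\<close> local.\<close>

lemma tree_action_affine:
  assumes "\<sigma> \<in> Gal Kinf (adjoin K {t})"
  shows "tree_action d \<alpha> \<sigma> \<in> affine_group d I"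
proof -
  note h = Gal_hom[OF assms] and hD = hom_onD[OF Kinf(1) Gal_hom(1)[OF assms]]
  let ?g = "tree_action d \<alpha> \<sigma>"
  have "\<sigma> \<xi> ^ d = 1 ^ d" using hD(9)[OF Kinf(5), of d] hD(1) by (simp add: \<xi>_d)
  then obtain i where i: "i < d" "\<sigma> \<xi> = \<xi> ^ i"
    using root_of_unity_multiple[OF \<xi> d0, of 1 "\<sigma> \<xi>"] by auto
  \<comment> \<open>Otherwise \<open>e = d / gcd i d\<close> is smaller than \<open>d\<close>, and
    \<open>\<xi>^e \<noteq> 1\<close> is sent to 1, contrary to injectivity.\<close>
  have cop: "coprime i d"
  proof (rule ccontr)
    assume "\<not> coprime i d"
    then have g: "gcd i d \<noteq> 1" by (simp add: coprime_iff_gcd_eq_1)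
    obtain e where e: "d = gcd i d * e" by (metis dvdE gcd_dvd2)
    obtain f where f: "i = gcd i d * f" by (metis dvdE gcd_dvd1)
    have e0: "0 < e" using e d0 by (cases "e = 0") auto
    have g0: "gcd i d \<noteq> 0" using d0 by simp
    have "e < d"
    proof -
      have "1 * e < gcd i d * e" using g g0 e0 by (intro mult_strict_right_mono) linarith+
      then show ?thesis using e by simp
    qed
    have "i * e = d * f" using e f by (metis mult.assoc mult.commute)
    then have "\<sigma> \<xi> ^ e = 1" unfolding i(2) by (simp add: \<xi>_d flip: power_mult) (simp add: power_mult \<xi>_d)
    then have "\<sigma> (\<xi> ^ e - 1) = 0"
      using hD(6)[OF sfieldD(9)[OF Kinf(1,5)] sfieldD(2)[OF Kinf(1)], of e] hD(9)[OF Kinf(5), of e] hD(1) by simp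
    then have "\<xi> ^ e = 1"
      using hD(10)[OF sfieldD(7)[OF Kinf(1) sfieldD(9)[OF Kinf(1,5)] sfieldD(2)[OF Kinf(1)]], of e] by simp
    then show False using \<xi> e0 \<open>e < d\<close> by (auto simp: primitive_root_of_unity_def)
  qed
  have "i > 0" using cop d2 by (cases "i = 0") auto
  have "K\<xi> \<subseteq> Kinf" by (rule adjoin_least[OF Kinf(1,2)]) (use Kinf(5) in simp)
  then have "hom_on K\<xi> \<sigma>" by (rule hom_on_mono[OF h(1)])
  moreover have "coprime (int i) (int d)" using cop by simp
  ultimately have iI: "int i \<in> I"
    unfolding cyclotomic_image_iff using i \<open>i > 0\<close> h(2)
    by (intro conjI exI[of _ \<sigma>]) simp_all
  have it: "\<sigma> (\<alpha> w) ^ d = \<sigma> (\<alpha> v) - c" if "w = v @ [x]" "w \<in> words d" for v w x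
  proof -
    have vx: "v \<in> words d" "x \<in> {1..d}" using that by auto
    have "\<sigma> (\<alpha> w) ^ d = \<sigma> (\<alpha> w ^ d)" by (rule hD(9)[OF Kinf(3)[OF that(2)], symmetric])
    also have "\<dots> = \<sigma> (\<alpha> v - c)" using \<alpha>_snoc_pow[OF vx] that(1) by simp
    also have "\<dots> = \<sigma> (\<alpha> v) - c"
      using hD(6)[OF Kinf(3)[OF vx(1)] subsetD[OF Kinf(2) cK]] h(2)[OF cK] by simp
    finally show ?thesis .
  qed
  have ex: "\<exists>v\<in>words d. \<sigma> (\<alpha> w) = \<alpha> v" if "w \<in> words d" for w
    using that
  proof (induction w rule: rev_induct)
    case Nil
    then show ?case using h(3) by (intro bexI[of _ "[]"]) (simp_all add: \<alpha>_Nil)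
  next
    case (snoc x w)
    then have wd: "w \<in> words d" by simp
    from snoc.IH[OF wd] obtain v where v: "v \<in> words d" "\<sigma> (\<alpha> w) = \<alpha> v" by blast
    have "\<sigma> (\<alpha> (w @ [x])) ^ d = \<alpha> v - c" unfolding it[OF refl snoc.prems] v(2) ..
    then obtain y where y: "y \<in> {1..d}" "\<sigma> (\<alpha> (w @ [x])) = \<alpha> (v @ [y])" by (rule d_th_root[OF v(1)])
    then show ?case using v(1) by (intro bexI[of _ "v @ [y]"]) simp_all
  qed
  have g: "?g w \<in> words d" "\<sigma> (\<alpha> w) = \<alpha> (?g w)" if "w \<in> words d" for w
    using ex[OF that] tree_action_apply[OF that, of _ \<sigma>] by auto
  have g_Nil: "?g [] = []" using tree_action_apply[of "[]" "[]" \<sigma>] h(3) by (simp add: \<alpha>_Nil)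
  \<comment> \<open>The letter \<open>d\<close> stands for residue 0, so its image is the
    translation part.\<close>
  define b where "b w = int (last (?g (w @ [d])))" for w
  have step: "?g (w @ [x]) = ?g w @ [affine_mod d (int i) (b w) x]" if w: "w \<in> words d" "x \<in> {1..d}" for w x
  proof -
    have wd: "w @ [d] \<in> words d" "w @ [x] \<in> words d" using w d0 by simp_all
    have "\<sigma> (\<alpha> (w @ [d])) ^ d = \<alpha> (?g w) - c" unfolding it[OF refl wd(1)] g(2)[OF w(1)] ..
    then obtain z where z: "z \<in> {1..d}" "\<sigma> (\<alpha> (w @ [d])) = \<alpha> (?g w @ [z])" by (rule d_th_root[OF g(1)[OF w(1)]])
    have gd: "?g (w @ [d]) = ?g w @ [z]"
    proof (rule tree_action_apply[OF wd(1)])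
      show "?g w @ [z] \<in> words d" using g(1)[OF w(1)] z(1) by simp
    qed (rule z(2))
    then have bz: "b w = int z" by (simp add: b_def)
    let ?y = "affine_mod d (int i) (b w) x"
    have y: "?y \<in> {1..d}" by (rule affine_mod_in[OF d0])
    have "\<beta> w \<in> Kinf" using Kinf(3)[OF wd(1)] by (simp add: \<beta>_def)
    then have "\<sigma> (\<xi> ^ x * \<beta> w) = (\<xi> ^ i) ^ x * \<sigma> (\<beta> w)"
      using hD(4)[OF sfieldD(9)[OF Kinf(1,5)], of "\<beta> w" x] hD(9)[OF Kinf(5), of x] i(2) by simp
    also have "\<sigma> (\<beta> w) = \<xi> ^ z * \<beta> (?g w)"
      using z(2) \<alpha>_snoc[OF g(1)[OF w(1)] z(1)] by (simp add: \<beta>_def)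
    also have "(\<xi> ^ i) ^ x * (\<xi> ^ z * \<beta> (?g w)) = \<xi> ^ (i * x + z) * \<beta> (?g w)"
      by (simp add: power_add power_mult)
    also have "\<xi> ^ (i * x + z) = \<xi> ^ ?y"
    proof -
      have "[int ?y = int i * int x + int z] (mod int d)" using affine_mod_cong[OF d0, of "int i" "b w" x] bz by simp
      then have "[int ?y = int (i * x + z)] (mod int d)" by simp
      then show ?thesis unfolding \<xi>_pow_eq_iff cong_int_iff by (rule cong_sym)
    qed
    finally have \<sigma>x: "\<sigma> (\<alpha> (w @ [x])) = \<alpha> (?g w @ [?y])"
      unfolding \<alpha>_snoc[OF w] \<alpha>_snoc[OF g(1)[OF w(1)] y] .
    show ?thesis
    proof (rule tree_action_apply[OF wd(2)])
      show "?g w @ [?y] \<in> words d" using g(1)[OF w(1)] y by simp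
    qed (rule \<sigma>x)
  qed
  have "?g w = act (\<lambda>w. affine_mod d (int i) (b w)) w" if "w \<in> words d" for w
    using that
  proof (induction w rule: rev_induct)
    case (snoc x w)
    then have "w \<in> words d" "x \<in> {1..d}" by auto
    then show ?case using step snoc.IH by (simp only: act_snoc)
  qed (simp add: g_Nil)
  then have "?g = affine_aut d (int i) b"
    by (intro extensionalityI[of _ "words d"]) (auto simp: tree_action_def affine_aut_def aut_def)
  then show ?thesis using iI by (auto simp: affine_group_def)
qed

text \<open>The permuted labels obey the tower relations with \<open>\<xi>\<close> replaced by
  \<open>\<xi>^a\<close>, since the images of the letters \<open>x\<close> and \<open>d\<close>
  differ by \<open>a x\<close> modulo \<open>d\<close>.\<close>

lemma affine_compatible:
  assumes a: "a \<in> I" and g: "g = affine_aut d a b"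
    and \<phi>: "\<phi> t = t" "\<phi> c = c" "\<phi> \<xi> = \<xi> ^ nat a"
  shows "compatible \<phi> (\<lambda>w. \<alpha> (g w)) (words d)"
  unfolding compatible_def
proof (intro conjI ballI)
  interpret U: unit_group_mod d I by (rule unit_group)
  have gw: "g w \<in> words d" if "w \<in> words d" for w
    using act_in_words[OF U.portrait_affine[OF a] that] that by (simp add: g affine_aut_def aut_def)
  have gs: "g (w @ [x]) = g w @ [affine_mod d a (b w) x]" if "w \<in> words d" "x \<in> {1..d}" for w x
    using that by (simp add: g affine_aut_def aut_def act_snoc)
  have a0: "a > 0" using a by (simp add: cyclotomic_image_iff)
  show "\<alpha> (g []) = \<phi> t" using \<phi>(1) by (simp add: g affine_aut_def aut_def \<alpha>_Nil)
  fix w assume w: "w \<in> words d"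
  have dd: "d \<in> {1..d}" using d0 by simp
  note am = affine_mod_in[OF d0]
  show "\<alpha> (g (w @ [d])) ^ d = \<alpha> (g w) - \<phi> c"
    unfolding gs[OF w dd] \<phi>(2) by (rule \<alpha>_snoc_pow[OF gw[OF w] am])
  fix x assume x: "x \<in> {1..d}"
  have "\<xi> ^ affine_mod d a (b w) x = \<xi> ^ (nat a * x + affine_mod d a (b w) d)"
  proof -
    have "[a * int x + int (affine_mod d a (b w) d) = a * int x + (a * int d + b w)] (mod int d)"
      by (intro cong_add cong_refl affine_mod_cong d0)
    moreover have "[a * int x + (a * int d + b w) = a * int x + b w] (mod int d)"
      by (simp add: cong_iff_dvd_diff)
    ultimately have "[int (affine_mod d a (b w) x) = a * int x + int (affine_mod d a (b w) d)] (mod int d)"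
      by (rule cong_trans[OF affine_mod_cong[OF d0] cong_sym[OF cong_trans]])
    then have "[int (affine_mod d a (b w) x) = int (nat a * x + affine_mod d a (b w) d)] (mod int d)"
      using a0 by simp
    then show ?thesis unfolding \<xi>_pow_eq_iff cong_int_iff .
  qed
  then show "\<alpha> (g (w @ [x])) = \<phi> \<xi> ^ x * \<alpha> (g (w @ [d]))"
    unfolding gs[OF w dd] gs[OF w x] \<alpha>_snoc[OF gw[OF w] am] \<phi>(3)
    by (simp add: power_add power_mult)
qed

text \<open>A homomorphism prescribed on \<open>K(\<xi>)\<close> and fixing \<open>t\<close> is
  extended over each finite stage by \<open>extend_hom\<close>. Extensions are determined by the
  generators, so separately chosen ones agree and glue to a map on the union.\<close>

lemma affine_in_G:
  assumes a: "a \<in> I"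
  shows "affine_aut d a b \<in> tree_action d \<alpha> ` Gal Kinf (adjoin K {t})"
proof -
  interpret U: unit_group_mod d I by (rule unit_group)
  define g where "g = affine_aut d a b"
  have gA: "g \<in> carrier (Aut_tree d)" unfolding g_def by (rule U.affine_aut_in[OF a])
  obtain \<tau> where \<tau>: "hom_on K\<xi> \<tau>" "\<forall>x\<in>K. \<tau> x = x" "\<tau> \<xi> = \<xi> ^ nat a"
    using a by (auto simp: cyclotomic_image_iff)
  have into: "\<tau> ` K\<xi> \<subseteq> K\<xi>"
  proof (rule image_subsetI, rule hom_on_image_adjoin[OF \<tau>(1) K\<xi>(1)])
    fix y assume "y \<in> K \<union> {\<xi>}"
    then show "\<tau> y \<in> K\<xi>" using \<tau>(2,3) K\<xi>(2) sfieldD(9)[OF K\<xi>(1,3)] by auto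
  qed
  have "\<exists>\<phi>0. hom_on (adjoin K\<xi> {t}) \<phi>0 \<and> (\<forall>z\<in>K\<xi>. \<phi>0 z = \<tau> z) \<and> \<phi>0 t = t"
    by (rule hom_extend_transcendental[OF K\<xi>(1) \<tau>(1)])
      (erule (1) K\<xi>_trans, erule K\<xi>_trans[OF coeffs_in_mono[OF _ into]])
  then obtain \<phi>0 where "hom_on (adjoin K\<xi> {t}) \<phi>0 \<and> (\<forall>z\<in>K\<xi>. \<phi>0 z = \<tau> z) \<and> \<phi>0 t = t" by (rule exE)
  then have \<phi>0: "hom_on E0 \<phi>0" "\<forall>z\<in>K\<xi>. \<phi>0 z = \<tau> z" "\<phi>0 t = t"
    unfolding E0_eq by simp_all
  have \<phi>0K: "\<phi>0 x = x" if "x \<in> K" for x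
    using bspec[OF \<phi>0(2) subsetD[OF K\<xi>(2) that]] bspec[OF \<tau>(2) that] by simp
  have \<phi>0\<xi>: "\<phi>0 \<xi> = \<xi> ^ nat a" using bspec[OF \<phi>0(2) K\<xi>(3)] \<tau>(3) by simp
  have comp: "compatible \<phi>0 (\<lambda>w. \<alpha> (g w)) (words d)"
    by (rule affine_compatible[OF a g_def \<phi>0(3) \<phi>0K[OF cK] \<phi>0\<xi>])
  have sw: "short_words d n \<subseteq> words d" for n by (auto simp: short_words_def)
  let ?ok = "\<lambda>n \<phi>. hom_on (F (short_words d n)) \<phi> \<and> (\<forall>x\<in>E0. \<phi> x = \<phi>0 x) \<and>
      (\<forall>w\<in>short_words d n. \<phi> (\<beta> w) = \<alpha> (g (w @ [d])))"
  have "\<exists>\<phi>. ?ok n \<phi>" for n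
    by (rule extend_hom[OF finite_short_words tree_closed_short_words \<phi>0(1) compatible_subset[OF comp sw]])
  then obtain \<Phi> where \<Phi>: "\<And>n. ?ok n (\<Phi> n)" by metis
  note \<Phi>1 = conjunct1[OF \<Phi>] and \<Phi>2 = bspec[OF conjunct1[OF conjunct2[OF \<Phi>]]]
    and \<Phi>3 = bspec[OF conjunct2[OF conjunct2[OF \<Phi>]]]
  have agree: "\<Phi> n x = \<Phi> m x" if "m \<le> n" "x \<in> F (short_words d m)" for m n x
  proof -
    have h: "hom_on (F (short_words d m)) (\<Phi> n)"
      by (rule hom_on_mono[OF \<Phi>1 F_mono[OF short_words_mono[OF that(1)]]])
    show ?thesis
    proof (rule hom_on_unique[OF h[unfolded F_def] \<Phi>1[of m, unfolded F_def] _ that(2)[unfolded F_def]])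
      fix y assume "y \<in> E0 \<union> \<beta> ` short_words d m"
      then consider "y \<in> E0" | w where "w \<in> short_words d m" "y = \<beta> w" by blast
      then show "\<Phi> n y = \<Phi> m y"
      proof cases
        case 1
        then show ?thesis using \<Phi>2[of y n] \<Phi>2[of y m] by simp
      next
        case 2
        then have "w \<in> short_words d n" using short_words_mono[OF that(1)] by blast
        then show ?thesis using \<Phi>3[of w n] \<Phi>3[of w m] 2 by simp
      qed
    qed
  qed
  \<comment> \<open>The least stage containing \<open>x\<close> makes a definite choice; by
    \<open>agree\<close> every later stage gives the same value.\<close>
  define \<sigma> where "\<sigma> = (\<lambda>x\<in>Kinf. \<Phi> (LEAST n. x \<in> F (short_words d n)) x)"
  have \<sigma>: "\<sigma> x = \<Phi> n x" if "x \<in> F (short_words d n)" for n x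
  proof -
    let ?m = "LEAST n. x \<in> F (short_words d n)"
    have "x \<in> F (short_words d ?m)" "?m \<le> n" using that by (auto intro: LeastI Least_le)
    then show ?thesis using agree[of ?m n x] that unfolding \<sigma>_def Kinf_Union by auto
  qed
  have \<sigma>hom: "hom_on Kinf \<sigma>"
    unfolding hom_on_def
  proof (intro conjI ballI)
    show "\<sigma> 1 = 1" using \<sigma>[OF sfieldD(2)[OF F(1)], of 0] hom_onD(1)[OF F(1) \<Phi>1] by simp
    fix x y assume "x \<in> Kinf" "y \<in> Kinf"
    then obtain m n where "x \<in> F (short_words d m)" "y \<in> F (short_words d n)" unfolding Kinf_Union by blast
    then have xy: "x \<in> F (short_words d (max m n))" "y \<in> F (short_words d (max m n))"
      using F_mono[OF short_words_mono[of m "max m n"]] F_mono[OF short_words_mono[of n "max m n"]] by auto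
    show "\<sigma> (x + y) = \<sigma> x + \<sigma> y"
      unfolding \<sigma>[OF xy(1)] \<sigma>[OF xy(2)] \<sigma>[OF sfieldD(3)[OF F(1) xy]] by (rule hom_onD(3)[OF F(1) \<Phi>1 xy])
    show "\<sigma> (x * y) = \<sigma> x * \<sigma> y"
      unfolding \<sigma>[OF xy(1)] \<sigma>[OF xy(2)] \<sigma>[OF sfieldD(4)[OF F(1) xy]] by (rule hom_onD(4)[OF F(1) \<Phi>1 xy])
  qed
  have \<sigma>K: "\<sigma> x = x" if "x \<in> K" for x
    using \<sigma>[OF subsetD[OF F(2) subsetD[OF E0(2) that]], of 0] \<Phi>2[OF subsetD[OF E0(2) that]] \<phi>0K[OF that] by simp
  have \<sigma>t: "\<sigma> t = t"
    using \<sigma>[OF subsetD[OF F(2) E0(4)], of 0] \<Phi>2[OF E0(4)] \<phi>0(3) by simp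
  have \<sigma>\<alpha>: "\<sigma> (\<alpha> w) = \<alpha> (g w)" if w: "w \<in> words d" for w
  proof -
    let ?S = "short_words d (Suc (length w))"
    have "w \<in> ?S" using w by (simp add: short_words_def)
    from tree_closedD[OF tree_closed_short_words this]
    have *: "w = [] \<or> (\<exists>v\<in>?S. \<exists>x\<in>{1..d}. w = v @ [x])" .
    have "\<sigma> (\<alpha> w) = \<Phi> (Suc (length w)) (\<alpha> w)" by (rule \<sigma>[OF \<alpha>_in_F[OF sw *]])
    also have "\<dots> = \<alpha> (g w)"
      by (rule hom_\<alpha>[OF \<Phi>1 \<Phi>2 \<Phi>3 compatible_subset[OF comp sw] sw *])
    finally show ?thesis .
  qed
  have gbij: "g ` words d = words d"
    using Aut_BijD[OF gA] by (simp add: Bij_def bij_betw_def)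
  have "\<sigma> x \<in> Kinf" if "x \<in> Kinf" for x
  proof (rule hom_on_image_adjoin[OF \<sigma>hom[unfolded Kinf_eq] Kinf(1) _ that[unfolded Kinf_eq]])
    fix y assume "y \<in> K \<union> \<alpha> ` words d"
    then consider "y \<in> K" | w where "w \<in> words d" "y = \<alpha> w" by blast
    then show "\<sigma> y \<in> Kinf"
    proof cases
      case 1
      then show ?thesis using \<sigma>K[OF 1] Kinf(2) by auto
    next
      case 2
      then have "g w \<in> words d" using gbij by blast
      then show ?thesis unfolding 2(2) \<sigma>\<alpha>[OF 2(1)] by (rule Kinf(3))
    qed
  qed
  then have "\<sigma> ` Kinf \<subseteq> Kinf" by (rule image_subsetI)
  \<comment> \<open>Surjectivity: the image is a subfield containing \<open>K\<close> and all
    labels, because \<open>g\<close> permutes the words.\<close>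
  moreover have "adjoin K (\<alpha> ` words d) \<subseteq> \<sigma> ` Kinf"
  proof (rule adjoin_least[OF sfield_hom_image[OF Kinf(1) \<sigma>hom]])
    show "K \<subseteq> \<sigma> ` Kinf"
    proof
      fix x assume "x \<in> K"
      then show "x \<in> \<sigma> ` Kinf" using \<sigma>K[of x] Kinf(2) by (intro image_eqI[where x = x]) auto
    qed
    show "\<alpha> ` words d \<subseteq> \<sigma> ` Kinf"
    proof (rule image_subsetI)
      fix v assume "v \<in> words d"
      then obtain w where "w \<in> words d" "v = g w" using gbij by blast
      then have "\<alpha> v = \<sigma> (\<alpha> w)" "\<alpha> w \<in> Kinf" using \<sigma>\<alpha> Kinf(3) by simp_all
      then show "\<alpha> v \<in> \<sigma> ` Kinf" by (rule image_eqI)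
    qed
  qed
  ultimately have im: "\<sigma> ` Kinf = Kinf" unfolding Kinf_eq[symmetric] by blast
  have Kt: "\<forall>x\<in>adjoin K {t}. \<sigma> x = x"
  proof
    fix x assume x: "x \<in> adjoin K {t}"
    have sub: "adjoin K {t} \<subseteq> Kinf" by (rule adjoin_least[OF Kinf(1,2)]) (use Kinf(4) in simp)
    have "hom_on (adjoin K {t}) (\<lambda>x. x)" by (simp add: hom_on_def)
    then show "\<sigma> x = x"
    proof (rule hom_on_unique[OF hom_on_mono[OF \<sigma>hom sub] _ _ x])
      fix y assume "y \<in> K \<union> {t}"
      then show "\<sigma> y = y" using \<sigma>K[of y] \<sigma>t by (cases "y = t") simp_all
    qed
  qed
  have "\<sigma> \<in> Gal Kinf (adjoin K {t})"
    unfolding Gal_iff[OF Kinf(1)]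
  proof (intro conjI)
    show "\<sigma> \<in> extensional Kinf" by (simp add: \<sigma>_def)
  qed (fact \<sigma>hom im Kt)+
  moreover have "tree_action d \<alpha> \<sigma> = g"
  proof (rule extensionalityI[of _ "words d"])
    show "tree_action d \<alpha> \<sigma> \<in> extensional (words d)" by (simp add: tree_action_def)
    show "g \<in> extensional (words d)" using Aut_BijD[OF gA] by (simp add: Bij_def)
    fix w assume w: "w \<in> words d"
    then have "g w \<in> words d" using gbij by blast
    then show "tree_action d \<alpha> \<sigma> w = g w" using \<sigma>\<alpha>[OF w] by (rule tree_action_apply[OF w])
  qed
  ultimately show ?thesis unfolding g_def by (intro image_eqI[where x = \<sigma>]) simp_all
qed

theorem G_inf_eq: "G_inf d K (unicritical d c) t \<alpha> = affine_group d I"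
proof
  show "G_inf d K (unicritical d c) t \<alpha> \<subseteq> affine_group d I"
    unfolding G_inf_def Kinf_def[symmetric] using tree_action_affine by blast
  show "affine_group d I \<subseteq> G_inf d K (unicritical d c) t \<alpha>"
    unfolding G_inf_def Kinf_def[symmetric] affine_group_def using affine_in_G by blast
qed

end

section \<open>The rational base field\<close>

lemma rational_subfield:
  fixes K :: "'a::field set"
  assumes K: "sfield K" and iso: "ring_of_type_algebra\<lparr>carrier := K\<rparr> \<simeq> (ring_of_type_algebra :: rat ring)"
  shows "of_int n = (0::'a) \<Longrightarrow> n = 0"
    "x \<in> K \<Longrightarrow> \<exists>m n. n \<noteq> 0 \<and> of_int n * x = of_int m"
proof -
  obtain h :: "'a \<Rightarrow> rat" where "h \<in> ring_iso (ring_of_type_algebra\<lparr>carrier := K\<rparr>) ring_of_type_algebra"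
    using iso unfolding is_ring_iso_def by blast
  then have h: "hom_on K h" by (simp add: ring_iso_def ring_hom_def hom_on_def)
  note hD = hom_onD[OF K h]
  have nat: "h (of_nat m) = of_nat m" for m
  proof (induction m)
    case (Suc m)
    have "of_nat m \<in> K" using sfield_of_int[OF K, of "int m"] by simp
    then show ?case using Suc hD(1) hD(3)[OF sfieldD(2)[OF K], of "of_nat m"] by simp
  qed (simp add: hD)
  have int: "h (of_int m) = of_int m" for m
  proof (cases m rule: int_cases2)
    case (nonpos k)
    have "of_nat k \<in> K" using sfield_of_int[OF K, of "int k"] by simp
    from hD(5)[OF this] show ?thesis using nat[of k] nonpos by simp
  qed (simp add: nat)
  show "n = 0" if "of_int n = (0::'a)" using int[of n] hD(2) that by simp
  show "\<exists>m n. n \<noteq> 0 \<and> of_int n * x = of_int m" if x: "x \<in> K"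
  proof -
    obtain m n where mn: "n \<noteq> 0" "h x = of_int m / of_int n"
      by (metis Fract_of_int_quotient Rat_cases less_irrefl)
    have nx: "of_int n * x \<in> K" by (intro sfieldD(4)[OF K sfield_of_int[OF K] x])
    have "h (of_int n * x - of_int m) = h (of_int n) * h x - h (of_int m)"
      using hD(6)[OF nx sfield_of_int[OF K]] hD(4)[OF sfield_of_int[OF K] x] by simp
    also have "\<dots> = 0" using mn by (simp add: int)
    finally have "of_int n * x - of_int m = 0"
      using hD(10)[OF sfieldD(7)[OF K nx sfield_of_int[OF K]]] by blast
    then show ?thesis using mn(1) by (intro exI[of _ m] exI[of _ n]) simp
  qed
qed

lemma clear_denominators:
  fixes K :: "'a::field set"
  assumes frac: "\<And>x. x \<in> K \<Longrightarrow> \<exists>m n. n \<noteq> 0 \<and> of_int n * x = of_int m" and p: "coeffs_in K p"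
  shows "\<exists>N q. N \<noteq> 0 \<and> (\<forall>x. of_int N * poly p x = ev q x)"
  using p
proof (induction p)
  case 0
  then show ?case by (intro exI[of _ 1] exI[of _ 0]) (simp add: ev_simps)
next
  case (pCons a p)
  have "a \<in> K" "coeffs_in K p"
    using pCons.prems unfolding coeffs_in_def by (metis coeff_pCons_0, metis coeff_pCons_Suc)
  then obtain m n where mn: "n \<noteq> 0" "of_int n * a = of_int m" using frac by blast
  obtain N q where Nq: "N \<noteq> 0" "\<And>x. of_int N * poly p x = ev q x"
    using pCons.IH[OF \<open>coeffs_in K p\<close>] by blast
  have "of_int (N * n) * poly (pCons a p) x = ev (pCons (N * m) (Polynomial.smult n q)) x" for x
  proof -
    have "of_int (N * n) * poly (pCons a p) x = of_int N * (of_int n * a) + x * (of_int n * (of_int N * poly p x))"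
      by (simp add: algebra_simps)
    also have "\<dots> = ev (pCons (N * m) (Polynomial.smult n q)) x"
      unfolding mn(2) Nq(2) by (simp add: ev_simps)
    finally show ?thesis .
  qed
  then show ?case using mn(1) Nq(1) by (intro exI[of _ "N * n"] exI[of _ "pCons (N * m) (Polynomial.smult n q)"]) simp
qed

lemma map_poly_ident: "map_poly (\<lambda>x. x) p = p"
  by (simp add: poly_eq_iff coeff_map_poly)

context unicritical_tower
begin

text \<open>Extending the identity of \<open>K\<close> by \<open>\<xi> \<mapsto> \<xi>^a\<close>
  requires that the same polynomials vanish at both. One direction is conjugacy for the exponent
  \<open>a\<close>, the other for an inverse \<open>j\<close> of \<open>a\<close> modulo
  \<open>d\<close>; denominators are cleared because conjugacy concerns integer polynomials.\<close>

lemma cyclotomic_image_rational: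
  assumes iso: "ring_of_type_algebra\<lparr>carrier := K\<rparr> \<simeq> (ring_of_type_algebra :: rat ring)"
  shows "I = {a. 0 < a \<and> a < int d \<and> coprime a (int d)}"
proof (intro equalityI subsetI)
  note rat = rational_subfield[OF K iso]
  fix a assume "a \<in> {a. 0 < a \<and> a < int d \<and> coprime a (int d)}"
  then have a: "0 < a" "a < int d" "coprime a (int d)" by auto
  have cop: "coprime (nat a) d" using a by (metis coprime_int_iff int_nat_eq less_imp_le)
  from cong_solve_coprime_nat[OF this] obtain j where j: "[nat a * j = Suc 0] (mod d)" by blast
  then have cj: "coprime j d" by (metis coprime_Suc_0_left cong_imp_coprime cong_sym coprime_mult_left_iff)
  have conj: "ev q (\<xi> ^ k) = 0" if "coprime k d" "ev q \<xi> = 0" for k q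
  proof -
    have char0: "n = 0" if "of_int n = (0::'a)" for n using that by (rule rat(1))
    have "conjugate_power \<xi> k" using char0 that(1) by (rule conjugate_coprime[OF d0 \<xi>])
    moreover have "conjugate_power \<xi> k \<longleftrightarrow> (\<forall>q. ev q \<xi> = 0 \<longrightarrow> ev q (\<xi> ^ k) = 0)"
      using char0 by (rule conjugate_power_def[OF d0 \<xi>])
    ultimately show ?thesis using that(2) by blast
  qed
  have "(\<xi> ^ nat a) ^ j = \<xi>" using \<xi>_pow_eq_iff[of "nat a * j" 1] j by (simp add: power_mult)
  have "\<exists>\<tau>. hom_on K\<xi> \<tau> \<and> (\<forall>x\<in>K. \<tau> x = x) \<and> \<tau> \<xi> = \<xi> ^ nat a"
  proof (rule hom_extend_single[OF K])
    show "hom_on K (\<lambda>x. x)" by (simp add: hom_on_def)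
    fix p assume "coeffs_in K p"
    from clear_denominators[OF rat(2) this] obtain N q
      where Nq: "N \<noteq> 0" "\<And>x. of_int N * poly p x = ev q x" by blast
    have "(of_int N :: 'a) \<noteq> 0" using rat(1) Nq(1) by blast
    then have pq: "poly p x = 0 \<longleftrightarrow> ev q x = 0" for x using Nq(2)[of x] by auto
    have "ev q \<xi> = 0" if "ev q (\<xi> ^ nat a) = 0"
    proof -
      have "ev (pcompose q (Polynomial.monom 1 (nat a))) \<xi> = 0" using that by (simp add: ev_pcompose ev_simps)
      then have "ev (pcompose q (Polynomial.monom 1 (nat a))) (\<xi> ^ j) = 0"
        by (rule conj[OF cj])
      then have "ev q ((\<xi> ^ j) ^ nat a) = 0" by (simp add: ev_pcompose ev_simps)
      moreover have "(\<xi> ^ j) ^ nat a = \<xi>" using \<open>(\<xi> ^ nat a) ^ j = \<xi>\<close> by (simp add: mult.commute flip: power_mult)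
      ultimately show ?thesis by simp
    qed
    moreover have "ev q (\<xi> ^ nat a) = 0" if "ev q \<xi> = 0"
      by (rule conj[OF cop that])
    ultimately show "poly p \<xi> = 0 \<longleftrightarrow> poly (map_poly (\<lambda>x. x) p) (\<xi> ^ nat a) = 0"
      unfolding map_poly_ident pq by blast
  qed
  then show "a \<in> I" unfolding cyclotomic_image_iff using a by blast
qed (simp add: cyclotomic_image_iff)

end

section \<open>Units modulo \<open>d\<close> and the proof of the theorem\<close>

lemma card_units_below:
  assumes "d \<ge> 2"
  shows "card {a. 0 < a \<and> a < int d \<and> coprime a (int d)} = totient d"
proof -
  interpret residues "int d" "residue_ring (int d)" using assms by (simp add: residues_def)
  show ?thesis using totient_eq res_units_eq by simp
qed

lemma card_consecutive_units:
  assumes "d \<ge> 2"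
  shows "card {a. 0 < a \<and> a < int d \<and> coprime a (int d) \<and> coprime (a - 1) (int d)} = consecutive_units d"
proof -
  have "bij_betw (\<lambda>k. int k + 1) {k. k < d \<and> coprime k d \<and> coprime (Suc k) d}
      {a. 0 < a \<and> a < int d \<and> coprime a (int d) \<and> coprime (a - 1) (int d)}"
  proof (rule bij_betw_byWitness[where f' = "\<lambda>a. nat (a - 1)"])
    show "(\<lambda>k. int k + 1) ` {k. k < d \<and> coprime k d \<and> coprime (Suc k) d}
      \<subseteq> {a. 0 < a \<and> a < int d \<and> coprime a (int d) \<and> coprime (a - 1) (int d)}"
    proof (rule image_subsetI)
      fix k assume "k \<in> {k. k < d \<and> coprime k d \<and> coprime (Suc k) d}"
      then have k: "k < d" "coprime k d" "coprime (Suc k) d" by auto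
      \<comment> \<open>The value \<open>k = d - 1\<close> would give \<open>a = d\<close>, outside
        the range; it drops out since \<open>d \<ge> 2\<close> is not coprime to itself.\<close>
      have "Suc k \<noteq> d" using k(3) assms by auto
      moreover have "coprime (int (Suc k)) (int d)" "coprime (int k) (int d)" using k by (simp_all only: coprime_int_iff)
      ultimately show "int k + 1 \<in> {a. 0 < a \<and> a < int d \<and> coprime a (int d) \<and> coprime (a - 1) (int d)}"
        using k(1) by (simp add: add.commute)
    qed
    show "(\<lambda>a. nat (a - 1)) ` {a. 0 < a \<and> a < int d \<and> coprime a (int d) \<and> coprime (a - 1) (int d)}
      \<subseteq> {k. k < d \<and> coprime k d \<and> coprime (Suc k) d}"
    proof (rule image_subsetI)
      fix a assume "a \<in> {a. 0 < a \<and> a < int d \<and> coprime a (int d) \<and> coprime (a - 1) (int d)}"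
      then have a: "0 < a" "a < int d" "coprime a (int d)" "coprime (a - 1) (int d)" by auto
      define k where "k = nat (a - 1)"
      have k: "a - 1 = int k" "a = int (Suc k)" using a(1) by (simp_all add: k_def)
      then have "coprime (int (Suc k)) (int d)" "coprime (int k) (int d)" using a(3,4) by simp_all
      then have "coprime (Suc k) d" "coprime k d" by (simp_all only: coprime_int_iff)
      then show "nat (a - 1) \<in> {k. k < d \<and> coprime k d \<and> coprime (Suc k) d}"
        using a(2) k by (simp add: k_def[symmetric])
    qed
  qed auto
  then show ?thesis unfolding consecutive_units_def by (rule bij_betw_same_card[symmetric])
qed

text \<open>In the range \<open>0 < a < d\<close> subtracting 1 needs no reduction; at
  \<open>a = 1\<close> both sides fail, as 0 is not coprime to \<open>d \<ge> 2\<close>.\<close>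

lemma residue_minus_one_unit:
  assumes "d \<ge> 2" "0 < a" "a < int d"
  shows "a \<ominus>\<^bsub>residue_ring (int d)\<^esub> \<one>\<^bsub>residue_ring (int d)\<^esub> \<in> Units (residue_ring (int d)) \<longleftrightarrow> coprime (a - 1) (int d)"
proof -
  interpret residues "int d" "residue_ring (int d)" using assms by (simp add: residues_def)
  have "a \<ominus>\<^bsub>residue_ring (int d)\<^esub> \<one>\<^bsub>residue_ring (int d)\<^esub> = (a - 1) mod int d"
    by (simp add: a_minus_def res_add_eq res_neg_eq res_one_eq mod_add_right_eq)
  also have "\<dots> = a - 1" using assms by simp
  finally have e: "a \<ominus>\<^bsub>residue_ring (int d)\<^esub> \<one>\<^bsub>residue_ring (int d)\<^esub> = a - 1" .
  have "a - 1 \<noteq> 0" if "coprime (a - 1) (int d)" using that assms(1) by auto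
  then show ?thesis unfolding e res_units_eq using assms by auto
qed

text \<open>\<open>X^d - u\<close> is separable: \<open>X\<close> times its derivative divided by
  \<open>d\<close>, minus the polynomial itself, is the nonzero constant \<open>u\<close>.\<close>

lemma separably_closed_roots:
  assumes sep: "\<forall>p :: 'a::field poly. Polynomial.degree p > 0 \<longrightarrow> coprime p (pderiv p) \<longrightarrow> (\<exists>x. poly p x = 0)"
    and d: "d > 0" "of_nat d \<noteq> (0::'a)" and u: "u \<noteq> (0::'a)"
  shows "\<exists>r. r ^ d = u"
proof -
  let ?p = "Polynomial.monom 1 d + [:- u:]"
  have "Polynomial.degree ?p = d"
    by (subst degree_add_eq_left) (use d in \<open>simp_all add: degree_monom_eq\<close>)
  moreover have "coprime ?p (pderiv ?p)"
  proof (rule coprimeI)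
    fix q assume q: "q dvd ?p" "q dvd pderiv ?p"
    have "pderiv ?p = Polynomial.monom (of_nat d) (d - 1)"
      by (simp add: pderiv_add pderiv_monom pderiv_pCons)
    then have "[:0, 1 / of_nat d:] * pderiv ?p = Polynomial.monom 1 d"
      using d by (simp add: smult_monom flip: monom_Suc)
    then have "[:0, 1 / of_nat d:] * pderiv ?p - ?p = [:u:]" by simp
    moreover have "q dvd [:0, 1 / of_nat d:] * pderiv ?p - ?p" using q by (intro dvd_diff dvd_mult)
    ultimately have "q dvd [:u:]" by simp
    moreover have "is_unit [:u:]" using u by (simp add: is_unit_const_poly_iff dvd_field_iff)
    ultimately show "is_unit q" by (rule dvd_unit_imp_unit)
  qed
  ultimately obtain x where "poly ?p x = 0" using sep[rule_format, of ?p] d(1) by auto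
  then show ?thesis by (auto simp: poly_monom)
qed

text \<open>The fixed-point proportion averages over the multipliers that occur, so its denominator
  is \<open>card I\<close>; this equals \<open>totient d\<close> when every unit modulo
  \<open>d\<close> occurs, as over the rationals. Convergence is asserted separately, since
  \<open>lim\<close> alone does not express it.\<close>

theorem theorem1:
  fixes d :: nat and K :: "'a::field set" and t c \<xi> :: 'a and \<alpha> :: "nat list \<Rightarrow> 'a"
  assumes "d \<ge> 2"
    and "subfield K ring_of_type_algebra"
    and "\<not> CHAR('a) dvd d"
    and "ring.transcendental ring_of_type_algebra K t"
    and "ambient_separable_closure_of (adjoin K {t})"
    and "c \<in> K"
    and "separable_over K \<xi>" and "primitive_root_of_unity d \<xi>"
    and "post_critically_infinite_at_0 (unicritical d c)"
    and "preimage_labelling d \<xi> c t \<alpha>"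
  defines "G \<equiv> G_inf d K (unicritical d c) t \<alpha>"
    and "R \<equiv> residue_ring (int d)"
    and "I \<equiv> cyclotomic_image d K \<xi>"
  shows "regular_branch d G
    \<and> Hausdorff_dim d G = ereal (ln (real d) / ln (fact d))
    \<and> convergent (fixed_ratio d G)
    \<and> FPP d G = real (card {a \<in> I. a \<ominus>\<^bsub>R\<^esub> \<one>\<^bsub>R\<^esub> \<in> Units R}) / real (card I)
    \<and> (card I = totient d \<longrightarrow>
         FPP d G = real (card {a \<in> I. a \<ominus>\<^bsub>R\<^esub> \<one>\<^bsub>R\<^esub> \<in> Units R}) / real (totient d))
    \<and> (ring_of_type_algebra\<lparr>carrier := K\<rparr> \<simeq> (ring_of_type_algebra :: rat ring) \<longrightarrow>
         FPP d G = (\<Prod>p\<in>prime_factors d. (real p - 2) / (real p - 1))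
         \<and> (odd d \<longrightarrow> FPP d G > 0))"
proof -
  have d_nz: "of_nat d \<noteq> (0::'a)" using assms(3) by (simp add: of_nat_eq_0_iff_char_dvd)
  interpret T: unicritical_tower d K t c \<xi> \<alpha>
  proof
    show "sfield K" using assms(2) by (simp only: sfield_iff_subfield)
    show "\<exists>r. r ^ d = u" if "u \<noteq> (0::'a)" for u
      using separably_closed_roots[OF _ _ d_nz that] assms(1,5)
      unfolding ambient_separable_closure_of_def by simp
    show "(unit_map d c ^^ n) 0 \<noteq> (unit_map d c ^^ m) 0" if "n \<noteq> m" for n m
      using assms(9)[unfolded post_critically_infinite_at_0_def unicritical_eq, rule_format, OF that] .
  qed (rule assms d_nz)+
  interpret U: unit_group_mod d I unfolding I_def by (rule T.unit_group)
  have G: "G = affine_group d I" unfolding G_def I_def by (rule T.G_inf_eq)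
  have units: "{a \<in> I. a \<ominus>\<^bsub>R\<^esub> \<one>\<^bsub>R\<^esub> \<in> Units R} = {a \<in> I. coprime (a - 1) (int d)}"
    unfolding R_def I_def using residue_minus_one_unit[OF assms(1)] by (auto simp: T.cyclotomic_image_iff)
  note lim = U.affine_FPP
  have FPP: "FPP d G = real (card {a \<in> I. coprime (a - 1) (int d)}) / real (card I)"
    unfolding FPP_def G by (rule limI[OF lim])
  have rational: "FPP d G = (\<Prod>p\<in>prime_factors d. (real p - 2) / (real p - 1)) \<and> (odd d \<longrightarrow> FPP d G > 0)"
    if iso: "ring_of_type_algebra\<lparr>carrier := K\<rparr> \<simeq> (ring_of_type_algebra :: rat ring)"
  proof
    have I: "I = {a. 0 < a \<and> a < int d \<and> coprime a (int d)}"
      unfolding I_def by (rule T.cyclotomic_image_rational[OF iso])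
    have "card I = totient d" unfolding I by (rule card_units_below[OF assms(1)])
    moreover have "{a \<in> I. coprime (a - 1) (int d)} = {a. 0 < a \<and> a < int d \<and> coprime a (int d) \<and> coprime (a - 1) (int d)}"
      unfolding I by blast
    ultimately show F: "FPP d G = (\<Prod>p\<in>prime_factors d. (real p - 2) / (real p - 1))"
      unfolding FPP using card_consecutive_units[OF assms(1)] consecutive_units_ratio[of d] assms(1) by simp
    show "odd d \<longrightarrow> FPP d G > 0"
    proof
      assume odd: "odd d"
      show "FPP d G > 0"
        unfolding F
      proof (rule prod_pos)
        fix p assume p: "p \<in> prime_factors d"
        then have "prime p" "p dvd d" by auto
        then have "p \<noteq> 2" "p \<ge> 2" using odd prime_ge_2_nat by auto
        then show "0 < (real p - 2) / (real p - 1)" by simp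
      qed
    qed
  qed
  have "convergent (fixed_ratio d G)" using lim unfolding G convergent_def by blast
  moreover have "regular_branch d G" "Hausdorff_dim d G = ereal (ln (real d) / ln (fact d))"
    unfolding G by (rule U.affine_regular_branch, rule U.affine_Hausdorff)
  ultimately show ?thesis
    unfolding units using FPP rational by (intro conjI impI) (assumption | simp | blast)+
qed

end
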